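(* Let $n\ge 1$, $d\ge 1$ be integers, let $\mathbf{X}=S^{n-1}\times S^{n-1}=\{(\mathbf{x},\mathbf{y})\in\mathbb{R}^n\times\mathbb{R}^n:\ 1-\|\mathbf{x}\|^2=0,\ 1-\|\mathbf{y}\|^2=0\}$, and let $q\in\mathbb{R}[\mathbf{x},\mathbf{y}]$ be a polynomial of degree $d$, with $q_{\min}=\min_{(\mathbf{x},\mathbf{y})\in\mathbf{X}}q(\mathbf{x},\mathbf{y})$ and $q_{\max}=\max_{(\mathbf{x},\mathbf{y})\in\mathbf{X}}q(\mathbf{x},\mathbf{y})$. Then for every integer $t\ge 2nd\sqrt{d}$, $$q_{\min}-\mathrm{lb}(q,\mathcal{T}(\mathbf{X}))_{2t}\le \frac{C_{\mathbf{X}}(n,d)}{t^2}\,(q_{\max}-q_{\min}),$$ where $C_{\mathbf{X}}(n,d):=8\,n^2 d^3\binom{d+2}{2}\,\gamma(S^{n-1})_d^2$ depends only on $n$ and $d$.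
   Context: For $\mathbf{x}\in\mathbb{R}^n$, $\|\mathbf{x}\|$ is the Euclidean norm. $\Sigma[\mathbf{x},\mathbf{y}]$ denotes the cone of sums of squares of real polynomials. For an integer $s$, the truncated preordering of $\mathbf{X}$ is $\mathcal{T}(\mathbf{X})_{2s}:=\{\sigma+h_1(1-\|\mathbf{x}\|^2)+h_2(1-\|\mathbf{y}\|^2):\ \sigma\in\Sigma[\mathbf{x},\mathbf{y}],\ \deg\sigma\le 2s,\ h_1,h_2\in\mathbb{R}[\mathbf{x},\mathbf{y}],\ \deg h_i\le 2s-2\}$, and $\mathrm{lb}(q,\mathcal{T}(\mathbf{X}))_s:=\sup\{\tau\in\mathbb{R}:\ q-\tau\in\mathcal{T}(\mathbf{X})_{2s}\}$. Harmonic constant: equip $S^{n-1}$ with the uniform (rotation-invariant) probability measure; let $H_k$ be the space of spherical harmonics of degree $k$ (restrictions to $S^{n-1}$ of harmonic homogeneous polynomials of degree $k$). Every $p\in\mathbb{R}[\mathbf{x}]_d$ (polynomials of degree at most $d$) satisfies $p=\sum_{k=0}^d p_k$ on $S^{n-1}$ with $p_k\in H_k$ (orthogonal projections). With $\|p\|_{S^{n-1}}=\max_{\mathbf{x}\in S^{n-1}}|p(\mathbf{x})|$, define $\gamma(S^{n-1})_d:=\max_{p\in\mathbb{R}[\mathbf{x}]_d,\,p\not\equiv 0 \text{ on } S^{n-1}}\ \max_{0\le k\le d}\|p_k\|_{S^{n-1}}/\|p\|_{S^{n-1}}$. *)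

theory Defs
  imports "HOL-Analysis.Analysis"
begin

text \<open>Multivariate real polynomials are rendered as polynomial functions on
 points z :: 'v \<Rightarrow> real, 'v a finite index type of variables.
 Over the reals polynomial functions and polynomials coincide.\<close>

definition monom :: "('v::finite \<Rightarrow> nat) \<Rightarrow> ('v \<Rightarrow> real) \<Rightarrow> real" where
  "monom a z = (\<Prod>i\<in>UNIV. z i ^ a i)"

definition polys :: "nat \<Rightarrow> (('v::finite \<Rightarrow> real) \<Rightarrow> real) set" where
  "polys d = {f. \<exists>c. \<forall>z. f z = (\<Sum>a\<in>{a. sum a UNIV \<le> d}. c a * monom a z)}"

definition hom_polys :: "nat \<Rightarrow> (('v::finite \<Rightarrow> real) \<Rightarrow> real) set" where
  "hom_polys k = {f. \<exists>c. \<forall>z. f z = (\<Sum>a\<in>{a. sum a UNIV = k}. c a * monom a z)}"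

definition laplacian :: "(('v::finite \<Rightarrow> real) \<Rightarrow> real) \<Rightarrow> ('v \<Rightarrow> real) \<Rightarrow> real" where
  "laplacian f z = (\<Sum>i\<in>UNIV. deriv (\<lambda>t. deriv (\<lambda>s. f (z(i := z i + s))) t) 0)"

text \<open>Harmonic homogeneous polynomials of degree k (their restrictions to the
 sphere form the space H_k of spherical harmonics).\<close>
definition harm_polys :: "nat \<Rightarrow> (('v::finite \<Rightarrow> real) \<Rightarrow> real) set" where
  "harm_polys k = {f. f \<in> hom_polys k \<and> (\<forall>z. laplacian f z = 0)}"

definition sq_norm :: "('v::finite \<Rightarrow> real) \<Rightarrow> real" where
  "sq_norm z = (\<Sum>i\<in>UNIV. (z i)^2)"

definition sphere_set :: "('v::finite \<Rightarrow> real) set" where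
  "sphere_set = {z. sq_norm z = 1}"

definition sph_norm :: "(('v::finite \<Rightarrow> real) \<Rightarrow> real) \<Rightarrow> real" where
  "sph_norm p = Sup ((\<lambda>z. \<bar>p z\<bar>) ` sphere_set)"

text \<open>Harmonic constant gamma(S^{n-1})_d, with n = CARD('n).  The components
 p_k of the harmonic decomposition p = sum p_k on the sphere (p_k in H_k) are
 unique, so the maximum over the data below is the maximum over k and p.\<close>
definition gamma_sph :: "'n::finite itself \<Rightarrow> nat \<Rightarrow> real" where
  "gamma_sph _ d = Sup {sph_norm (h k) / sph_norm p | p h k.
      (p :: ('n \<Rightarrow> real) \<Rightarrow> real) \<in> polys d \<and> (\<exists>z\<in>sphere_set. p z \<noteq> 0) \<and>
      (\<forall>j\<le>d. h j \<in> harm_polys j) \<and>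
      (\<forall>z\<in>sphere_set. p z = (\<Sum>j\<le>d. h j z)) \<and> k \<le> d}"

definition xpart :: "('n + 'n \<Rightarrow> real) \<Rightarrow> ('n \<Rightarrow> real)" where
  "xpart z = (\<lambda>i. z (Inl i))"
definition ypart :: "('n + 'n \<Rightarrow> real) \<Rightarrow> ('n \<Rightarrow> real)" where
  "ypart z = (\<lambda>i. z (Inr i))"

definition XX :: "('n::finite + 'n \<Rightarrow> real) set" where
  "XX = {z. sq_norm (xpart z) = 1 \<and> sq_norm (ypart z) = 1}"

definition is_sos :: "(('v::finite \<Rightarrow> real) \<Rightarrow> real) \<Rightarrow> bool" where
  "is_sos \<sigma> \<longleftrightarrow> (\<exists>fs. (\<forall>f\<in>set fs. \<exists>e. f \<in> polys e) \<and> \<sigma> = (\<lambda>z. \<Sum>f\<leftarrow>fs. (f z)^2))"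

definition trunc_preord :: "nat \<Rightarrow> (('n::finite + 'n \<Rightarrow> real) \<Rightarrow> real) set" where
  "trunc_preord s = {g. \<exists>\<sigma> h1 h2. is_sos \<sigma> \<and> \<sigma> \<in> polys (2 * s) \<and>
      h1 \<in> polys (2 * s - 2) \<and> h2 \<in> polys (2 * s - 2) \<and>
      g = (\<lambda>z. \<sigma> z + h1 z * (1 - sq_norm (xpart z)) + h2 z * (1 - sq_norm (ypart z)))}"

text \<open>lb(q, T(X))_s as an extended real (sup of the empty set is -infinity).\<close>
definition lb :: "(('n::finite + 'n \<Rightarrow> real) \<Rightarrow> real) \<Rightarrow> nat \<Rightarrow> ereal" where
  "lb q s = Sup (ereal ` {\<tau>. (\<lambda>z. q z - \<tau>) \<in> trunc_preord s})"

definition C_X :: "'n::finite itself \<Rightarrow> nat \<Rightarrow> real" where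
  "C_X T d = 8 * real (CARD('n))^2 * real d^3 * real ((d+2) choose 2) * (gamma_sph T d)^2"

end

(* The sphere enters only through harmonic polynomials. Dividing by |x|^2 shows that every polynomial
   agrees on the sphere with a harmonic one; its value at the centre is taken as the spherical mean,
   which is a positive functional by the maximum principle, and Euler's identity yields the Funk-Hecke
   formula. Hence a kernel u(<x,y>)^2 acts on spherical harmonics of degree k as a scalar lam k. Choosing
   u = P / (s - xi), with xi the root nearest 1 of a Gegenbauer polynomial P of degree t + 1, gives
   1 - lam k <= k^2 n^2 / t^2. The product kernel is inverted on the harmonic components of
   q - q_min + delta; the components are bounded by gamma^2, so the preimage is nonnegative on the product
   of the spheres for the stated delta. Applying the kernel turns nonnegativity into a sum of squares,
   because a positive functional has a positive semidefinite Gram matrix, and the remainder vanishes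
   on the product, hence lies in the truncated ideal. *)

theory Submission
  imports Defs "HOL-Computational_Algebra.Polynomial"
begin

text \<open>What the argument asks of integration over a sphere is linearity, positivity and the
  identity \<open>sph_mean_laplacian\<close>; all three follow from the harmonic decomposition. A
  genuine integral occurs in one variable only: the moments of the weight sin^\<open>\<nu>\<close>
  obey the recurrence of \<open>fh_coeff\<close> in degree 0, so the concentration of the kernel
  becomes an extremal problem for \<open>zint\<close>. The kernel has to be a square, so that a
  nonnegative preimage yields squares, and its eigenvalues have to be near 1, so that the preimage
  stays nonnegative. With degree t for u, the squared product over two spheres has degree 4 t, which
  is why the bound concerns level 2 t. Constants: t >= 2 n d sqrt d says n^2 d^3 / t^2 <= 1/4; the
  binomial coefficient counts bidegrees (j, k) with j + k <= d; the square of gamma comes from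
  decomposing first in x, then in y; 8 bounds the distortion due to inverted eigenvalues. The case n
  = 1 is separate: the sphere has two points and the weight exponent n - 2 would be
  negative.\<close>

subsection \<open>Polynomial functions\<close>

text \<open>Covers \<open>polys\<close> and \<open>hom_polys\<close> by one index set, so that the
  closure properties are proved once for both.\<close>

definition mspan :: "('v::finite \<Rightarrow> nat) set \<Rightarrow> (('v \<Rightarrow> real) \<Rightarrow> real) set" where
  "mspan I = {f. \<exists>c. \<forall>z. f z = (\<Sum>a\<in>I. c a * Defs.monom a z)}"

definition polyfun :: "(('v::finite \<Rightarrow> real) \<Rightarrow> real) set" where
  "polyfun = {f. \<exists>e. f \<in> polys e}"

lemma polys_mspan: "polys d = mspan {a. sum a UNIV \<le> d}"
  by (simp add: polys_def mspan_def)

lemma hom_polys_mspan: "hom_polys d = mspan {a. sum a UNIV = d}"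
  by (simp add: hom_polys_def mspan_def)

lemma finite_index_le [simp]: "finite {a::'v::finite \<Rightarrow> nat. sum a UNIV \<le> d}"
proof (rule finite_subset[of _ "PiE UNIV (\<lambda>_. {..d})"])
  have "a x \<le> d" if "sum a UNIV \<le> d" for a :: "'v \<Rightarrow> nat" and x
    using member_le_sum[of x UNIV a] that by simp
  then show "{a::'v \<Rightarrow> nat. sum a UNIV \<le> d} \<subseteq> PiE UNIV (\<lambda>_. {..d})"
    by (auto simp: PiE_def)
  show "finite (PiE (UNIV::'v set) (\<lambda>_. {..d}))" by (intro finite_PiE) auto
qed

lemma finite_index_eq [simp]: "finite {a::'v::finite \<Rightarrow> nat. sum a UNIV = d}"
  by (rule finite_subset[OF _ finite_index_le[of d]]) auto

lemma mspan_zero: "(\<lambda>z. 0) \<in> mspan I"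
  unfolding mspan_def by (auto intro: exI[of _ "\<lambda>_. 0"])

lemma mspan_add: "f \<in> mspan I \<Longrightarrow> g \<in> mspan I \<Longrightarrow> (\<lambda>z. f z + g z) \<in> mspan I"
  unfolding mspan_def
proof clarsimp
  fix c c' assume "\<forall>z. f z = (\<Sum>a\<in>I. c a * Defs.monom a z)" "\<forall>z. g z = (\<Sum>a\<in>I. c' a * Defs.monom a z)"
  then show "\<exists>c''. \<forall>z. (\<Sum>a\<in>I. c a * Defs.monom a z) + (\<Sum>a\<in>I. c' a * Defs.monom a z)
     = (\<Sum>a\<in>I. c'' a * Defs.monom a z)"
    by (intro exI[of _ "\<lambda>a. c a + c' a"]) (simp add: distrib_right sum.distrib)
qed

lemma mspan_cmult: "f \<in> mspan I \<Longrightarrow> (\<lambda>z. c * f z) \<in> mspan I"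
  unfolding mspan_def
proof clarsimp
  fix c'
  show "\<exists>c''. \<forall>z. c * (\<Sum>a\<in>I. c' a * Defs.monom a z) = (\<Sum>a\<in>I. c'' a * Defs.monom a z)"
    by (intro exI[of _ "\<lambda>a. c * c' a"]) (simp add: sum_distrib_left mult.assoc)
qed

lemma mspan_sum: "(\<And>s. s \<in> S \<Longrightarrow> f s \<in> mspan I) \<Longrightarrow> (\<lambda>z. \<Sum>s\<in>S. f s z) \<in> mspan I"
  by (induction S rule: infinite_finite_induct) (auto intro: mspan_zero mspan_add)

lemma mspan_monom: "finite I \<Longrightarrow> a \<in> I \<Longrightarrow> Defs.monom a \<in> mspan I"
  unfolding mspan_def
  by (auto intro!: exI[of _ "\<lambda>b. if b = a then 1 else 0"] simp: if_distrib[of "\<lambda>x. x * _"] cong: if_cong)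

text \<open>The last two cases retain membership in \<open>mspan I\<close>, because the
  differentiation rules applied in such inductions are stated for polynomial functions.\<close>

lemma mspan_induct [consumes 1, case_names finite zero monom cmult add]:
  assumes "f \<in> mspan I" "finite I"
    and z: "Q (\<lambda>z. 0)" and m: "\<And>a. a \<in> I \<Longrightarrow> Q (Defs.monom a)"
    and s: "\<And>c f. f \<in> mspan I \<Longrightarrow> Q f \<Longrightarrow> Q (\<lambda>z. c * f z)"
    and p: "\<And>f g. f \<in> mspan I \<Longrightarrow> g \<in> mspan I \<Longrightarrow> Q f \<Longrightarrow> Q g \<Longrightarrow> Q (\<lambda>z. f z + g z)"
  shows "Q f"
proof -
  obtain c where c: "\<And>z. f z = (\<Sum>a\<in>I. c a * Defs.monom a z)"
    using assms(1) by (auto simp: mspan_def)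
  have "J \<subseteq> I \<Longrightarrow> Q (\<lambda>z. \<Sum>a\<in>J. c a * Defs.monom a z)" if "finite J" for J
    using that
  proof induction
    case (insert x F)
    have "(\<lambda>z. \<Sum>a\<in>F. c a * Defs.monom a z) \<in> mspan I"
      using insert assms(2) by (intro mspan_sum mspan_cmult mspan_monom) auto
    with insert show ?case
      by (auto intro!: p s m mspan_cmult mspan_monom assms(2))
  qed (simp add: z)
  from this[of I] assms(2) have "Q (\<lambda>z. \<Sum>a\<in>I. c a * Defs.monom a z)" by simp
  moreover have "f = (\<lambda>z. \<Sum>a\<in>I. c a * Defs.monom a z)" using c by auto
  ultimately show ?thesis by simp
qed

lemma mspan_mono:
  assumes "f \<in> mspan I" "I \<subseteq> J" "finite J"
  shows "f \<in> mspan J"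
  using assms(1)
  by (induction rule: mspan_induct)
     (use assms finite_subset[OF assms(2,3)] in \<open>auto intro: mspan_zero mspan_monom mspan_cmult mspan_add\<close>)

lemma monom_mult: "Defs.monom a z * Defs.monom b z = Defs.monom (\<lambda>i. a i + b i) z"
  by (simp add: Defs.monom_def power_add prod.distrib)

lemma mspan_mult:
  assumes "f \<in> mspan I" "g \<in> mspan J" "finite I" "finite J" "finite K"
    and K: "\<And>a b. a \<in> I \<Longrightarrow> b \<in> J \<Longrightarrow> (\<lambda>i. a i + b i) \<in> K"
  shows "(\<lambda>z. f z * g z) \<in> mspan K"
proof -
  obtain c where c: "\<And>z. f z = (\<Sum>a\<in>I. c a * Defs.monom a z)"
    using assms(1) by (auto simp: mspan_def)
  obtain c' where c': "\<And>z. g z = (\<Sum>a\<in>J. c' a * Defs.monom a z)"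
    using assms(2) by (auto simp: mspan_def)
  have "(\<lambda>z. \<Sum>a\<in>I. \<Sum>b\<in>J. (c a * c' b) * Defs.monom (\<lambda>i. a i + b i) z) \<in> mspan K"
    using K assms by (intro mspan_sum mspan_cmult mspan_monom) auto
  also have "(\<lambda>z. \<Sum>a\<in>I. \<Sum>b\<in>J. (c a * c' b) * Defs.monom (\<lambda>i. a i + b i) z) = (\<lambda>z. f z * g z)"
    unfolding c c' sum_product by (simp add: monom_mult[symmetric] mult_ac)
  finally show ?thesis .
qed

lemma polys_zero: "(\<lambda>z. 0) \<in> polys d"
  and polys_add: "f \<in> polys d \<Longrightarrow> g \<in> polys d \<Longrightarrow> (\<lambda>z. f z + g z) \<in> polys d"
  and polys_cmult: "f \<in> polys d \<Longrightarrow> (\<lambda>z. c * f z) \<in> polys d"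
  and polys_sum: "(\<And>s. s \<in> S \<Longrightarrow> h s \<in> polys d) \<Longrightarrow> (\<lambda>z. \<Sum>s\<in>S. h s z) \<in> polys d"
  and hom_zero: "(\<lambda>z. 0) \<in> hom_polys d"
  and hom_add: "f \<in> hom_polys d \<Longrightarrow> g \<in> hom_polys d \<Longrightarrow> (\<lambda>z. f z + g z) \<in> hom_polys d"
  and hom_cmult: "f \<in> hom_polys d \<Longrightarrow> (\<lambda>z. c * f z) \<in> hom_polys d"
  and hom_sum: "(\<And>s. s \<in> S \<Longrightarrow> h s \<in> hom_polys d) \<Longrightarrow> (\<lambda>z. \<Sum>s\<in>S. h s z) \<in> hom_polys d"
  unfolding polys_mspan hom_polys_mspan
  by (simp_all add: mspan_zero mspan_add mspan_cmult mspan_sum)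

lemma polys_mult: "f \<in> polys d \<Longrightarrow> g \<in> polys e \<Longrightarrow> (\<lambda>z. f z * g z) \<in> polys (d + e)"
  unfolding polys_mspan by (rule mspan_mult) (auto simp: sum.distrib)

lemma hom_mult: "f \<in> hom_polys d \<Longrightarrow> g \<in> hom_polys e \<Longrightarrow> (\<lambda>z. f z * g z) \<in> hom_polys (d + e)"
  unfolding hom_polys_mspan by (rule mspan_mult) (auto simp: sum.distrib)

lemma polys_mono: "f \<in> polys d \<Longrightarrow> d \<le> e \<Longrightarrow> f \<in> polys e"
  unfolding polys_mspan by (rule mspan_mono) auto

lemma hom_imp_polys: "f \<in> hom_polys d \<Longrightarrow> d \<le> e \<Longrightarrow> f \<in> polys e"
  unfolding polys_mspan hom_polys_mspan by (rule mspan_mono) auto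

lemma hom_monom: "Defs.monom a \<in> hom_polys (sum a UNIV)"
  unfolding hom_polys_mspan by (rule mspan_monom) auto

lemma hom_const: "(\<lambda>z. c) \<in> hom_polys 0"
  using hom_cmult[OF hom_monom[of "\<lambda>_. 0"], of c] by (simp add: Defs.monom_def)

lemma polys_const: "(\<lambda>z. c) \<in> polys d"
  by (rule hom_imp_polys[OF hom_const]) simp

lemma hom_coord: "(\<lambda>z. z i) \<in> hom_polys 1"
proof -
  have "Defs.monom (\<lambda>j. if j = i then 1 else 0) = (\<lambda>z. z i)"
    by (auto simp: Defs.monom_def if_distrib[of "\<lambda>k. _ ^ k"] cong: if_cong)
  with hom_monom[of "\<lambda>j. if j = i then 1 else 0"] show ?thesis by simp
qed

lemma hom_power: "f \<in> hom_polys d \<Longrightarrow> (\<lambda>z. f z ^ m) \<in> hom_polys (d * m)"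
  by (induction m) (auto intro: hom_const dest: hom_mult)

lemma hom_sq_norm: "sq_norm \<in> hom_polys 2"
proof -
  have "(\<lambda>z. \<Sum>i\<in>UNIV. z i ^ 2) \<in> hom_polys 2"
    by (intro hom_sum) (use hom_power[OF hom_coord] in fastforce)
  then show ?thesis by (simp add: sq_norm_def[abs_def])
qed

lemma polyfunI: "f \<in> polys d \<Longrightarrow> f \<in> polyfun"
  by (auto simp: polyfun_def)

lemma polyfun_hom: "f \<in> hom_polys d \<Longrightarrow> f \<in> polyfun"
  by (auto intro: polyfunI hom_imp_polys)

lemma polyfun_const: "(\<lambda>z. c) \<in> polyfun"
  by (rule polyfunI[OF polys_const[of _ 0]])

lemma polyfun_coord: "(\<lambda>z. z i) \<in> polyfun"
  by (rule polyfun_hom[OF hom_coord])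

lemma polyfun_add: "f \<in> polyfun \<Longrightarrow> g \<in> polyfun \<Longrightarrow> (\<lambda>z. f z + g z) \<in> polyfun"
proof -
  assume "f \<in> polyfun" "g \<in> polyfun"
  then obtain d e where "f \<in> polys d" "g \<in> polys e" by (auto simp: polyfun_def)
  then have "f \<in> polys (max d e)" "g \<in> polys (max d e)" by (auto elim: polys_mono)
  then show ?thesis by (intro polyfunI polys_add)
qed

lemma polyfun_mult: "f \<in> polyfun \<Longrightarrow> g \<in> polyfun \<Longrightarrow> (\<lambda>z. f z * g z) \<in> polyfun"
  by (auto simp: polyfun_def dest: polys_mult)

lemma polyfun_cmult: "f \<in> polyfun \<Longrightarrow> (\<lambda>z. c * f z) \<in> polyfun"
  by (rule polyfun_mult[OF polyfun_const])

lemma polyfun_diff: "f \<in> polyfun \<Longrightarrow> g \<in> polyfun \<Longrightarrow> (\<lambda>z. f z - g z) \<in> polyfun"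
  using polyfun_add[of f "\<lambda>z. (-1) * g z"] polyfun_cmult[of g "-1"] by simp

lemma polyfun_sum: "(\<And>s. s \<in> S \<Longrightarrow> f s \<in> polyfun) \<Longrightarrow> (\<lambda>z. \<Sum>s\<in>S. f s z) \<in> polyfun"
  by (induction S rule: infinite_finite_induct) (auto intro: polyfun_const polyfun_add)

lemma polyfun_power: "f \<in> polyfun \<Longrightarrow> (\<lambda>z. f z ^ m) \<in> polyfun"
  by (induction m) (auto intro: polyfun_const polyfun_mult)

lemma polyfun_sq_norm: "sq_norm \<in> polyfun"
  by (rule polyfun_hom[OF hom_sq_norm])

lemmas polyfun_intros = polyfun_const polyfun_coord polyfun_add polyfun_mult polyfun_diff
  polyfun_sum polyfun_power polyfun_sq_norm

lemma polyfun_induct [consumes 1, case_names monom cmult add]: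
  assumes "f \<in> polyfun"
    and m: "\<And>a. Q (Defs.monom a)"
    and s: "\<And>c f. f \<in> polyfun \<Longrightarrow> Q f \<Longrightarrow> Q (\<lambda>z. c * f z)"
    and p: "\<And>f g. f \<in> polyfun \<Longrightarrow> g \<in> polyfun \<Longrightarrow> Q f \<Longrightarrow> Q g \<Longrightarrow> Q (\<lambda>z. f z + g z)"
  shows "Q f"
proof -
  obtain e where "f \<in> polys e" using assms(1) by (auto simp: polyfun_def)
  then have "f \<in> mspan {a. sum a UNIV \<le> e}" by (simp add: polys_mspan)
  then show ?thesis
  proof (induction rule: mspan_induct)
    \<comment> \<open>The rule offers no case for 0, so 0 is produced as a multiple of a
      monomial.\<close>
    case zero
    have "Q (\<lambda>z. 0 * Defs.monom (\<lambda>_. 0) z)"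
      by (rule s) (auto intro: m polyfun_hom hom_monom)
    then show ?case by simp
  qed (auto intro: m s p simp: polys_mspan[symmetric] intro: polyfunI)
qed

subsection \<open>Partial derivatives and the Laplacian\<close>

definition pd :: "'v \<Rightarrow> (('v::finite \<Rightarrow> real) \<Rightarrow> real) \<Rightarrow> ('v \<Rightarrow> real) \<Rightarrow> real" where
  "pd i f z = deriv (\<lambda>s. f (z(i := s))) (z i)"

lemma monom_fun_upd: "Defs.monom a (z(i := s)) = s ^ a i * (\<Prod>j\<in>UNIV-{i}. z j ^ a j)"
proof -
  have "Defs.monom a (z(i := s)) = s ^ a i * (\<Prod>j\<in>UNIV-{i}. (z(i:=s)) j ^ a j)"
    unfolding Defs.monom_def by (subst prod.remove[of _ i]) auto
  then show ?thesis by simp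
qed

lemma DERIV_monom: "((\<lambda>s. Defs.monom a (z(i := s))) has_real_derivative
    (real (a i) * Defs.monom (a(i := a i - 1)) (z(i := s)))) (at s)"
  unfolding monom_fun_upd by (auto intro!: derivative_eq_intros)

text \<open>The derivative is given along the whole coordinate line, not just at \<open>z i\<close>,
  since the Laplacian and the second-derivative test at a minimum differentiate it again.\<close>

lemma DERIV_pd:
  assumes "f \<in> polyfun"
  shows "((\<lambda>s. f (z(i := s))) has_real_derivative pd i f (z(i := s))) (at s)"
proof -
  have "\<exists>D. ((\<lambda>s. f (z(i := s))) has_real_derivative D) (at s)"
    using assms
  proof (induction rule: polyfun_induct)
    case (monom a) show ?case using DERIV_monom by blast
  next
    case (cmult c f) then show ?case using DERIV_cmult by blast
  next
    case (add f g) then show ?case using DERIV_add by blast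
  qed
  then show ?thesis by (auto simp: pd_def dest: DERIV_imp_deriv)
qed

lemma pd_eqI:
  assumes "((\<lambda>s. f (z(i := s))) has_real_derivative D) (at (z i))"
  shows "pd i f z = D"
  using assms by (simp add: pd_def DERIV_imp_deriv)

lemma DERIV_pd': "f \<in> polyfun \<Longrightarrow> ((\<lambda>s. f (z(i := s))) has_real_derivative pd i f z) (at (z i))"
  using DERIV_pd[of f z i "z i"] by simp

lemma pd_monom: "pd i (Defs.monom a) = (\<lambda>z. real (a i) * Defs.monom (a(i := a i - 1)) z)"
proof (intro ext pd_eqI)
  fix z show "((\<lambda>s. Defs.monom a (z(i := s))) has_real_derivative
      real (a i) * Defs.monom (a(i := a i - 1)) z) (at (z i))"
    using DERIV_monom[of a z i "z i"] by (simp only: fun_upd_triv)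
qed

lemma pd_const: "pd i (\<lambda>z. c) = (\<lambda>z. 0)"
  by (intro ext pd_eqI) auto

lemma pd_coord: "pd i (\<lambda>z. z j) = (\<lambda>z. if i = j then 1 else 0)"
  by (intro ext pd_eqI) auto

lemma pd_add: "f \<in> polyfun \<Longrightarrow> g \<in> polyfun \<Longrightarrow> pd i (\<lambda>z. f z + g z) = (\<lambda>z. pd i f z + pd i g z)"
  by (intro ext pd_eqI DERIV_add DERIV_pd')

lemma pd_diff: "f \<in> polyfun \<Longrightarrow> g \<in> polyfun \<Longrightarrow> pd i (\<lambda>z. f z - g z) = (\<lambda>z. pd i f z - pd i g z)"
  by (intro ext pd_eqI DERIV_diff DERIV_pd')

lemma pd_cmult: "f \<in> polyfun \<Longrightarrow> pd i (\<lambda>z. c * f z) = (\<lambda>z. c * pd i f z)"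
  by (intro ext pd_eqI DERIV_cmult DERIV_pd')

lemma pd_mult: "f \<in> polyfun \<Longrightarrow> g \<in> polyfun \<Longrightarrow>
    pd i (\<lambda>z. f z * g z) = (\<lambda>z. pd i f z * g z + f z * pd i g z)"
  by (intro ext pd_eqI, rule DERIV_cong[OF DERIV_mult[OF DERIV_pd' DERIV_pd']]) (auto simp: algebra_simps)

lemma pd_power: "f \<in> polyfun \<Longrightarrow> pd i (\<lambda>z. f z ^ m) = (\<lambda>z. real m * f z ^ (m - 1) * pd i f z)"
  by (intro ext pd_eqI, rule DERIV_cong[OF DERIV_power[OF DERIV_pd']]) (auto simp: algebra_simps)

lemma pd_sum: "(\<And>s. s \<in> S \<Longrightarrow> f s \<in> polyfun) \<Longrightarrow>
    pd i (\<lambda>z. \<Sum>s\<in>S. f s z) = (\<lambda>z. \<Sum>s\<in>S. pd i (f s) z)"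
  by (intro ext pd_eqI DERIV_sum DERIV_pd')

lemma pd_hom: "f \<in> hom_polys k \<Longrightarrow> pd i f \<in> hom_polys (k - 1)"
proof -
  assume "f \<in> hom_polys k"
  then have "f \<in> mspan {a. sum a UNIV = k}" by (simp add: hom_polys_mspan)
  then show ?thesis
  proof (induction rule: mspan_induct)
    case (monom a)
    show ?case
    \<comment> \<open>For \<open>a i = 0\<close> the truncated exponent \<open>a i - 1\<close>
      leaves the total degree unchanged; the factor \<open>real (a i)\<close> removes this
      term.\<close>
    proof (cases "a i = 0")
      case True then show ?thesis by (simp add: pd_monom hom_zero)
    next
      case False
      have "sum (a(i := a i - 1)) UNIV = sum a UNIV - 1"
        using False by (simp add: sum.remove[of UNIV i])
      then show ?thesis using monom hom_monom[of "a(i := a i - 1)"]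
        by (auto simp: pd_monom intro: hom_cmult)
    qed
  next
    case (cmult c f)
    then have "f \<in> polyfun" by (auto simp: hom_polys_mspan[symmetric] intro: polyfun_hom)
    then show ?case using cmult by (simp add: pd_cmult hom_cmult)
  next
    case (add f g)
    then have "f \<in> polyfun" "g \<in> polyfun" by (auto simp: hom_polys_mspan[symmetric] intro: polyfun_hom)
    then show ?case using add by (simp add: pd_add hom_add)
  qed (simp_all add: pd_const hom_zero)
qed

lemma hom_0_imp_const:
  fixes f :: "('v::finite \<Rightarrow> real) \<Rightarrow> real"
  assumes "f \<in> hom_polys 0"
  shows "f = (\<lambda>z. f w)"
proof -
  have "{a::'v \<Rightarrow> nat. sum a UNIV = 0} = {\<lambda>_. 0}" by auto
  with assms show ?thesis by (auto simp: hom_polys_def Defs.monom_def)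
qed

lemma pd_hom_0: "f \<in> hom_polys 0 \<Longrightarrow> pd i f = (\<lambda>z. 0)"
  by (subst hom_0_imp_const[of f undefined]) (simp_all add: pd_const)

lemma pd_polyfun: "f \<in> polyfun \<Longrightarrow> pd i f \<in> polyfun"
  by (induction rule: polyfun_induct)
     (auto simp: pd_monom pd_add pd_cmult intro!: polyfun_intros polyfun_hom[OF hom_monom])

lemma pd_commute: "f \<in> polyfun \<Longrightarrow> pd i (pd j f) = pd j (pd i f)"
proof (induction rule: polyfun_induct)
  case (monom a)
  show ?case
  proof (cases "i = j")
    case False
    then have "a(j := a j - 1, i := a i - 1) = a(i := a i - 1, j := a j - 1)"
      by (rule fun_upd_twist[OF not_sym])
    with False show ?thesis
      by (simp add: pd_monom pd_cmult polyfun_hom[OF hom_monom] mult.left_commute)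
  qed simp
qed (simp_all add: pd_add pd_cmult pd_polyfun)

lemma euler_identity:
  assumes "f \<in> hom_polys k"
  shows "(\<Sum>i\<in>UNIV. z i * pd i f z) = real k * f z"
proof -
  from assms have "f \<in> mspan {a. sum a UNIV = k}" by (simp add: hom_polys_mspan)
  then show ?thesis
  proof (induction rule: mspan_induct)
    case (monom a)
    have *: "z i * (real (a i) * Defs.monom (a(i := a i - 1)) z) = real (a i) * Defs.monom a z" for i
    proof (cases "a i = 0")
      case False
      then have "z i * Defs.monom (a(i := a i - 1)) z = Defs.monom a z"
        by (cases "a i") (auto simp: Defs.monom_def prod.remove[of UNIV i])
      then show ?thesis by (metis mult.left_commute)
    qed simp
    show ?case using monom
      unfolding pd_monom * sum_distrib_right[symmetric] by auto
  next
    case (cmult c f)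
    then have "f \<in> polyfun" by (auto simp: hom_polys_mspan[symmetric] intro: polyfun_hom)
    then show ?case using cmult by (simp add: pd_cmult mult.left_commute[of _ c] sum_distrib_left[symmetric])
  next
    case (add f g)
    then have "f \<in> polyfun" "g \<in> polyfun" by (auto simp: hom_polys_mspan[symmetric] intro: polyfun_hom)
    then show ?case using add by (simp add: pd_add distrib_left sum.distrib)
  next
    case zero
    show ?case by (simp only: pd_const) simp
  qed simp
qed

lemma hom_scale:
  fixes f :: "('v::finite \<Rightarrow> real) \<Rightarrow> real"
  assumes "f \<in> hom_polys k"
  shows "f (\<lambda>i. c * z i) = c ^ k * f z"
proof -
  from assms obtain C where C: "\<And>z. f z = (\<Sum>a\<in>{a. sum a UNIV = k}. C a * Defs.monom a z)"
    by (auto simp: hom_polys_def)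
  have "Defs.monom a (\<lambda>i. c * z i) = c ^ sum a UNIV * Defs.monom a z" for a :: "'v \<Rightarrow> nat"
    by (simp add: Defs.monom_def power_mult_distrib prod.distrib power_sum)
  then show ?thesis unfolding C by (simp add: sum_distrib_left mult_ac)
qed

text \<open>In \<open>laplacian\<close> the derivatives are taken in an increment at 0, in
  \<open>pd\<close> in the coordinate itself; a translation of the variable reconciles the
  two.\<close>

lemma laplacian_eq: "f \<in> polyfun \<Longrightarrow> laplacian f = (\<lambda>z. \<Sum>i\<in>UNIV. pd i (pd i f) z)"
proof (intro ext)
  fix z assume f: "f \<in> polyfun"
  have "((\<lambda>s. f (z(i := z i + s))) has_real_derivative pd i f (z(i := z i + t))) (at t)" for i t
    using DERIV_shift[of "\<lambda>s. f (z(i := s))" "pd i f (z(i := z i + t))" t "z i"] DERIV_pd[OF f, of z i "z i + t"]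
    by (simp add: add.commute)
  then have 1: "deriv (\<lambda>s. f (z(i := z i + s))) = (\<lambda>t. pd i f (z(i := z i + t)))" for i
    by (intro ext DERIV_imp_deriv)
  have "((\<lambda>t. pd i f (z(i := z i + t))) has_real_derivative pd i (pd i f) z) (at 0)" for i
    using DERIV_shift[of "\<lambda>s. pd i f (z(i := s))" "pd i (pd i f) z" 0 "z i"]
      DERIV_pd'[OF pd_polyfun[OF f, of i], where z = z and i = i]
    by (simp add: add.commute)
  then have "deriv (\<lambda>t. pd i f (z(i := z i + t))) 0 = pd i (pd i f) z" for i
    by (rule DERIV_imp_deriv)
  then show "laplacian f z = (\<Sum>i\<in>UNIV. pd i (pd i f) z)"
    by (simp add: laplacian_def 1)
qed

lemma laplacian_const: "laplacian (\<lambda>z. c) = (\<lambda>z. 0)"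
  by (simp add: laplacian_eq polyfun_intros pd_const)

lemma laplacian_add: "f \<in> polyfun \<Longrightarrow> g \<in> polyfun \<Longrightarrow>
    laplacian (\<lambda>z. f z + g z) = (\<lambda>z. laplacian f z + laplacian g z)"
  by (simp add: laplacian_eq polyfun_intros pd_add pd_polyfun sum.distrib)

lemma laplacian_cmult: "f \<in> polyfun \<Longrightarrow> laplacian (\<lambda>z. c * f z) = (\<lambda>z. c * laplacian f z)"
  by (simp add: laplacian_eq polyfun_intros pd_cmult pd_polyfun sum_distrib_left)

lemma laplacian_diff: "f \<in> polyfun \<Longrightarrow> g \<in> polyfun \<Longrightarrow>
    laplacian (\<lambda>z. f z - g z) = (\<lambda>z. laplacian f z - laplacian g z)"
  by (simp add: laplacian_eq polyfun_intros pd_diff pd_polyfun sum_subtractf)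

lemma laplacian_mult: "f \<in> polyfun \<Longrightarrow> g \<in> polyfun \<Longrightarrow>
    laplacian (\<lambda>z. f z * g z) =
      (\<lambda>z. laplacian f z * g z + f z * laplacian g z + 2 * (\<Sum>i\<in>UNIV. pd i f z * pd i g z))"
proof -
  assume fg: "f \<in> polyfun" "g \<in> polyfun"
  have "pd i (pd i (\<lambda>z. f z * g z)) z
     = pd i (pd i f) z * g z + f z * pd i (pd i g) z + 2 * (pd i f z * pd i g z)" for i z
    by (simp add: fg pd_mult pd_add pd_polyfun polyfun_mult)
  then show ?thesis
    by (simp add: laplacian_eq fg polyfun_mult sum.distrib sum_distrib_left sum_distrib_right)
qed

lemma laplacian_polyfun: "f \<in> polyfun \<Longrightarrow> laplacian f \<in> polyfun"
  by (simp add: laplacian_eq polyfun_sum pd_polyfun)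

lemma laplacian_hom: "f \<in> hom_polys k \<Longrightarrow> laplacian f \<in> hom_polys (k - 2)"
proof -
  assume f: "f \<in> hom_polys k"
  have "pd i (pd i f) \<in> hom_polys (k - 2)" for i
    using pd_hom[OF pd_hom[OF f], of i i] by (simp add: numeral_2_eq_2)
  then show ?thesis by (simp add: laplacian_eq[OF polyfun_hom[OF f]] hom_sum)
qed

lemma laplacian_hom_less_2: "f \<in> hom_polys k \<Longrightarrow> k < 2 \<Longrightarrow> laplacian f = (\<lambda>z. 0)"
proof -
  assume f: "f \<in> hom_polys k" "k < 2"
  then have "pd i f \<in> hom_polys 0" for i using pd_hom[OF f(1), of i] by simp
  then show ?thesis by (simp add: laplacian_eq[OF polyfun_hom[OF f(1)]] pd_hom_0)
qed

lemma pd_sq_norm: "pd i sq_norm = (\<lambda>z. 2 * z i)"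
proof -
  have "pd i (\<lambda>z. \<Sum>j\<in>UNIV. z j ^ 2) = (\<lambda>z. \<Sum>j\<in>UNIV. 2 * z j * (if i = j then 1 else 0))"
    by (subst pd_sum) (auto simp: polyfun_intros pd_power pd_coord)
  then show ?thesis by (simp add: sq_norm_def[abs_def] if_distrib cong: if_cong)
qed

lemma laplacian_sq_norm: "laplacian (sq_norm :: ('v::finite \<Rightarrow> real) \<Rightarrow> real) = (\<lambda>z. 2 * real CARD('v))"
proof -
  have "pd i (pd i sq_norm) = (\<lambda>z::'v \<Rightarrow> real. 2)" for i
    by (simp only: pd_sq_norm pd_cmult[OF polyfun_coord] pd_coord) simp
  then show ?thesis
    by (simp add: laplacian_eq polyfun_sq_norm mult.commute[of 2])
qed

text \<open>The gradient term of the product rule is 4 z . grad s, which Euler's identity turns into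
  4 m s; the 2 n is the Laplacian of \<open>sq_norm\<close>.\<close>

lemma laplacian_sq_norm_mult:
  fixes s :: "('v::finite \<Rightarrow> real) \<Rightarrow> real"
  assumes "s \<in> hom_polys m"
  shows "laplacian (\<lambda>z. sq_norm z * s z)
    = (\<lambda>z. (2 * real CARD('v) + 4 * real m) * s z + sq_norm z * laplacian s z)"
proof -
  have "(\<Sum>i\<in>UNIV. 2 * z i * pd i s z) = 2 * (real m * s z)" for z
    unfolding euler_identity[OF assms, symmetric] by (simp add: sum_distrib_left mult.assoc)
  then show ?thesis
    by (simp add: laplacian_mult polyfun_sq_norm polyfun_hom[OF assms] laplacian_sq_norm pd_sq_norm
        algebra_simps)
qed

subsection \<open>Harmonic decomposition\<close>

text \<open>If \<open>c * r + N * \<Delta> r = g\<close> and \<open>s = \<Delta> r\<close>, applying \<open>\<Delta>\<close> gives an equation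
  of the same shape for \<open>s\<close> with a larger constant.\<close>

lemma solve_laplacian_equation:
  fixes g :: "('v::finite \<Rightarrow> real) \<Rightarrow> real"
  assumes "g \<in> hom_polys k" "c > 0"
  shows "\<exists>r\<in>hom_polys k. \<forall>z. c * r z + sq_norm z * laplacian r z = g z"
  using assms
proof (induction k arbitrary: g c rule: less_induct)
  case (less k)
  show ?case
  proof (cases "k < 2")
    case True
    then show ?thesis
      using less.prems laplacian_hom_less_2[OF hom_cmult[OF less.prems(1)], of "1 / c"]
      by (intro bexI[of _ "\<lambda>z. 1 / c * g z"]) (use hom_cmult[OF less.prems(1), of "1 / c"] in auto)
  next
    case False
    define m where "m = k - 2"
    have k: "k = 2 + m" using False by (simp add: m_def)
    \<comment> \<open>The increment is the factor from \<open>laplacian_sq_norm_mult\<close>, which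
      appears when the Laplacian meets \<open>sq_norm z * s z\<close>.\<close>
    define c' where "c' = c + 2 * real CARD('v) + 4 * real m"
    have "c' > 0" using less.prems by (simp add: c'_def add_pos_nonneg)
    moreover have "laplacian g \<in> hom_polys m"
      using laplacian_hom[OF less.prems(1)] by (simp add: k)
    ultimately obtain s where s: "s \<in> hom_polys m"
      and s_eq: "\<And>z. c' * s z + sq_norm z * laplacian s z = laplacian g z"
      using less.IH[of m] k by force
    \<comment> \<open>The equation dictates \<open>r\<close> once \<open>s\<close> stands for its
      Laplacian; what remains is to verify that \<open>s\<close> is that Laplacian.\<close>
    define r where "r = (\<lambda>z. 1 / c * (g z - sq_norm z * s z))"
    have Ns: "(\<lambda>z. sq_norm z * s z) \<in> hom_polys k"
      using hom_mult[OF hom_sq_norm s] by (simp add: k)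
    have "r \<in> hom_polys k"
      unfolding r_def using hom_add[OF less.prems(1) hom_cmult[OF Ns, of "-1"]] hom_cmult[of _ k "1 / c"] by simp
    moreover have "laplacian r z = s z" for z
    proof -
      have "laplacian r z = 1 / c * (laplacian g z - ((2 * real CARD('v) + 4 * real m) * s z + sq_norm z * laplacian s z))"
        unfolding r_def using polyfun_hom[OF less.prems(1)] polyfun_hom[OF Ns]
        by (simp only: laplacian_cmult laplacian_diff polyfun_diff laplacian_sq_norm_mult[OF s])
      also have "\<dots> = s z"
        using less.prems s_eq[of z, symmetric] by (simp add: c'_def field_simps)
      finally show ?thesis .
    qed
    then have "c * r z + sq_norm z * laplacian r z = g z" for z
      using less.prems by (simp add: r_def)
    ultimately show ?thesis by blast
  qed
qed

text \<open>By \<open>laplacian_sq_norm_mult\<close>, harmonicity of the difference is exactly the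
  equation of \<open>solve_laplacian_equation\<close> for \<open>s\<close>, with constant 2 n + 4 m
  and right-hand side the Laplacian of \<open>f\<close>.\<close>

lemma hom_decomp_step:
  fixes f :: "('v::finite \<Rightarrow> real) \<Rightarrow> real"
  assumes "f \<in> hom_polys (m + 2)"
  obtains s where "s \<in> hom_polys m" "(\<lambda>z. f z - sq_norm z * s z) \<in> harm_polys (m + 2)"
proof -
  have "laplacian f \<in> hom_polys m" using laplacian_hom[OF assms] by simp
  moreover have "2 * real CARD('v) + 4 * real m > 0" by (simp add: add_pos_nonneg)
  ultimately obtain s where s: "s \<in> hom_polys m"
    and eq: "\<And>z. (2 * real CARD('v) + 4 * real m) * s z + sq_norm z * laplacian s z = laplacian f z"
    using solve_laplacian_equation by blast
  have Ns: "(\<lambda>z. sq_norm z * s z) \<in> hom_polys (m + 2)"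
    using hom_mult[OF hom_sq_norm s] by (simp add: add.commute)
  have "(\<lambda>z. f z - sq_norm z * s z) \<in> hom_polys (m + 2)"
    using hom_add[OF assms hom_cmult[OF Ns, of "-1"]] by simp
  moreover have "laplacian (\<lambda>z. f z - sq_norm z * s z) z = 0" for z
    using eq[of z] by (simp add: laplacian_diff polyfun_hom[OF assms] polyfun_hom[OF Ns] laplacian_sq_norm_mult[OF s])
  ultimately show thesis using that[OF s] by (auto simp: harm_polys_def)
qed

lemma harm_imp_hom: "h \<in> harm_polys k \<Longrightarrow> h \<in> hom_polys k"
  by (simp add: harm_polys_def)

lemma harm_laplacian: "h \<in> harm_polys k \<Longrightarrow> laplacian h = (\<lambda>z. 0)"
  by (auto simp: harm_polys_def)

lemma harm_polyfun: "h \<in> harm_polys k \<Longrightarrow> h \<in> polyfun"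
  by (blast intro: harm_imp_hom polyfun_hom)

lemma harm_zero: "(\<lambda>z. 0) \<in> harm_polys k"
  by (simp add: harm_polys_def hom_zero laplacian_const)

lemma harm_add: "f \<in> harm_polys k \<Longrightarrow> g \<in> harm_polys k \<Longrightarrow> (\<lambda>z. f z + g z) \<in> harm_polys k"
  using harm_polyfun[of f k] harm_polyfun[of g k]
  by (simp add: harm_polys_def hom_add laplacian_add)

lemma harm_cmult: "f \<in> harm_polys k \<Longrightarrow> (\<lambda>z. c * f z) \<in> harm_polys k"
  using harm_polyfun[of f k] by (simp add: harm_polys_def hom_cmult laplacian_cmult)

lemma harm_less_2: "f \<in> hom_polys k \<Longrightarrow> k < 2 \<Longrightarrow> f \<in> harm_polys k"
  by (simp add: harm_polys_def laplacian_hom_less_2)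

text \<open>The remainder is tracked with its degree because it ends up in the truncated ideal. The
  clause for \<open>k < 2\<close> compensates for the truncated \<open>k - 2\<close>, which alone
  would admit a nonzero constant.\<close>

lemma hom_harmonic_decomp:
  fixes f :: "('v::finite \<Rightarrow> real) \<Rightarrow> real"
  assumes "f \<in> hom_polys k"
  shows "\<exists>h r. (\<forall>j. h j \<in> harm_polys j) \<and> (\<forall>j>k. h j = (\<lambda>z. 0)) \<and> r \<in> polys (k - 2) \<and>
    (k < 2 \<longrightarrow> r = (\<lambda>z. 0)) \<and> f = (\<lambda>z. (\<Sum>j\<le>k. h j z) + (1 - sq_norm z) * r z)"
  using assms
proof (induction k arbitrary: f rule: less_induct)
  case (less k)
  show ?case
  proof (cases "k < 2")
    case True
    have "(\<Sum>j\<le>k. (if j = k then f else (\<lambda>z. 0)) z) = f z" for z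
      by (simp add: if_distrib[of "\<lambda>h. h z"] cong: if_cong)
    with True less.prems show ?thesis
      by (intro exI[of _ "\<lambda>j. if j = k then f else (\<lambda>z. 0)"] exI[of _ "\<lambda>z. 0"])
         (auto intro: harm_zero harm_less_2 polys_zero)
  next
    case False
    then obtain m where k: "k = m + 2" by (metis add.commute le_Suc_ex not_less)
    from less.prems obtain s where s: "s \<in> hom_polys m"
      and h': "(\<lambda>z. f z - sq_norm z * s z) \<in> harm_polys k"
      using hom_decomp_step[of f m] unfolding k by blast
    from less.IH[OF _ s] obtain h r where h: "\<And>j. h j \<in> harm_polys j" "\<And>j. j > m \<Longrightarrow> h j = (\<lambda>z. 0)"
      and r: "r \<in> polys (m - 2)" and seq: "s = (\<lambda>z. (\<Sum>j\<le>m. h j z) + (1 - sq_norm z) * r z)"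
      unfolding k by auto
    \<comment> \<open>\<open>h\<close> vanishes above \<open>m\<close>, so on passing from
      \<open>m\<close> to \<open>k = m + 2\<close> the sum gains only the new top component.\<close>
    define H where "H = h(k := (\<lambda>z. f z - sq_norm z * s z))"
    have "(\<Sum>j\<le>k. H j z) = (\<Sum>j\<le>m. h j z) + (f z - sq_norm z * s z)" for z
      by (simp add: k H_def h(2))
    \<comment> \<open>Writing \<open>sq_norm z * s z\<close> as s - (1 - |z|^2) s, the first part is
      decomposed by induction and -s joins the remainder.\<close>
    then have "f z = (\<Sum>j\<le>k. H j z) + (1 - sq_norm z) * (r z + (-1) * s z)" for z
      using fun_cong[OF seq, of z] by (simp add: algebra_simps)
    moreover have "(\<lambda>z. r z + (-1) * s z) \<in> polys m"
      by (intro polys_add polys_cmult polys_mono[OF r] hom_imp_polys[OF s]) auto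
    ultimately show ?thesis
      using h h' k by (intro exI[of _ H] exI[of _ "\<lambda>z. r z + (-1) * s z"]) (auto simp: H_def)
  qed
qed

lemma harmonic_decomp:
  fixes f :: "('v::finite \<Rightarrow> real) \<Rightarrow> real"
  assumes "f \<in> polys D"
  shows "\<exists>h r. (\<forall>j. h j \<in> harm_polys j) \<and> r \<in> polys (D - 2) \<and>
    f = (\<lambda>z. (\<Sum>j\<le>D. h j z) + (1 - sq_norm z) * r z)"
proof -
  have "f \<in> mspan {a. sum a UNIV \<le> D}" using assms by (simp add: polys_mspan)
  then show ?thesis
  proof (induction rule: mspan_induct)
    case zero
    show ?case by (rule exI[of _ "\<lambda>j z. 0"], rule exI[of _ "\<lambda>z. 0"]) (simp add: harm_zero polys_zero)
  next
    case (monom a)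
    define k where "k = sum a UNIV"
    have kD: "k \<le> D" using monom by (simp add: k_def)
    from hom_harmonic_decomp[OF hom_monom, of a] obtain h r
      where h: "\<And>j. h j \<in> harm_polys j" "\<And>j. j > k \<Longrightarrow> h j = (\<lambda>z. 0)"
      and r: "r \<in> polys (k - 2)" and eq: "Defs.monom a = (\<lambda>z. (\<Sum>j\<le>k. h j z) + (1 - sq_norm z) * r z)"
      unfolding k_def[symmetric] by blast
    have "(\<Sum>j\<le>D. h j z) = (\<Sum>j\<le>k. h j z)" for z
      by (rule sum.mono_neutral_right) (use kD h(2) in auto)
    with eq have "Defs.monom a = (\<lambda>z. (\<Sum>j\<le>D. h j z) + (1 - sq_norm z) * r z)" by simp
    moreover have "r \<in> polys (D - 2)" using kD by (intro polys_mono[OF r]) auto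
    ultimately show ?case using h(1) by blast
  next
    case (cmult c f)
    then obtain h r where h: "\<And>j. h j \<in> harm_polys j" and r: "r \<in> polys (D - 2)"
      and eq: "f = (\<lambda>z. (\<Sum>j\<le>D. h j z) + (1 - sq_norm z) * r z)" by blast
    have "(\<lambda>z. c * f z) = (\<lambda>z. (\<Sum>j\<le>D. c * h j z) + (1 - sq_norm z) * (c * r z))"
      unfolding eq by (simp add: sum_distrib_left algebra_simps)
    moreover have "(\<lambda>z. c * r z) \<in> polys (D - 2)" by (rule polys_cmult[OF r])
    moreover have "\<forall>j. (\<lambda>z. c * h j z) \<in> harm_polys j" using h by (auto intro: harm_cmult)
    ultimately show ?case by (intro exI[of _ "\<lambda>j z. c * h j z"] exI[of _ "\<lambda>z. c * r z"]) simp
  next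
    case (add f g)
    then obtain h r h' r' where h: "\<And>j. h j \<in> harm_polys j" "\<And>j. h' j \<in> harm_polys j"
      and r: "r \<in> polys (D - 2)" "r' \<in> polys (D - 2)"
      and eq: "f = (\<lambda>z. (\<Sum>j\<le>D. h j z) + (1 - sq_norm z) * r z)"
        "g = (\<lambda>z. (\<Sum>j\<le>D. h' j z) + (1 - sq_norm z) * r' z)" by blast
    have "(\<lambda>z. f z + g z) = (\<lambda>z. (\<Sum>j\<le>D. h j z + h' j z) + (1 - sq_norm z) * (r z + r' z))"
      unfolding eq by (simp add: sum.distrib algebra_simps)
    moreover have "(\<lambda>z. r z + r' z) \<in> polys (D - 2)" by (rule polys_add[OF r])
    moreover have "\<forall>j. (\<lambda>z. h j z + h' j z) \<in> harm_polys j" using h by (auto intro: harm_add)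
    ultimately show ?case by (intro exI[of _ "\<lambda>j z. h j z + h' j z"] exI[of _ "\<lambda>z. r z + r' z"]) simp
  qed simp
qed

subsection \<open>The maximum principle and the spherical mean\<close>

text \<open>A negative \<open>D\<close> would make \<open>f'\<close> negative just to the right of
  \<open>a\<close>, and \<open>f\<close> would fall below \<open>f a\<close> there.\<close>

lemma second_derivative_at_min:
  fixes f f' :: "real \<Rightarrow> real"
  assumes f: "\<And>s. (f has_real_derivative f' s) (at s)"
    and f': "(f' has_real_derivative D) (at a)"
    and min: "\<And>s. \<bar>s - a\<bar> < e \<Longrightarrow> f a \<le> f s" and "e > 0"
  shows "D \<ge> 0"
proof (rule ccontr)
  assume "\<not> D \<ge> 0"
  have "f' a = 0"
    by (rule DERIV_local_min[OF f \<open>e > 0\<close>]) (use min in \<open>auto simp: abs_minus_commute\<close>)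
  moreover from \<open>\<not> D \<ge> 0\<close> obtain d where d: "d > 0" "\<And>h. 0 < h \<Longrightarrow> h < d \<Longrightarrow> f' (a + h) < f' a"
    using DERIV_neg_dec_right[OF f'] by auto
  define h where "h = min d e / 2"
  have h: "0 < h" "h < d" "h < e" using d \<open>e > 0\<close> by (auto simp: h_def)
  obtain x where x: "a < x" "x < a + h" "f (a + h) - f a = (a + h - a) * f' x"
    using MVT2[of a "a + h" f f'] f h(1) by auto
  have "f' x < 0" using d(2)[of "x - a"] x h \<open>f' a = 0\<close> by auto
  then have "f (a + h) < f a" using x h mult_pos_neg[of h "f' x"] by simp
  with min[of "a + h"] h show False by auto
qed

lemma continuous_on_monom_vec: "continuous_on S (\<lambda>x::real^'v. Defs.monom a (\<lambda>i. x $ i))"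
  unfolding Defs.monom_def by (intro continuous_intros)

lemma continuous_on_polyfun_vec:
  "f \<in> polyfun \<Longrightarrow> continuous_on S (\<lambda>x::real^'v. f (\<lambda>i. x $ i))"
  by (induction rule: polyfun_induct) (intro continuous_on_monom_vec continuous_intros; assumption)+

lemma sq_norm_vec: "sq_norm (\<lambda>i. (x::real^'v) $ i) = (norm x)\<^sup>2"
  by (simp add: sq_norm_def norm_vec_def L2_set_def sum_nonneg)

lemma sq_norm_nonneg: "sq_norm z \<ge> 0"
  by (simp add: sq_norm_def sum_nonneg)

text \<open>A minimum over the closed ball cannot lie in the interior: all pure second derivatives
  would be nonnegative there, against the sign of the Laplacian. So it lies on the sphere.\<close>

lemma superharmonic_nonneg:
  fixes v :: "('v::finite \<Rightarrow> real) \<Rightarrow> real"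
  assumes v: "v \<in> polyfun" and lap: "\<And>z. laplacian v z < 0"
    and nonneg: "\<And>z. sq_norm z = 1 \<Longrightarrow> v z \<ge> 0"
  shows "v (\<lambda>i. 0) \<ge> 0"
proof -
  let ?V = "\<lambda>x::real^'v. v (\<lambda>i. x $ i)"
  have "\<exists>x\<in>cball 0 1. \<forall>y\<in>cball 0 1. ?V x \<le> ?V y"
    by (rule continuous_attains_inf[OF compact_cball _ continuous_on_polyfun_vec[OF v]]) auto
  then obtain x where x: "norm x \<le> 1" and xmin: "\<And>y. norm y \<le> 1 \<Longrightarrow> ?V x \<le> ?V y"
    by (auto simp: dist_norm)
  define z where "z = (\<lambda>i. x $ i)"
  have zmin: "v z \<le> v w" if "sq_norm w \<le> 1" for w
  proof -
    have "sq_norm w = (norm ((\<chi> i. w i) :: real^'v))\<^sup>2" using sq_norm_vec[of "(\<chi> i. w i) :: real^'v"] by simp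
    with that have "norm ((\<chi> i. w i) :: real^'v) \<le> 1" by (simp add: power_le_one_iff abs_square_le_1)
    from xmin[OF this] show ?thesis by (simp add: z_def)
  qed
  have "sq_norm z = 1"
  proof (rule ccontr)
    assume "sq_norm z \<noteq> 1"
    with x have lt: "sq_norm z < 1"
      by (simp add: z_def sq_norm_vec order_less_le power_le_one)
    have "pd i (pd i v) z \<ge> 0" for i
    proof -
      have sq: "sq_norm (z(i := s)) = sq_norm z + (s\<^sup>2 - (z i)\<^sup>2)" for s
      proof -
        have "(\<Sum>j\<in>UNIV - {i}. ((z(i := s)) j)\<^sup>2) = (\<Sum>j\<in>UNIV - {i}. (z j)\<^sup>2)" by (rule sum.cong) auto
        then show ?thesis by (simp add: sq_norm_def sum.remove[of UNIV i])
      qed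
      \<comment> \<open>An interior point stays in the ball when one coordinate moves slightly, so
        \<open>z\<close> is a local minimum along each axis.\<close>
      have "isCont (\<lambda>s. sq_norm z + (s\<^sup>2 - (z i)\<^sup>2)) (z i)" by (intro continuous_intros)
      then have "((\<lambda>s. sq_norm z + (s\<^sup>2 - (z i)\<^sup>2)) \<longlongrightarrow> sq_norm z) (nhds (z i))"
        using tendsto_at_iff_tendsto_nhds[of "\<lambda>s. sq_norm z + (s\<^sup>2 - (z i)\<^sup>2)" "z i"]
        by (simp add: isCont_def)
      from order_tendstoD(2)[OF this lt]
      obtain e where e: "e > 0" "\<And>s. \<bar>s - z i\<bar> < e \<Longrightarrow> sq_norm z + (s\<^sup>2 - (z i)\<^sup>2) < 1"
        unfolding eventually_nhds_metric dist_real_def by blast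
      show ?thesis
      proof (rule second_derivative_at_min[OF DERIV_pd[OF v] DERIV_pd'[OF pd_polyfun[OF v]]])
        show "v (z(i := z i)) \<le> v (z(i := s))" if "\<bar>s - z i\<bar> < e" for s
          using zmin[of "z(i := s)"] e(2)[OF that] by (simp add: sq)
      qed fact
    qed
    then have "laplacian v z \<ge> 0" by (simp add: laplacian_eq[OF v] sum_nonneg)
    with lap[of z] show False by simp
  qed
  then have "v z \<ge> 0" by (rule nonneg)
  moreover have "v z \<le> v (\<lambda>i. 0)" by (rule zmin) (simp add: sq_norm_def)
  ultimately show ?thesis by simp
qed

definition harmonic :: "(('v::finite \<Rightarrow> real) \<Rightarrow> real) \<Rightarrow> bool" where
  "harmonic u \<longleftrightarrow> u \<in> polyfun \<and> laplacian u = (\<lambda>z. 0)"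

lemma minimum_principle:
  fixes u :: "('v::finite \<Rightarrow> real) \<Rightarrow> real"
  assumes u: "harmonic u" and nonneg: "\<And>z. z \<in> sphere_set \<Longrightarrow> u z \<ge> 0"
  shows "u (\<lambda>i. 0) \<ge> 0"
proof (rule field_le_epsilon)
  fix e :: real assume "e > 0"
  \<comment> \<open>The added term vanishes on the sphere, equals \<open>e\<close> at the centre and
    makes the Laplacian strictly negative.\<close>
  define v where "v = (\<lambda>z. u z + e * (1 - sq_norm z))"
  have up: "u \<in> polyfun" using u by (simp add: harmonic_def)
  have "v \<in> polyfun" unfolding v_def by (intro polyfun_intros up)
  moreover have "laplacian v z = e * - (2 * real CARD('v))" for z
    unfolding v_def using u
    by (simp add: harmonic_def laplacian_add laplacian_cmult laplacian_diff polyfun_intros laplacian_const laplacian_sq_norm)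
  ultimately have "v (\<lambda>i. 0) \<ge> 0"
    using \<open>e > 0\<close> nonneg
    by (intro superharmonic_nonneg) (auto simp: v_def sphere_set_def mult_pos_neg)
  then show "0 \<le> u (\<lambda>i. 0) + e" by (simp add: v_def sq_norm_def)
qed

section \<open>Harmonic extension from the sphere and the mean that it defines\<close>

lemma harmonic_add: "harmonic u \<Longrightarrow> harmonic v \<Longrightarrow> harmonic (\<lambda>z. u z + v z)"
  by (simp add: harmonic_def polyfun_add laplacian_add)

lemma harmonic_cmult: "harmonic u \<Longrightarrow> harmonic (\<lambda>z. c * u z)"
  by (simp add: harmonic_def polyfun_cmult laplacian_cmult)

lemma harm_harmonic: "h \<in> harm_polys k \<Longrightarrow> harmonic h"
  by (simp add: harmonic_def harm_polyfun harm_laplacian)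

lemma harmonic_sum: "(\<And>s. s \<in> S \<Longrightarrow> harmonic (f s)) \<Longrightarrow> harmonic (\<lambda>z. \<Sum>s\<in>S. f s z)"
  by (induction S rule: infinite_finite_induct)
     (simp_all add: harmonic_add, simp_all add: harmonic_def polyfun_const laplacian_const)

text \<open>The polynomial Dirichlet problem: the ideal term of \<open>harmonic_decomp\<close>
  disappears on the sphere.\<close>

lemma harmonic_extension:
  assumes "f \<in> polyfun"
  shows "\<exists>u. harmonic u \<and> (\<forall>z\<in>sphere_set. u z = f z)"
proof -
  from assms obtain D where "f \<in> polys D" by (auto simp: polyfun_def)
  from harmonic_decomp[OF this] obtain h r where h: "\<And>j. h j \<in> harm_polys j"
    and eq: "f = (\<lambda>z. (\<Sum>j\<le>D. h j z) + (1 - sq_norm z) * r z)" by blast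
  have "harmonic (\<lambda>z. \<Sum>j\<le>D. h j z)" by (intro harmonic_sum harm_harmonic[OF h])
  moreover have "\<forall>z\<in>sphere_set. (\<Sum>j\<le>D. h j z) = f z" by (simp add: eq sphere_set_def)
  ultimately show ?thesis by blast
qed

text \<open>The spherical mean of \<open>f\<close> is the value at the centre of its harmonic extension.\<close>

definition sph_mean :: "(('v::finite \<Rightarrow> real) \<Rightarrow> real) \<Rightarrow> real" where
  "sph_mean f = (SOME u. harmonic u \<and> (\<forall>z\<in>sphere_set. u z = f z)) (\<lambda>i. 0)"

text \<open>Independence of the choice in \<open>sph_mean\<close>: two extensions differ by a
  harmonic function that is 0 on the sphere, and the minimum principle applies to both signs of the
  difference.\<close>

lemma sph_mean_eq:
  assumes u: "harmonic u" "\<And>z. z \<in> sphere_set \<Longrightarrow> u z = f z"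
  shows "sph_mean f = u (\<lambda>i. 0)"
proof -
  define w where "w = (SOME u. harmonic u \<and> (\<forall>z\<in>sphere_set. u z = f z))"
  have w: "harmonic w" "\<And>z. z \<in> sphere_set \<Longrightarrow> w z = f z"
    using someI[of "\<lambda>u. harmonic u \<and> (\<forall>z\<in>sphere_set. u z = f z)" u] u by (auto simp: w_def)
  have "harmonic (\<lambda>z. u z + (-1) * w z)" "harmonic (\<lambda>z. w z + (-1) * u z)"
    by (intro harmonic_add harmonic_cmult u w)+
  from this[THEN minimum_principle] have "w (\<lambda>i. 0) = u (\<lambda>i. 0)"
    using u(2) w(2) by force
  then show ?thesis by (simp add: sph_mean_def w_def)
qed

lemma sph_mean_cong:
  assumes "f \<in> polyfun" "\<And>z. z \<in> sphere_set \<Longrightarrow> f z = g z"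
  shows "sph_mean f = sph_mean g"
proof -
  obtain u where "harmonic u" "\<forall>z\<in>sphere_set. u z = f z" using harmonic_extension[OF assms(1)] by blast
  then show ?thesis using sph_mean_eq[of u f] sph_mean_eq[of u g] assms(2) by simp
qed

lemma sph_mean_add:
  assumes "f \<in> polyfun" "g \<in> polyfun"
  shows "sph_mean (\<lambda>z. f z + g z) = sph_mean f + sph_mean g"
proof -
  obtain u where u: "harmonic u" "\<forall>z\<in>sphere_set. u z = f z" using harmonic_extension[OF assms(1)] by blast
  obtain v where v: "harmonic v" "\<forall>z\<in>sphere_set. v z = g z" using harmonic_extension[OF assms(2)] by blast
  show ?thesis
    using sph_mean_eq[OF harmonic_add[OF u(1) v(1)], of "\<lambda>z. f z + g z"] u v sph_mean_eq[of u f] sph_mean_eq[of v g]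
    by simp
qed

lemma sph_mean_cmult:
  assumes "f \<in> polyfun"
  shows "sph_mean (\<lambda>z. c * f z) = c * sph_mean f"
proof -
  obtain u where u: "harmonic u" "\<forall>z\<in>sphere_set. u z = f z" using harmonic_extension[OF assms(1)] by blast
  show ?thesis
    using sph_mean_eq[OF harmonic_cmult[OF u(1), of c], of "\<lambda>z. c * f z"] u sph_mean_eq[of u f]
    by simp
qed

lemma sph_mean_const: "sph_mean (\<lambda>z. c) = c"
  by (rule sph_mean_eq) (auto simp: harmonic_def polyfun_const laplacian_const)

lemma sph_mean_diff:
  assumes "f \<in> polyfun" "g \<in> polyfun"
  shows "sph_mean (\<lambda>z. f z - g z) = sph_mean f - sph_mean g"
  using sph_mean_add[OF assms(1) polyfun_cmult[OF assms(2)], of "-1"] sph_mean_cmult[OF assms(2), of "-1"]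
  by simp

lemma sph_mean_sum:
  "(\<And>s. s \<in> S \<Longrightarrow> f s \<in> polyfun) \<Longrightarrow> sph_mean (\<lambda>z. \<Sum>s\<in>S. f s z) = (\<Sum>s\<in>S. sph_mean (f s))"
  by (induction S rule: infinite_finite_induct)
     (simp_all add: sph_mean_const sph_mean_add polyfun_sum)

lemma sph_mean_nonneg:
  assumes "f \<in> polyfun" "\<And>z. z \<in> sphere_set \<Longrightarrow> f z \<ge> 0"
  shows "sph_mean f \<ge> 0"
proof -
  obtain u where "harmonic u" "\<forall>z\<in>sphere_set. u z = f z" using harmonic_extension[OF assms(1)] by blast
  then show ?thesis using sph_mean_eq[of u f] minimum_principle[of u] assms(2) by simp
qed

lemma sph_mean_mono:
  assumes "f \<in> polyfun" "g \<in> polyfun" "\<And>z. z \<in> sphere_set \<Longrightarrow> f z \<le> g z"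
  shows "sph_mean f \<le> sph_mean g"
  using sph_mean_nonneg[OF polyfun_diff[OF assms(2,1)]] sph_mean_diff[OF assms(2,1)] assms(3) by simp

lemma hom_at_zero: "f \<in> hom_polys k \<Longrightarrow> k > 0 \<Longrightarrow> f (\<lambda>i. 0) = 0"
  using hom_scale[of f k 0 "\<lambda>i. 0"] by (auto simp: zero_power)

lemma sph_mean_harm: "h \<in> harm_polys k \<Longrightarrow> k > 0 \<Longrightarrow> sph_mean h = 0"
  using sph_mean_eq[OF harm_harmonic] hom_at_zero[OF harm_imp_hom] by metis

text \<open>This takes the place of integration by parts. In f = h + |z|^2 s the harmonic part has
  mean 0 and Laplacian 0, while s and |z|^2 s have equal means; the induction closes because (2 n +
  4 m) + m (m + n - 2) = (m + 2) (m + n).\<close>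

lemma sph_mean_laplacian:
  fixes f :: "('v::finite \<Rightarrow> real) \<Rightarrow> real"
  assumes "f \<in> hom_polys k"
  shows "sph_mean (laplacian f) = real k * (real k + real CARD('v) - 2) * sph_mean f"
  using assms
proof (induction k arbitrary: f rule: less_induct)
  case (less k)
  show ?case
  proof (cases "k < 2")
    case True
    then have "k = 0 \<or> k = 1" by auto
    then show ?thesis
      using sph_mean_harm[OF harm_less_2[OF less.prems True]]
      by (auto simp: laplacian_hom_less_2[OF less.prems True] sph_mean_const)
  next
    case False
    then obtain m where k: "k = m + 2" by (metis add.commute le_Suc_ex not_less)
    from less.prems obtain s where s: "s \<in> hom_polys m"
      and h: "(\<lambda>z. f z - sq_norm z * s z) \<in> harm_polys k"
      using hom_decomp_step[of f m] unfolding k by blast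
    have sp: "s \<in> polyfun" and fp: "f \<in> polyfun" using s less.prems by (auto intro: polyfun_hom)
    have Nsp: "(\<lambda>z. sq_norm z * s z) \<in> polyfun" by (intro polyfun_intros sp)
    have Ns: "sph_mean (\<lambda>z. sq_norm z * g z) = sph_mean g" if "g \<in> polyfun" for g :: "('v \<Rightarrow> real) \<Rightarrow> real"
      by (rule sph_mean_cong) (auto intro!: polyfun_intros that simp: sphere_set_def)
    have "sph_mean f - sph_mean s = 0"
      using sph_mean_harm[OF h] by (simp add: k sph_mean_diff fp Nsp Ns sp)
    moreover have "laplacian f = laplacian (\<lambda>z. sq_norm z * s z)"
      using harm_laplacian[OF h] by (auto simp: laplacian_diff fp Nsp fun_eq_iff)
    moreover have "sph_mean (laplacian (\<lambda>z. sq_norm z * s z))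
      = (2 * real CARD('v) + 4 * real m) * sph_mean s + sph_mean (laplacian s)"
      by (simp add: laplacian_sq_norm_mult[OF s] sph_mean_add sph_mean_cmult Ns polyfun_intros sp laplacian_polyfun)
    ultimately show ?thesis
      using less.IH[OF _ s] by (simp add: k algebra_simps)
  qed
qed

subsection \<open>A Funk-Hecke formula for powers\<close>

definition ip :: "('v::finite \<Rightarrow> real) \<Rightarrow> ('v \<Rightarrow> real) \<Rightarrow> real" where
  "ip x y = (\<Sum>i\<in>UNIV. x i * y i)"

lemma hom_ip: "ip x \<in> hom_polys 1"
  unfolding ip_def[abs_def] by (intro hom_sum hom_cmult hom_coord)

lemma polyfun_ip: "ip x \<in> polyfun" "(\<lambda>y. ip x y) \<in> polyfun"
  using polyfun_hom[OF hom_ip] by auto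

lemma ip_commute: "ip x y = ip y x"
  by (simp add: ip_def mult.commute)

lemma ip_self: "ip x x = sq_norm x"
  by (simp add: ip_def sq_norm_def power2_eq_square)

lemma pd_ip: "pd i (ip x) = (\<lambda>y. x i)"
proof -
  have "pd i (\<lambda>y. \<Sum>j\<in>UNIV. x j * y j) = (\<lambda>y. \<Sum>j\<in>UNIV. x j * (if i = j then 1 else 0))"
    by (subst pd_sum) (auto simp: polyfun_intros pd_cmult pd_coord)
  then show ?thesis by (simp add: ip_def[abs_def] if_distrib cong: if_cong)
qed

text \<open>The eigenvalue of the operator with kernel \<open>\<langle>x, y\<rangle>\<^sup>m\<close> on spherical harmonics of degree \<open>k\<close>.
  In dimension 1 the quotient for \<open>m + k = 1\<close> is \<open>0 / 0 = 0\<close>, which is the right value.\<close>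

fun fh_coeff :: "nat \<Rightarrow> nat \<Rightarrow> nat \<Rightarrow> real" where
  "fh_coeff n 0 k = (if k = 0 then 1 else 0)"
| "fh_coeff n (Suc 0) k = (2 * real k * fh_coeff n 0 (k - 1)) / ((1 + real k) * (real k + real n - 1))"
| "fh_coeff n (Suc (Suc m)) k = (real (m + 2) * real (m + 1) * fh_coeff n m k
     + 2 * real (m + 2) * real k * fh_coeff n (Suc m) (k - 1))
     / ((real m + 2 + real k) * (real m + real k + real n))"

lemma fh_coeff_less: "m < k \<Longrightarrow> fh_coeff n m k = 0"
  by (induction n m k rule: fh_coeff.induct) auto

text \<open>With \<open>fh_coeff_less\<close> this makes the averages against powers of
  \<open>ip x y\<close> a triangular system with nonzero diagonal for the harmonic
  components.\<close>

lemma fh_coeff_diag: "n \<ge> 1 \<Longrightarrow> fh_coeff n m m > 0"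
proof (induction m)
  case (Suc m)
  then show ?case
    by (cases m) (auto simp: fh_coeff_less intro!: divide_pos_pos mult_pos_pos add_pos_nonneg)
qed simp

lemma laplacian_ip_power_mult:
  assumes h: "h \<in> harm_polys k"
  shows "laplacian (\<lambda>y. ip x y ^ m * h y) = (\<lambda>y. (real m * real (m - 1) * sq_norm x) * (ip x y ^ (m - 2) * h y)
    + 2 * real m * (ip x y ^ (m - 1) * (\<Sum>i\<in>UNIV. x i * pd i h y)))"
proof -
  have hp: "h \<in> polyfun" by (rule harm_polyfun[OF h])
  have 1: "pd i (\<lambda>y. ip x y ^ m) = (\<lambda>y. (real m * x i) * ip x y ^ (m - 1))" for i m
    using pd_power[OF polyfun_ip(1), of i x m] by (simp add: pd_ip mult_ac)
  have "pd i (pd i (\<lambda>y. ip x y ^ m)) = (\<lambda>y. real m * real (m - 1) * (x i)\<^sup>2 * ip x y ^ (m - 2))" for i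
    unfolding 1 by (subst pd_cmult)
      (auto simp: polyfun_power polyfun_ip 1 power2_eq_square numeral_2_eq_2 mult_ac)
  then have "laplacian (\<lambda>y. ip x y ^ m) = (\<lambda>y. real m * real (m - 1) * sq_norm x * ip x y ^ (m - 2))"
    by (simp add: laplacian_eq polyfun_power polyfun_ip sq_norm_def sum_distrib_left sum_distrib_right)
  then show ?thesis
    by (simp add: laplacian_mult polyfun_power polyfun_ip hp harm_laplacian[OF h] 1
        sum_distrib_left sum_distrib_right mult_ac)
qed

text \<open>Derivatives in fixed directions commute with the Laplacian.\<close>

lemma harm_directional:
  assumes h: "h \<in> harm_polys k"
  shows "(\<lambda>y. \<Sum>i\<in>UNIV. x i * pd i h y) \<in> harm_polys (k - 1)"
proof -
  have hp: "h \<in> polyfun" by (rule harm_polyfun[OF h])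
  have "laplacian (pd i h) = (\<lambda>z. 0)" for i
  proof -
    have "pd j (pd j (pd i h)) = pd i (pd j (pd j h))" for j
      by (simp add: pd_commute[of _ j i] hp pd_polyfun)
    then have "laplacian (pd i h) = (\<lambda>z. \<Sum>j\<in>UNIV. pd i (pd j (pd j h)) z)"
      by (simp add: laplacian_eq hp pd_polyfun)
    also have "\<dots> = pd i (laplacian h)"
      by (simp add: laplacian_eq[OF hp] pd_sum pd_polyfun hp)
    also have "\<dots> = (\<lambda>z. 0)" by (simp add: harm_laplacian[OF h] pd_const)
    finally show ?thesis .
  qed
  then have "pd i h \<in> harm_polys (k - 1)" for i
    using pd_hom[OF harm_imp_hom[OF h]] by (simp add: harm_polys_def)
  then have *: "(\<lambda>y. x i * pd i h y) \<in> harm_polys (k - 1)" for i by (rule harm_cmult)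
  have "(\<lambda>y. \<Sum>i\<in>S. x i * pd i h y) \<in> harm_polys (k - 1)" if "finite S" for S
    using that by induction (simp_all add: harm_zero harm_add * del: One_nat_def)
  then show ?thesis by simp
qed

lemma solve_divide: "c * a = b \<Longrightarrow> c \<noteq> 0 \<Longrightarrow> a = b / (c :: real)"
  by (simp add: eq_divide_eq mult.commute)

text \<open>\<open>sph_mean_laplacian\<close>, applied to the product of a power and
  \<open>h\<close>, leads to the same mean with \<open>m - 2\<close> and to the mean with
  \<open>m - 1\<close> and the derivative of \<open>h\<close> along \<open>x\<close>. At
  \<open>x\<close> that derivative is k h(x) by Euler's identity, which yields the recurrence of
  \<open>fh_coeff\<close>.\<close>

lemma sph_mean_ip_power_mult:
  fixes x :: "'v::finite \<Rightarrow> real"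
  assumes "h \<in> harm_polys k" and x: "sq_norm x = 1"
  shows "sph_mean (\<lambda>y. ip x y ^ m * h y) = fh_coeff CARD('v) m k * h x"
  using assms(1)
proof (induction m arbitrary: h k rule: less_induct)
  case (less m)
  note h = less.prems
  let ?n = "real CARD('v)"
  have hp: "h \<in> polyfun" by (rule harm_polyfun[OF h])
  define h' where "h' = (\<lambda>y. \<Sum>i\<in>UNIV. x i * pd i h y)"
  have h': "h' \<in> harm_polys (k - 1)" unfolding h'_def by (rule harm_directional[OF h])
  have h'_y: "(\<Sum>i\<in>UNIV. x i * pd i h y) = h' y" for y by (simp add: h'_def)
  have h'x: "h' x = real k * h x"
    unfolding h'_def by (rule euler_identity[OF harm_imp_hom[OF h]])
  have hom: "(\<lambda>y. ip x y ^ m * h y) \<in> hom_polys (m + k)"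
    using hom_mult[OF hom_power[OF hom_ip] harm_imp_hom[OF h], of x m] by simp
  have lap: "real (m + k) * (real (m + k) + ?n - 2) * sph_mean (\<lambda>y. ip x y ^ m * h y)
     = real m * real (m - 1) * sph_mean (\<lambda>y. ip x y ^ (m - 2) * h y)
       + 2 * real m * sph_mean (\<lambda>y. ip x y ^ (m - 1) * h' y)"
    unfolding sph_mean_laplacian[OF hom, symmetric] laplacian_ip_power_mult[OF h] h'_y
    using polyfun_mult[OF polyfun_power[OF polyfun_ip(1)] hp] polyfun_mult[OF polyfun_power[OF polyfun_ip(1)] harm_polyfun[OF h']]
    by (simp add: x sph_mean_add sph_mean_cmult polyfun_cmult)
  have n1: "?n \<ge> 1" using one_le_card_finite[where 'a='v] by simp
  consider "m = 0" | "m = 1" "k = 0" | "m = 1" "k > 0" | m' where "m = Suc (Suc m')"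
    by (metis One_nat_def gr0I not0_implies_Suc)
  then show ?case
  proof cases
    case 1
    show ?thesis
    proof (cases "k = 0")
      case True
      then have hc: "h = (\<lambda>y. h x)" using hom_0_imp_const[of h x] harm_imp_hom[OF h] by auto
      have "sph_mean h = h x" by (subst hc) (rule sph_mean_const)
      then show ?thesis using 1 True by simp
    next
      case False
      then show ?thesis using 1 sph_mean_harm[OF h] by simp
    qed
  next
    \<comment> \<open>Here (m + k) + n - 2 = n - 1 is 0 in dimension 1 and \<open>lap\<close> gives
      no information; a linear function has mean 0 because it is harmonic.\<close>
    case 2
    then have "sph_mean (\<lambda>y. ip x y ^ m * h y) = 0"
      using sph_mean_harm[OF harm_less_2[OF hom]] by simp
    then show ?thesis using 2 by simp
  next
    case 3
    then have "sph_mean h' = fh_coeff CARD('v) 0 (k - 1) * (real k * h x)"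
      using less.IH[OF _ h', of 0] by (simp add: h'x)
    then have "((1 + real k) * (real k + ?n - 1)) * sph_mean (\<lambda>y. ip x y ^ m * h y)
       = 2 * real k * fh_coeff CARD('v) 0 (k - 1) * h x"
      using lap 3 by (simp add: algebra_simps)
    moreover have "real k + ?n - 1 > 0" using 3 n1 by linarith
    then have "(1 + real k) * (real k + ?n - 1) \<noteq> 0" by auto
    ultimately have "sph_mean (\<lambda>y. ip x y ^ m * h y)
       = 2 * real k * fh_coeff CARD('v) 0 (k - 1) * h x / ((1 + real k) * (real k + ?n - 1))"
      by (rule solve_divide)
    then show ?thesis using 3 by (simp only: fh_coeff.simps One_nat_def) simp
  next
    case 4
    have A: "sph_mean (\<lambda>y. ip x y ^ (m - 2) * h y) = fh_coeff CARD('v) m' k * h x"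
      using less.IH[OF _ h, of m'] 4 by simp
    have B: "sph_mean (\<lambda>y. ip x y ^ (m - 1) * h' y) = fh_coeff CARD('v) (Suc m') (k - 1) * (real k * h x)"
      using less.IH[OF _ h', of "Suc m'"] 4 by (simp add: h'x)
    have m: "real (m + k) = real m' + 2 + real k" "real m = real (m' + 2)" "real (m - 1) = real (m' + 1)"
      using 4 by auto
    have "((real m' + 2 + real k) * (real m' + real k + ?n)) * sph_mean (\<lambda>y. ip x y ^ m * h y)
       = real (m + k) * (real (m + k) + ?n - 2) * sph_mean (\<lambda>y. ip x y ^ m * h y)"
      unfolding m by simp
    also have "\<dots> = (real (m' + 2) * real (m' + 1) * fh_coeff CARD('v) m' k
          + 2 * real (m' + 2) * real k * fh_coeff CARD('v) (Suc m') (k - 1)) * h x"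
      unfolding lap unfolding A B m(2,3) by (simp only: distrib_right distrib_left mult_ac)
    finally have eq: "((real m' + 2 + real k) * (real m' + real k + ?n)) * sph_mean (\<lambda>y. ip x y ^ m * h y) = \<dots>" .
    have "real m' + real k + ?n > 0" using n1 by linarith
    then have "(real m' + 2 + real k) * (real m' + real k + ?n) \<noteq> 0" by auto
    from solve_divide[OF eq this] show ?thesis using 4 by simp
  qed
qed

subsection \<open>Bounds on harmonic components\<close>

lemma abs_coord_le_1: "z \<in> sphere_set \<Longrightarrow> \<bar>z i\<bar> \<le> 1"
proof -
  assume "z \<in> sphere_set"
  then have "(z i)\<^sup>2 \<le> 1"
    using member_le_sum[of i UNIV "\<lambda>i. (z i)\<^sup>2"] by (simp add: sphere_set_def sq_norm_def)
  then show ?thesis by (simp add: abs_square_le_1)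
qed

text \<open>The squared norms of x + y and x - y are 2 + 2 <x, y> and 2 - 2 <x, y>.\<close>

lemma abs_ip_le_1:
  assumes "x \<in> sphere_set" "y \<in> sphere_set"
  shows "\<bar>ip x y\<bar> \<le> 1"
proof -
  have 1: "sq_norm (\<lambda>i. x i + c * y i) = 1 + 2 * c * ip x y + c\<^sup>2" for c
  proof -
    have "sq_norm (\<lambda>i. x i + c * y i) = sq_norm x + 2 * c * ip x y + c\<^sup>2 * sq_norm y"
      by (simp add: sq_norm_def ip_def power2_eq_square algebra_simps sum.distrib sum_distrib_left)
    then show ?thesis using assms by (simp add: sphere_set_def)
  qed
  from 1[of 1] 1[of "-1"] sq_norm_nonneg[of "\<lambda>i. x i + y i"] sq_norm_nonneg[of "\<lambda>i. x i + - 1 * y i"]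
  show ?thesis by (simp add: abs_le_iff)
qed

text \<open>The cube contains the unit sphere as well as the product of two spheres, so one bound
  serves both.\<close>

lemma polyfun_bounded_on_cube:
  assumes "f \<in> polyfun"
  shows "\<exists>C. \<forall>z. (\<forall>i. \<bar>z i\<bar> \<le> 1) \<longrightarrow> \<bar>f z\<bar> \<le> C"
  using assms
proof (induction rule: polyfun_induct)
  case (monom a)
  have "\<bar>Defs.monom a z\<bar> \<le> 1" if "\<forall>i. \<bar>z i\<bar> \<le> 1" for z :: "'a \<Rightarrow> real"
    unfolding Defs.monom_def abs_prod power_abs
    by (rule prod_le_1) (use that in \<open>auto intro: power_le_one\<close>)
  then show ?case by blast
next
  case (cmult c f)
  then obtain C where "\<forall>z. (\<forall>i. \<bar>z i\<bar> \<le> 1) \<longrightarrow> \<bar>f z\<bar> \<le> C" by blast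
  then show ?case by (intro exI[of _ "\<bar>c\<bar> * C"]) (auto simp: abs_mult intro: mult_left_mono)
next
  case (add f g)
  then obtain C D where "\<forall>z. (\<forall>i. \<bar>z i\<bar> \<le> 1) \<longrightarrow> \<bar>f z\<bar> \<le> C" "\<forall>z. (\<forall>i. \<bar>z i\<bar> \<le> 1) \<longrightarrow> \<bar>g z\<bar> \<le> D" by blast
  then show ?case by (intro exI[of _ "C + D"]) (meson abs_triangle_ineq add_mono order_trans)
qed

lemma sph_norm_upper:
  assumes "f \<in> polyfun" "z \<in> sphere_set"
  shows "\<bar>f z\<bar> \<le> sph_norm f"
proof -
  from polyfun_bounded_on_cube[OF assms(1)] obtain C
    where "\<And>z. (\<forall>i. \<bar>z i\<bar> \<le> 1) \<Longrightarrow> \<bar>f z\<bar> \<le> C" by blast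
  then have "bdd_above ((\<lambda>z. \<bar>f z\<bar>) ` sphere_set)"
    by (intro bdd_aboveI2[of _ _ C]) (simp add: abs_coord_le_1)
  then show ?thesis unfolding sph_norm_def by (intro cSUP_upper assms)
qed

lemma sphere_nonempty: "\<exists>z. z \<in> (sphere_set :: ('v::finite \<Rightarrow> real) set)"
proof -
  obtain i :: 'v where True by blast
  have "sq_norm (\<lambda>j. if j = i then 1 else 0 :: real) = 1"
    by (simp add: sq_norm_def if_distrib[of "\<lambda>x. x ^ 2"] cong: if_cong)
  then show ?thesis by (auto simp: sphere_set_def)
qed

lemma sph_norm_least:
  fixes f :: "('v::finite \<Rightarrow> real) \<Rightarrow> real"
  assumes "\<And>z. z \<in> sphere_set \<Longrightarrow> \<bar>f z\<bar> \<le> C"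
  shows "sph_norm f \<le> C"
  unfolding sph_norm_def using sphere_nonempty by (intro cSUP_least assms) auto

lemma sph_norm_nonneg: "f \<in> polyfun \<Longrightarrow> sph_norm f \<ge> 0"
  using sphere_nonempty sph_norm_upper by (meson abs_ge_zero order_trans)

lemma abs_sph_mean_le:
  fixes f :: "('v::finite \<Rightarrow> real) \<Rightarrow> real"
  assumes "f \<in> polyfun" "\<And>z. z \<in> sphere_set \<Longrightarrow> \<bar>f z\<bar> \<le> C"
  shows "\<bar>sph_mean f\<bar> \<le> C"
proof -
  have "sph_mean f \<le> sph_mean (\<lambda>z::'v \<Rightarrow> real. C)"
    by (rule sph_mean_mono[OF assms(1) polyfun_const]) (use assms(2) in \<open>auto simp: abs_le_iff\<close>)
  moreover have "sph_mean (\<lambda>z::'v \<Rightarrow> real. - C) \<le> sph_mean f"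
    by (rule sph_mean_mono[OF polyfun_const assms(1)]) (use assms(2) in \<open>auto simp: abs_le_iff minus_le_iff\<close>)
  ultimately show ?thesis by (simp add: sph_mean_const abs_le_iff)
qed

text \<open>Averaging against \<open>\<langle>x, y\<rangle>\<^sup>m\<close> only sees the components of degree at most \<open>m\<close>,
  so the components are bounded one after the other.\<close>

lemma harmonic_component_bound:
  "\<exists>C\<ge>0. \<forall>p h M. p \<in> polyfun \<longrightarrow> (\<forall>j\<le>d. h j \<in> harm_polys j) \<longrightarrow>
     (\<forall>z\<in>sphere_set. p z = (\<Sum>j\<le>d. h j z)) \<longrightarrow> (\<forall>z\<in>sphere_set. \<bar>p z\<bar> \<le> M) \<longrightarrow> k \<le> d \<longrightarrow>
     (\<forall>x\<in>sphere_set. \<bar>h k (x :: 'v::finite \<Rightarrow> real)\<bar> \<le> C * M)"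
proof (induction k rule: less_induct)
  case (less k)
  let ?a = "fh_coeff CARD('v)"
  have a: "?a k k > 0" using fh_coeff_diag[of "CARD('v)"] one_le_card_finite[where 'a='v] by simp
  from less obtain C where C: "\<And>i. i < k \<Longrightarrow> C i \<ge> 0" and
    Cb: "\<And>i p h M x. i < k \<Longrightarrow> p \<in> polyfun \<Longrightarrow> (\<forall>j\<le>d. h j \<in> harm_polys j) \<Longrightarrow>
     (\<forall>z\<in>sphere_set. p z = (\<Sum>j\<le>d. h j z)) \<Longrightarrow> (\<forall>z\<in>sphere_set. \<bar>p z\<bar> \<le> M) \<Longrightarrow> i \<le> d \<Longrightarrow>
     x \<in> sphere_set \<Longrightarrow> \<bar>h i (x :: 'v \<Rightarrow> real)\<bar> \<le> C i * M" by metis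
  \<comment> \<open>Solves row \<open>k\<close> of the triangular system: the 1 stands for the
    average of \<open>ip x y ^ k * p y\<close>, the sum for the components already bounded.\<close>
  define D where "D = (1 + (\<Sum>i<k. \<bar>?a k i\<bar> * C i)) / ?a k k"
  show ?case
  proof (intro exI[of _ D] conjI allI impI ballI)
    show "D \<ge> 0" unfolding D_def using a C by (auto intro!: divide_nonneg_pos add_nonneg_nonneg sum_nonneg)
    fix p :: "('v \<Rightarrow> real) \<Rightarrow> real" and h M and x :: "'v \<Rightarrow> real"
    assume p: "p \<in> polyfun" and h: "\<forall>j\<le>d. h j \<in> harm_polys j"
      and eq: "\<forall>z\<in>sphere_set. p z = (\<Sum>j\<le>d. h j z)" and M: "\<forall>z\<in>sphere_set. \<bar>p z\<bar> \<le> M"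
      and kd: "k \<le> d" and x: "x \<in> sphere_set"
    have pol: "(\<lambda>y. ip x y ^ k * p y) \<in> polyfun" by (intro polyfun_intros polyfun_ip p)
    have "sph_mean (\<lambda>y. ip x y ^ k * p y) = sph_mean (\<lambda>y. \<Sum>j\<le>d. ip x y ^ k * h j y)"
      by (rule sph_mean_cong[OF pol]) (use eq in \<open>simp add: sum_distrib_left\<close>)
    also have "\<dots> = (\<Sum>j\<le>d. ?a k j * h j x)"
    proof (subst sph_mean_sum)
      show "(\<lambda>y. ip x y ^ k * h j y) \<in> polyfun" if "j \<in> {..d}" for j
        using that h by (intro polyfun_mult polyfun_power polyfun_ip) (auto intro: harm_polyfun)
      show "(\<Sum>j\<le>d. sph_mean (\<lambda>y. ip x y ^ k * h j y)) = (\<Sum>j\<le>d. ?a k j * h j x)"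
        using h x by (intro sum.cong) (auto simp: sph_mean_ip_power_mult sphere_set_def)
    qed
    also have "\<dots> = (\<Sum>j\<le>k. ?a k j * h j x)"
      by (rule sum.mono_neutral_right) (use kd fh_coeff_less in auto)
    also have "\<dots> = (\<Sum>j<k. ?a k j * h j x) + ?a k k * h k x"
      by (simp add: lessThan_Suc_atMost[symmetric])
    finally have "?a k k * h k x = sph_mean (\<lambda>y. ip x y ^ k * p y) - (\<Sum>j<k. ?a k j * h j x)" by simp
    moreover have "\<bar>sph_mean (\<lambda>y. ip x y ^ k * p y)\<bar> \<le> M"
    proof (rule abs_sph_mean_le[OF pol])
      fix y :: "'v \<Rightarrow> real" assume y: "y \<in> sphere_set"
      have "\<bar>ip x y\<bar> ^ k \<le> 1" using abs_ip_le_1[OF x y] by (intro power_le_one) auto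
      then have "\<bar>ip x y\<bar> ^ k * \<bar>p y\<bar> \<le> 1 * \<bar>p y\<bar>" by (intro mult_right_mono) auto
      also have "\<dots> \<le> M" using M y by simp
      finally show "\<bar>ip x y ^ k * p y\<bar> \<le> M" by (simp add: abs_mult power_abs)
    qed
    moreover have "\<bar>\<Sum>j<k. ?a k j * h j x\<bar> \<le> (\<Sum>j<k. \<bar>?a k j\<bar> * (C j * M))"
      using Cb[OF _ p h eq M _ x] kd
      by (intro order_trans[OF sum_abs] sum_mono) (auto simp: abs_mult intro!: mult_left_mono)
    ultimately have "\<bar>?a k k * h k x\<bar> \<le> M + (\<Sum>j<k. \<bar>?a k j\<bar> * (C j * M))" by linarith
    also have "\<dots> = (1 + (\<Sum>i<k. \<bar>?a k i\<bar> * C i)) * M"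
      by (simp add: sum_distrib_right distrib_right mult.assoc)
    also have "\<dots> = ?a k k * (D * M)"
      using a by (simp add: D_def)
    finally have "?a k k * \<bar>h k x\<bar> \<le> ?a k k * (D * M)" using a by (simp add: abs_mult)
    then show "\<bar>h k x\<bar> \<le> D * M" using a by simp
  qed
qed

lemma harmonic_component_gamma_bound:
  fixes p :: "('n::finite \<Rightarrow> real) \<Rightarrow> real"
  assumes p: "p \<in> polys d" and h: "\<And>j. j \<le> d \<Longrightarrow> h j \<in> harm_polys j"
    and eq: "\<And>z. z \<in> sphere_set \<Longrightarrow> p z = (\<Sum>j\<le>d. h j z)" and k: "k \<le> d"
    and M: "\<And>z. z \<in> sphere_set \<Longrightarrow> \<bar>p z\<bar> \<le> M" and x: "x \<in> sphere_set"
  shows "\<bar>h k x\<bar> \<le> gamma_sph TYPE('n) d * M"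
proof -
  define C where "C k = (SOME C. C \<ge> 0 \<and> (\<forall>p h M. p \<in> polyfun \<longrightarrow> (\<forall>j\<le>d. h j \<in> harm_polys j) \<longrightarrow>
     (\<forall>z\<in>sphere_set. p z = (\<Sum>j\<le>d. h j z)) \<longrightarrow> (\<forall>z\<in>sphere_set. \<bar>p z\<bar> \<le> M) \<longrightarrow> k \<le> d \<longrightarrow>
     (\<forall>x\<in>sphere_set. \<bar>h k (x :: 'n \<Rightarrow> real)\<bar> \<le> C * M)))" for k
  have C: "C k \<ge> 0 \<and> (\<forall>p h M. p \<in> polyfun \<longrightarrow> (\<forall>j\<le>d. h j \<in> harm_polys j) \<longrightarrow>
     (\<forall>z\<in>sphere_set. p z = (\<Sum>j\<le>d. h j z)) \<longrightarrow> (\<forall>z\<in>sphere_set. \<bar>p z\<bar> \<le> M) \<longrightarrow> k \<le> d \<longrightarrow>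
     (\<forall>x\<in>sphere_set. \<bar>h k (x :: 'n \<Rightarrow> real)\<bar> \<le> C k * M))" for k
    unfolding C_def by (rule someI_ex) (rule harmonic_component_bound)
  define R where "R = {sph_norm (h k) / sph_norm p | p h k.
      (p :: ('n \<Rightarrow> real) \<Rightarrow> real) \<in> polys d \<and> (\<exists>z\<in>sphere_set. p z \<noteq> 0) \<and>
      (\<forall>j\<le>d. h j \<in> harm_polys j) \<and>
      (\<forall>z\<in>sphere_set. p z = (\<Sum>j\<le>d. h j z)) \<and> k \<le> d}"
  \<comment> \<open>\<open>gamma_sph\<close> is a \<open>Sup\<close> of reals and dominates the
    quotients only once their set is bounded; the bound must not depend on \<open>p\<close>.\<close>
  have bdd: "bdd_above R"
  proof (rule bdd_aboveI[of _ "\<Sum>k\<le>d. C k"])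
    fix r assume "r \<in> R"
    then obtain p :: "('n \<Rightarrow> real) \<Rightarrow> real" and h k
      where r: "r = sph_norm (h k) / sph_norm p" and p: "p \<in> polys d"
      and nz: "\<exists>z\<in>sphere_set. p z \<noteq> 0" and h: "\<forall>j\<le>d. h j \<in> harm_polys j"
      and eq: "\<forall>z\<in>sphere_set. p z = (\<Sum>j\<le>d. h j z)" and k: "k \<le> d" unfolding R_def mem_Collect_eq by (elim exE conjE) blast
    have pp: "p \<in> polyfun" by (rule polyfunI[OF p])
    have "sph_norm (h k) \<le> C k * sph_norm p"
      using C[of k] pp h eq k sph_norm_upper[OF pp] by (intro sph_norm_least) blast
    moreover have "sph_norm p > 0"
      using nz sph_norm_upper[OF pp] by force
    ultimately have "r \<le> C k" by (simp add: r divide_le_eq)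
    also have "C k \<le> (\<Sum>k\<le>d. C k)" by (rule member_le_sum) (use k C in auto)
    finally show "r \<le> (\<Sum>k\<le>d. C k)" .
  qed
  have pp: "p \<in> polyfun" by (rule polyfunI[OF p])
  have hk: "h k \<in> polyfun" by (rule harm_polyfun[OF h[OF k]])
  have M0: "M \<ge> sph_norm p" by (rule sph_norm_least[OF M])
  show ?thesis
  proof (cases "\<exists>z\<in>sphere_set. p z \<noteq> 0")
    case True
    then have pos: "sph_norm p > 0"
      using sph_norm_upper[OF pp] by force
    have "sph_norm (h k) / sph_norm p \<in> R" unfolding R_def using p h eq k True by blast
    then have le: "sph_norm (h k) / sph_norm p \<le> gamma_sph TYPE('n) d"
      unfolding gamma_sph_def R_def[symmetric] using bdd by (rule cSup_upper)
    have g0: "0 \<le> gamma_sph TYPE('n) d"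
      by (rule order_trans[OF _ le]) (use sph_norm_nonneg[OF hk] pos in auto)
    have "\<bar>h k x\<bar> \<le> sph_norm (h k)" by (rule sph_norm_upper[OF hk x])
    also have "\<dots> \<le> gamma_sph TYPE('n) d * sph_norm p" using le pos by (simp add: divide_le_eq)
    also have "\<dots> \<le> gamma_sph TYPE('n) d * M" using g0 M0 by (rule mult_left_mono[rotated])
    finally show ?thesis .
  next
    \<comment> \<open>The quotient in \<open>gamma_sph\<close> carries no information when
      \<open>p\<close> is 0 on the sphere. Then the uniform bound with M = 0 kills the component,
      and \<open>gamma_sph\<close> is nonnegative because the constant 1 contributes a
      quotient.\<close>
    case False
    then have "\<forall>z\<in>sphere_set. \<bar>p z\<bar> \<le> 0" by auto
    then have "\<bar>h k x\<bar> \<le> C k * 0" using C[of k] pp h eq k x by blast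
    moreover have "0 \<le> gamma_sph TYPE('n) d"
    proof -
      obtain w :: "'n \<Rightarrow> real" where w: "w \<in> sphere_set" using sphere_nonempty by blast
      have "sph_norm (\<lambda>z::'n \<Rightarrow> real. 1) / sph_norm (\<lambda>z::'n \<Rightarrow> real. 1) \<in> R"
        unfolding R_def
        apply (rule CollectI)
        apply (rule exI[of _ "\<lambda>z. 1"], rule exI[of _ "\<lambda>j. if j = 0 then (\<lambda>z. 1) else (\<lambda>z. 0)"], rule exI[of _ 0])
        using w by (auto simp: polys_const harm_zero harm_less_2 hom_const if_distrib[of "\<lambda>f. f _"] cong: if_cong)
      from cSup_upper[OF this bdd] show ?thesis
        unfolding gamma_sph_def R_def[symmetric]
        by (rule order_trans[rotated]) (simp add: sph_norm_nonneg polyfun_const)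
    qed
    moreover have "M \<ge> 0" using M[OF x] by linarith
    ultimately show ?thesis by simp
  qed
qed

subsection \<open>The zonal functional and Gegenbauer polynomials\<close>

text \<open>Up to normalisation, the distribution of a coordinate on the unit sphere of dimension \<open>\<nu> + 1\<close>.\<close>

definition zint :: "nat \<Rightarrow> real poly \<Rightarrow> real" where
  "zint \<nu> p = integral {0..pi} (\<lambda>\<theta>. poly p (cos \<theta>) * sin \<theta> ^ \<nu>)"

lemma zint_continuous: "continuous_on (S :: real set) (\<lambda>\<theta>. poly p (cos \<theta>) * sin \<theta> ^ \<nu>)"
proof (rule continuous_at_imp_continuous_on, rule ballI)
  fix x :: real
  show "isCont (\<lambda>\<theta>. poly p (cos \<theta>) * sin \<theta> ^ \<nu>) x"
    unfolding poly_altdef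
    by (intro continuous_intros DERIV_isCont[OF DERIV_sin] DERIV_isCont[OF DERIV_cos])
qed

lemma zint_integrable: "(\<lambda>\<theta>. poly p (cos \<theta>) * sin \<theta> ^ \<nu>) integrable_on {0..pi}"
  by (intro integrable_continuous_real zint_continuous)

lemma zint_add: "zint \<nu> (p + q) = zint \<nu> p + zint \<nu> q"
  unfolding zint_def by (simp add: distrib_right integral_add zint_integrable)

lemma zint_smult: "zint \<nu> (smult c p) = c * zint \<nu> p"
  by (simp add: zint_def mult.assoc)

lemma zint_0: "zint \<nu> 0 = 0"
  by (simp add: zint_def)

lemma zint_diff: "zint \<nu> (p - q) = zint \<nu> p - zint \<nu> q"
  using zint_add[of \<nu> p "smult (-1) q"] by (simp only: zint_smult) simp

lemma zint_sum: "zint \<nu> (\<Sum>s\<in>S. f s) = (\<Sum>s\<in>S. zint \<nu> (f s))"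
  by (induction S rule: infinite_finite_induct) (simp_all add: zint_0 zint_add)

text \<open>With s = cos theta this is the derivative of (1 - s^2)^((\<open>\<nu>\<close>+1)/2) q
  divided by the weight (1 - s^2)^((\<open>\<nu>\<close>-1)/2). Such divergences integrate to
  0.\<close>

definition zdiv :: "nat \<Rightarrow> real poly \<Rightarrow> real poly" where
  "zdiv \<nu> q = [:1, 0, -1:] * pderiv q - smult (real \<nu> + 1) ([:0, 1:] * q)"

lemma DERIV_zdiv:
  "((\<lambda>\<theta>. sin \<theta> ^ (\<nu> + 1) * poly q (cos \<theta>)) has_real_derivative
     - (poly (zdiv \<nu> q) (cos \<theta>) * sin \<theta> ^ \<nu>)) (at \<theta>)"
proof -
  have s: "sin \<theta> * sin \<theta> = 1 - cos \<theta> * cos \<theta>"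
    using sin_cos_squared_add[of \<theta>] by (simp add: power2_eq_square)
  have "sin \<theta> ^ (\<nu> + 1) * (poly (pderiv q) (cos \<theta>) * - sin \<theta>)
     = - (sin \<theta> ^ \<nu> * ((sin \<theta> * sin \<theta>) * poly (pderiv q) (cos \<theta>)))" by simp
  then have "real (\<nu> + 1) * (sin \<theta> ^ \<nu> * cos \<theta>) * poly q (cos \<theta>)
      + sin \<theta> ^ (\<nu> + 1) * (poly (pderiv q) (cos \<theta>) * - sin \<theta>)
     = - (poly (zdiv \<nu> q) (cos \<theta>) * sin \<theta> ^ \<nu>)"
    unfolding s by (simp add: zdiv_def algebra_simps)
  moreover have "((\<lambda>\<theta>. sin \<theta> ^ (\<nu> + 1) * poly q (cos \<theta>)) has_real_derivative
     real (\<nu> + 1) * (sin \<theta> ^ \<nu> * cos \<theta>) * poly q (cos \<theta>)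
      + sin \<theta> ^ (\<nu> + 1) * (poly (pderiv q) (cos \<theta>) * - sin \<theta>)) (at \<theta>)"
    by (rule DERIV_cong[OF DERIV_mult[OF DERIV_power[OF DERIV_sin] DERIV_chain2[OF poly_DERIV DERIV_cos]]]) simp
  ultimately show ?thesis by metis
qed

lemma zint_zdiv: "zint \<nu> (zdiv \<nu> q) = 0"
proof -
  have "((\<lambda>\<theta>. - (poly (zdiv \<nu> q) (cos \<theta>) * sin \<theta> ^ \<nu>)) has_integral
     (sin pi ^ (\<nu> + 1) * poly q (cos pi) - sin 0 ^ (\<nu> + 1) * poly q (cos 0))) {0..pi}"
    by (rule fundamental_theorem_of_calculus[OF less_imp_le[OF pi_gt_zero]],
        rule has_vector_derivative_at_within, rule has_real_derivative_iff_has_vector_derivative[THEN iffD1],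
        rule DERIV_zdiv)
  from integral_unique[OF this] show ?thesis by (simp add: zint_def)
qed

text \<open>A vanishing integral of a continuous nonnegative function makes it 0 pointwise; as sin
  is positive inside the interval, u would have infinitely many roots.\<close>

lemma zint_square_pos:
  assumes "u \<noteq> 0"
  shows "zint \<nu> (u\<^sup>2) > 0"
proof -
  have nn: "poly (u\<^sup>2) (cos \<theta>) * sin \<theta> ^ \<nu> \<ge> 0" if "\<theta> \<in> {0..pi}" for \<theta>
    using that by (auto simp: poly_power sin_ge_zero)
  have "zint \<nu> (u\<^sup>2) \<ge> 0" unfolding zint_def using nn by (rule integral_nonneg[OF zint_integrable])
  moreover have "zint \<nu> (u\<^sup>2) \<noteq> 0"
  proof
    assume "zint \<nu> (u\<^sup>2) = 0"
    then have z: "\<forall>\<theta>\<in>{0..pi}. poly (u\<^sup>2) (cos \<theta>) * sin \<theta> ^ \<nu> = 0"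
      unfolding zint_def using integral_eq_0_iff[OF zint_continuous, of 0 pi "u\<^sup>2" \<nu>] nn pi_gt_zero by blast
    have "poly u s = 0" if "s \<in> {-1<..<1}" for s
    proof -
      have "sin (arccos s) \<noteq> 0" using that by (simp add: sin_arccos_nonzero)
      moreover have "arccos s \<in> {0..pi}" using that by (auto intro: arccos_lbound arccos_ubound)
      ultimately have "poly (u\<^sup>2) (cos (arccos s)) = 0" using z by force
      then show ?thesis using that by (simp add: poly_power)
    qed
    then have "{-1<..<1} \<subseteq> {s. poly u s = 0}" by auto
    moreover have "infinite {-1<..<1::real}" by (rule infinite_Ioo) simp
    ultimately show False using poly_roots_finite[OF assms] finite_subset by blast
  qed
  ultimately show ?thesis by simp
qed

lemma zint_monom_rec: "(real m + 1) * zint \<nu> (Polynomial.monom 1 m) = (real m + real \<nu> + 2) * zint \<nu> (Polynomial.monom 1 (m + 2))"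
proof -
  have "zdiv \<nu> (Polynomial.monom 1 (m + 1)) = smult (real m + 1) (Polynomial.monom 1 m) - smult (real m + real \<nu> + 2) (Polynomial.monom 1 (m + 2))"
    by (rule poly_eq_poly_eq_iff[THEN iffD1], rule ext)
       (simp add: zdiv_def pderiv_monom poly_monom algebra_simps)
  with zint_zdiv[of \<nu> "Polynomial.monom 1 (m + 1)"] show ?thesis by (simp add: zint_diff zint_smult)
qed

text \<open>Moments satisfy the recurrence of \<open>fh_coeff\<close> for k = 0 in dimension
  \<open>\<nu> + 2\<close>, by \<open>zint_zdiv\<close> on powers. This links the spherical mean of
  a function of one coordinate to an integral.\<close>

lemma zint_monom: "zint \<nu> (Polynomial.monom 1 m) = fh_coeff (\<nu> + 2) m 0 * zint \<nu> 1"
proof (induction m rule: less_induct)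
  case (less m)
  consider "m = 0" | "m = 1" | m' where "m = m' + 2" by (metis One_nat_def add_2_eq_Suc' not0_implies_Suc)
  then show ?case
  proof cases
    case 1 then show ?thesis by (simp add: monom_0 flip: one_pCons)
  next
    case 2
    have "zdiv \<nu> 1 = smult (- (real \<nu> + 1)) (Polynomial.monom 1 1)"
      by (simp add: zdiv_def monom_altdef pderiv_1)
    with zint_zdiv[of \<nu> 1] have "(real \<nu> + 1) * zint \<nu> (Polynomial.monom 1 1) = 0" by (simp add: zint_smult)
    then show ?thesis using 2 by (auto simp: add_eq_0_iff)
  next
    case 3
    from less.IH[of m'] 3 have "(real m' + 1) * (fh_coeff (\<nu> + 2) m' 0 * zint \<nu> 1) = (real m' + real \<nu> + 2) * zint \<nu> (Polynomial.monom 1 (m' + 2))"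
      using zint_monom_rec[of m' \<nu>] by simp
    then have "zint \<nu> (Polynomial.monom 1 (m' + 2)) = (real m' + 1) * (fh_coeff (\<nu> + 2) m' 0 * zint \<nu> 1) / (real m' + real \<nu> + 2)"
      by (intro solve_divide[OF sym]) auto
    moreover have "fh_coeff (\<nu> + 2) (m' + 2) 0 = (real m' + 1) * fh_coeff (\<nu> + 2) m' 0 / (real m' + real \<nu> + 2)"
    proof -
      have "fh_coeff (\<nu> + 2) (m' + 2) 0 = ((real m' + 2) * ((real m' + 1) * fh_coeff (\<nu> + 2) m' 0)) / ((real m' + 2) * (real m' + real \<nu> + 2))"
        by (simp add: add_ac mult_ac)
      also have "\<dots> = (real m' + 1) * fh_coeff (\<nu> + 2) m' 0 / (real m' + real \<nu> + 2)"
        by (rule mult_divide_mult_cancel_left) simp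
      finally show ?thesis .
    qed
    ultimately show ?thesis unfolding 3 by simp
  qed
qed

section \<open>Eigenvalues of polynomial kernels\<close>

definition fh_eigen :: "nat \<Rightarrow> real poly \<Rightarrow> nat \<Rightarrow> real" where
  "fh_eigen n \<phi> k = (\<Sum>m\<le>degree \<phi>. coeff \<phi> m * fh_coeff n m k)"

lemma polyfun_poly_ip: "(\<lambda>y. poly \<phi> (ip x y)) \<in> polyfun"
  unfolding poly_altdef by (intro polyfun_intros polyfun_ip)

lemma funk_hecke:
  fixes x :: "'v::finite \<Rightarrow> real"
  assumes h: "h \<in> harm_polys k" and x: "x \<in> sphere_set"
  shows "sph_mean (\<lambda>y. poly \<phi> (ip x y) * h y) = fh_eigen CARD('v) \<phi> k * h x"
proof -
  have p: "(\<lambda>y. ip x y ^ m * h y) \<in> polyfun" for m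
    by (intro polyfun_intros polyfun_ip harm_polyfun[OF h])
  have "sph_mean (\<lambda>y. poly \<phi> (ip x y) * h y) = sph_mean (\<lambda>y. \<Sum>m\<le>degree \<phi>. coeff \<phi> m * (ip x y ^ m * h y))"
    by (simp add: poly_altdef sum_distrib_right mult.assoc)
  also have "\<dots> = (\<Sum>m\<le>degree \<phi>. coeff \<phi> m * (fh_coeff CARD('v) m k * h x))"
    using x by (simp add: sph_mean_sum sph_mean_cmult polyfun_cmult p sph_mean_ip_power_mult[OF h] sphere_set_def)
  finally show ?thesis by (simp add: fh_eigen_def sum_distrib_right mult.assoc)
qed

text \<open>In degree 0 the eigenvalue is the mean of the kernel; by this identity both its
  normalisation and its concentration are decided by \<open>zint\<close>.\<close>

lemma fh_eigen_0_zint: "fh_eigen (\<nu> + 2) \<phi> 0 * zint \<nu> 1 = zint \<nu> \<phi>"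
proof -
  have "zint \<nu> \<phi> = zint \<nu> (\<Sum>m\<le>degree \<phi>. smult (coeff \<phi> m) (Polynomial.monom 1 m))"
    by (simp add: smult_monom poly_as_sum_of_monoms)
  also have "\<dots> = fh_eigen (\<nu> + 2) \<phi> 0 * zint \<nu> 1"
    by (simp add: zint_sum zint_smult zint_monom fh_eigen_def sum_distrib_right mult.assoc)
  finally show ?thesis by simp
qed

text \<open>The Gegenbauer operator (1 - s^2) q'' - (\<open>\<nu>\<close> + 1) s q' of parameter
  \<open>\<nu>\<close>/2, in divergence form.\<close>

definition gegen_op :: "nat \<Rightarrow> real poly \<Rightarrow> real poly" where
  "gegen_op \<nu> q = zdiv \<nu> (pderiv q)"

text \<open>Lagrange's identity. Integrated, it makes \<open>gegen_op\<close> symmetric for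
  \<open>zint\<close>; pointwise, it drives the Sturm comparison.\<close>

lemma zdiv_wronskian:
  "zdiv \<nu> (p * pderiv r - pderiv p * r) = p * gegen_op \<nu> r - r * gegen_op \<nu> p"
proof -
  have 1: "pderiv (p * pderiv r - pderiv p * r) = p * pderiv (pderiv r) - r * pderiv (pderiv p)"
    by (simp add: pderiv_mult pderiv_diff)
  show ?thesis unfolding gegen_op_def zdiv_def 1 by (simp add: algebra_simps smult_diff_right)
qed

lemma coeff_gegen_op:
  "coeff (gegen_op \<nu> q) m = real (m + 2) * real (m + 1) * coeff q (m + 2) - real m * (real m + real \<nu>) * coeff q m"
proof -
  have "gegen_op \<nu> q = pderiv (pderiv q) - pCons 0 (pCons 0 (pderiv (pderiv q))) - smult (real \<nu> + 1) (pCons 0 (pderiv q))"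
    by (simp add: gegen_op_def zdiv_def)
  then have 1: "coeff (gegen_op \<nu> q) m = coeff (pderiv (pderiv q)) m - coeff (pCons 0 (pCons 0 (pderiv (pderiv q)))) m
     - (real \<nu> + 1) * coeff (pCons 0 (pderiv q)) m" by (simp only: coeff_diff coeff_smult)
  consider "m = 0" | "m = 1" | m' where "m = Suc (Suc m')" by (metis One_nat_def not0_implies_Suc)
  then show ?thesis
    unfolding 1 by cases (simp_all add: coeff_pderiv coeff_pCons algebra_simps numeral_2_eq_2)
qed

lemma gegen_op_smult: "gegen_op \<nu> (smult c q) = smult c (gegen_op \<nu> q)"
  by (rule poly_eqI) (simp add: coeff_gegen_op algebra_simps)

text \<open>Entry \<open>i\<close> is the coefficient of s^(N - i) in the monic eigenpolynomial: the
  eigenvalue equation is solved downwards from the top, and the denominators are nonzero by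
  \<open>gegen_eigenvalue_less\<close>.\<close>

fun gegen_coeff :: "nat \<Rightarrow> nat \<Rightarrow> nat \<Rightarrow> real" where
  "gegen_coeff \<nu> N 0 = 1"
| "gegen_coeff \<nu> N (Suc 0) = 0"
| "gegen_coeff \<nu> N (Suc (Suc i)) = (let m = N - Suc (Suc i) in
     real (m + 2) * real (m + 1) * gegen_coeff \<nu> N i / (real m * (real m + real \<nu>) - real N * (real N + real \<nu>)))"

lemma gegen_eigenvalue_less: "m < N \<Longrightarrow> real m * (real m + real \<nu>) < real N * (real N + real \<nu>)"
  by (rule mult_strict_mono) auto

lemma gegen_exists:
  obtains P where "degree P = N" "P \<noteq> 0" "gegen_op \<nu> P = smult (- (real N * (real N + real \<nu>))) P"
proof -
  define P where "P = (\<Sum>m\<le>N. Polynomial.monom (gegen_coeff \<nu> N (N - m)) m)"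
  have c: "coeff P m = (if m \<le> N then gegen_coeff \<nu> N (N - m) else 0)" for m
    unfolding P_def by (simp add: coeff_sum coeff_monom)
  have 1: "coeff P N = 1" by (simp add: c)
  then have "P \<noteq> 0" by auto
  moreover from 1 have "degree P = N"
    using degree_le[of N P] le_degree[of P N] by (auto simp: c le_antisym)
  moreover have "gegen_op \<nu> P = smult (- (real N * (real N + real \<nu>))) P"
  proof (rule poly_eqI)
    fix m
    consider "m > N" | "m = N" | "m + 1 = N" | i where "N = m + Suc (Suc i)"
      by (metis One_nat_def add.commute add_Suc_right less_imp_Suc_add linorder_neqE_nat not0_implies_Suc plus_1_eq_Suc)
    then show "coeff (gegen_op \<nu> P) m = coeff (smult (- (real N * (real N + real \<nu>))) P) m"
    proof cases
      case 4
      have "real m * (real m + real \<nu>) - real N * (real N + real \<nu>) \<noteq> 0"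
        using gegen_eigenvalue_less[of m N \<nu>] 4 by simp
      then have "coeff P m * (real m * (real m + real \<nu>) - real N * (real N + real \<nu>)) = real (m + 2) * real (m + 1) * coeff P (m + 2)"
        using 4 by (simp add: c Let_def)
      moreover have "x * (a - b) = y \<Longrightarrow> y - a * x = (- b) * x" for a b x y :: real
        by (simp add: algebra_simps)
      ultimately show ?thesis unfolding coeff_gegen_op coeff_smult by blast
    qed (auto simp: coeff_gegen_op c)
  qed
  ultimately show thesis using that by blast
qed

text \<open>\<open>gegen_op\<close> maps s^j to a combination of s^j and s^(j - 2), so symmetry
  expresses a nonzero multiple of the pairing of P with s^j by the pairing with s^(j - 2). Induction
  on j then suffices.\<close>

lemma gegen_orthogonal:
  assumes P: "gegen_op \<nu> P = smult (- (real N * (real N + real \<nu>))) P" and "degree r < N"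
  shows "zint \<nu> (P * r) = 0"
proof -
  have mon: "j < N \<Longrightarrow> zint \<nu> (P * Polynomial.monom 1 j) = 0" for j
  proof (induction j rule: less_induct)
    case (less j)
    let ?M = "real N * (real N + real \<nu>)" and ?m = "real j * (real j + real \<nu>)"
    let ?x = "Polynomial.monom (1::real)"
    \<comment> \<open>For j < 2 the truncated \<open>j - 2\<close> is harmless, as its coefficient j
      (j - 1) is 0.\<close>
    have eq: "gegen_op \<nu> (?x j) = smult (real j * (real j - 1)) (?x (j - 2)) - smult ?m (?x j)"
    proof (rule poly_eqI)
      fix m
      consider "m = j" | "m + 2 = j" | "m \<noteq> j" "m + 2 \<noteq> j" by blast
      then show "coeff (gegen_op \<nu> (?x j)) m = coeff (smult (real j * (real j - 1)) (?x (j - 2)) - smult ?m (?x j)) m"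
      proof cases
        case 1
        have "j = j - 2 \<Longrightarrow> real j = 0" by simp
        then show ?thesis unfolding coeff_gegen_op using 1 by (auto simp: coeff_monom)
      next
        case 2
        then have j: "j = m + 2" by simp
        show ?thesis unfolding coeff_gegen_op j by (simp add: coeff_monom algebra_simps)
      next
        case 3
        then have "j - 2 = m \<Longrightarrow> j = 1 \<or> j = 0" by auto
        then show ?thesis unfolding coeff_gegen_op using 3 by (auto simp: coeff_monom)
      qed
    qed
    have alg: "P * (smult a p - smult b q) - q * smult (- c) P = smult a (P * p) + smult (c - b) (P * q)"
      for a b c :: real and p q
      by (rule poly_eq_poly_eq_iff[THEN iffD1], rule ext) (simp add: algebra_simps)
    have "zdiv \<nu> (P * pderiv (?x j) - pderiv P * ?x j)
      = smult (real j * (real j - 1)) (P * ?x (j - 2)) + smult (?M - ?m) (P * ?x j)"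
      unfolding zdiv_wronskian P eq by (rule alg)
    with zint_zdiv[of \<nu> "P * pderiv (?x j) - pderiv P * ?x j"]
    have "real j * (real j - 1) * zint \<nu> (P * ?x (j - 2)) + (?M - ?m) * zint \<nu> (P * ?x j) = 0"
      by (simp add: zint_add zint_smult)
    moreover have "real j * (real j - 1) * zint \<nu> (P * ?x (j - 2)) = 0"
    proof (cases "j < 2")
      case True then have "j = 0 \<or> j = 1" by auto then show ?thesis by auto
    next
      case False then show ?thesis using less.IH[of "j - 2"] less.prems by simp
    qed
    moreover have "?M - ?m \<noteq> 0" using gegen_eigenvalue_less[OF less.prems, of \<nu>] by simp
    ultimately show ?case by simp
  qed
  have "zint \<nu> (P * r) = zint \<nu> (P * (\<Sum>m\<le>degree r. smult (coeff r m) (Polynomial.monom 1 m)))"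
    by (simp add: smult_monom poly_as_sum_of_monoms)
  also have "\<dots> = (\<Sum>m\<le>degree r. coeff r m * zint \<nu> (P * Polynomial.monom 1 m))"
    by (simp add: sum_distrib_left zint_sum zint_smult)
  also have "\<dots> = 0" using mon assms(2) by (intro sum.neutral) auto
  finally show ?thesis .
qed

text \<open>Sturm comparison of \<open>P\<close> with the quadratic \<open>(s - \<xi>\<^sub>0) + \<kappa> (s - \<xi>\<^sub>0)\<^sup>2\<close>, a subsolution of the
  Gegenbauer equation on \<open>[\<xi>\<^sub>0, 1]\<close> that vanishes at \<open>\<xi>\<^sub>0\<close>.\<close>

lemma gegen_root_near_1:
  fixes \<nu> N :: nat and P :: "real poly" and \<epsilon> :: real
  defines "M \<equiv> real N * (real N + real \<nu>)"
  assumes P: "gegen_op \<nu> P = smult (- M) P" and \<epsilon>: "0 < \<epsilon>" "\<epsilon> \<le> 1" "M * \<epsilon> \<ge> (real \<nu> + 2)\<^sup>2"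
  shows "\<exists>\<xi>. 1 - \<epsilon> \<le> \<xi> \<and> \<xi> \<le> 1 \<and> poly P \<xi> = 0"
proof (rule ccontr)
  assume "\<not> ?thesis"
  then have nz: "poly P s \<noteq> 0" if "1 - \<epsilon> \<le> s" "s \<le> 1" for s using that by blast
  \<comment> \<open>Fixes the sign at 1, so that the absence of roots makes \<open>Q\<close>
    positive on the whole interval.\<close>
  define Q where "Q = smult (sgn (poly P 1)) P"
  have "sgn (poly P 1) \<noteq> 0" using nz[of 1] \<epsilon> by (simp add: sgn_zero_iff)
  then have Qnz: "poly Q s \<noteq> 0" if "1 - \<epsilon> \<le> s" "s \<le> 1" for s using nz that by (simp add: Q_def)
  have Q1: "poly Q 1 > 0" using nz[of 1] \<epsilon> by (simp add: Q_def sgn_if)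
  have Qpos: "poly Q s > 0" if "1 - \<epsilon> \<le> s" "s \<le> 1" for s
  proof (rule ccontr)
    assume "\<not> poly Q s > 0"
    then have neg: "poly Q s < 0" using Qnz[OF that] by simp
    then have "s \<noteq> 1" using Q1 by auto
    then have "s < 1" using that by simp
    from poly_IVT_pos[OF this neg Q1] obtain x where "s < x" "x < 1" "poly Q x = 0" by blast
    with Qnz[of x] that show False by auto
  qed
  have Q: "gegen_op \<nu> Q = smult (- M) Q"
    unfolding Q_def gegen_op_smult P by (simp add: mult.commute)
  \<comment> \<open>Chosen so that 2 \<open>\<kappa> * \<epsilon>\<close> = \<open>\<nu>\<close> +
    1: the lower bound for the defect of \<open>g\<close> then vanishes at \<open>\<xi>\<close>, and
    what is left is h (M - (\<open>\<nu>\<close> + 1) (\<open>\<nu>\<close> + 2) /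
    \<open>\<epsilon>\<close>), nonnegative by hypothesis.\<close>
  define \<kappa> where "\<kappa> = (real \<nu> + 1) / (2 * \<epsilon>)"
  define \<xi> where "\<xi> = 1 - \<epsilon>"
  define g where "g = [:-\<xi>, 1:] + smult \<kappa> ([:-\<xi>, 1:] * [:-\<xi>, 1:])"
  have g0: "poly g s = (s - \<xi>) + \<kappa> * (s - \<xi>)\<^sup>2" for s by (simp add: g_def power2_eq_square algebra_simps)
  have g1: "poly (pderiv g) s = 1 + 2 * \<kappa> * (s - \<xi>)" for s
    by (simp add: g_def pderiv_add pderiv_smult pderiv_mult pderiv_pCons algebra_simps)
  have g2: "poly (pderiv (pderiv g)) s = 2 * \<kappa>" for s
    by (simp add: g_def pderiv_add pderiv_smult pderiv_mult pderiv_pCons algebra_simps)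
  have \<kappa>0: "\<kappa> > 0" using \<epsilon> by (simp add: \<kappa>_def)
  have sub: "poly (gegen_op \<nu> g) s + M * poly g s \<ge> 0" if "\<xi> \<le> s" "s \<le> 1" for s
  proof -
    define h where "h = s - \<xi>"
    have h: "0 \<le> h" "h \<le> \<epsilon>" "s \<ge> 0" using that \<epsilon> by (auto simp: h_def \<xi>_def)
    have eq: "poly (gegen_op \<nu> g) s + M * poly g s
       = (1 - s * s) * (2 * \<kappa>) - (real \<nu> + 1) * (s * (1 + 2 * \<kappa> * h)) + M * (h + \<kappa> * h\<^sup>2)"
      by (simp add: gegen_op_def zdiv_def g0 g1 g2 h_def algebra_simps)
    have "s * s \<le> s * 1" using h that by (intro mult_left_mono) auto
    then have "1 - s * s \<ge> \<epsilon> - h" by (simp add: h_def \<xi>_def)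
    then have 1: "(1 - s * s) * (2 * \<kappa>) \<ge> (\<epsilon> - h) * (2 * \<kappa>)" using \<kappa>0 by (intro mult_right_mono) auto
    have "s * (1 + 2 * \<kappa> * h) \<le> 1 * (1 + 2 * \<kappa> * h)" using that \<kappa>0 h by (intro mult_right_mono) auto
    then have 2: "(real \<nu> + 1) * (s * (1 + 2 * \<kappa> * h)) \<le> (real \<nu> + 1) * (1 + 2 * \<kappa> * h)"
      by (intro mult_left_mono) auto
    have M0: "M \<ge> 0" by (simp add: M_def)
    then have 3: "M * (h + \<kappa> * h\<^sup>2) \<ge> M * h" using \<kappa>0 by (intro mult_left_mono) auto
    have k: "2 * \<kappa> = (real \<nu> + 1) / \<epsilon>" using \<epsilon> by (simp add: \<kappa>_def field_simps)
    have "(\<epsilon> - h) * (2 * \<kappa>) - (real \<nu> + 1) * (1 + 2 * \<kappa> * h) + M * h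
       = (h / \<epsilon>) * (M * \<epsilon> - (real \<nu> + 1) * (real \<nu> + 2))"
      unfolding k using \<epsilon> by (simp add: field_simps)
    also have "\<dots> \<ge> 0"
    proof (intro mult_nonneg_nonneg)
      have "(real \<nu> + 1) * (real \<nu> + 2) \<le> (real \<nu> + 2)\<^sup>2" by (simp add: power2_eq_square)
      with \<epsilon>(3) show "0 \<le> M * \<epsilon> - (real \<nu> + 1) * (real \<nu> + 2)" by linarith
    qed (use h \<epsilon> in auto)
    finally show ?thesis unfolding eq using 1 2 3 by linarith
  qed
  define V where "V = Q * pderiv g - pderiv Q * g"
  have zV: "poly (zdiv \<nu> V) s = poly Q s * (poly (gegen_op \<nu> g) s + M * poly g s)" for s
    unfolding V_def zdiv_wronskian Q by (simp add: algebra_simps)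
  define \<theta> where "\<theta> = arccos \<xi>"
  have \<xi>01: "0 \<le> \<xi>" "\<xi> < 1" using \<epsilon> by (auto simp: \<xi>_def)
  have \<theta>: "0 < \<theta>" "\<theta> < pi" "cos \<theta> = \<xi>"
    unfolding \<theta>_def using \<xi>01 arccos_lt_bounded[of \<xi>] by auto
  \<comment> \<open>By \<open>zV\<close> and \<open>sub\<close> this function of the angle does not
    increase from its value 0 at angle 0. Yet \<open>poly V \<xi>\<close> equals
    \<open>poly Q \<xi>\<close>, which is positive, because \<open>g\<close> vanishes at
    \<open>\<xi>\<close> with slope 1.\<close>
  have "sin \<theta> ^ (\<nu> + 1) * poly V (cos \<theta>) \<le> sin 0 ^ (\<nu> + 1) * poly V (cos 0)"
  proof (rule DERIV_nonpos_imp_nonincreasing[where f="\<lambda>\<theta>. sin \<theta> ^ (\<nu> + 1) * poly V (cos \<theta>)"])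
    fix x assume x: "0 \<le> x" "x \<le> \<theta>"
    have "\<xi> \<le> cos x" using cos_monotone_0_pi_le[of x \<theta>] x \<theta> by auto
    then have "poly (zdiv \<nu> V) (cos x) \<ge> 0"
      unfolding zV using Qpos[of "cos x"] sub[of "cos x"] by (simp add: \<xi>_def)
    moreover have "sin x \<ge> 0" using x \<theta> by (intro sin_ge_zero) auto
    ultimately have "- (poly (zdiv \<nu> V) (cos x) * sin x ^ \<nu>) \<le> 0" by simp
    with DERIV_zdiv show "\<exists>y. ((\<lambda>\<theta>. sin \<theta> ^ (\<nu> + 1) * poly V (cos \<theta>)) has_real_derivative y) (at x) \<and> y \<le> 0"
      by blast
  qed (use \<theta> in simp)
  then have "sin \<theta> ^ (\<nu> + 1) * poly V \<xi> \<le> 0" by (simp add: \<theta>)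
  moreover have "poly V \<xi> > 0" using Qpos[of \<xi>] \<xi>01 by (simp add: V_def g0 g1 \<xi>_def)
  moreover have "sin \<theta> ^ (\<nu> + 1) > 0" using \<theta> by (intro zero_less_power sin_gt_zero)
  ultimately show False using mult_pos_pos[of "sin \<theta> ^ (\<nu> + 1)" "poly V \<xi>"] by linarith
qed

text \<open>From 1 - s = (1 - \<open>\<xi>\<close>) - (s - \<open>\<xi>\<close>) follows (1 - s) u^2
  = (1 - \<open>\<xi>\<close>) u^2 - P u, and orthogonality removes P u. The mean of 1 - s relative
  to u^2 is thus exactly 1 - \<open>\<xi>\<close>.\<close>

lemma concentrated_square:
  fixes \<nu> N :: nat
  assumes "N > 0" "(real \<nu> + 2)\<^sup>2 \<le> real N * (real N + real \<nu>)"
  obtains u where "u \<noteq> 0" "degree u < N"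
    "zint \<nu> ([:1, -1:] * u\<^sup>2) \<le> (real \<nu> + 2)\<^sup>2 / (real N * (real N + real \<nu>)) * zint \<nu> (u\<^sup>2)"
proof -
  let ?M = "real N * (real N + real \<nu>)"
  obtain P where P: "degree P = N" "P \<noteq> 0" "gegen_op \<nu> P = smult (- ?M) P" by (rule gegen_exists)
  have M: "?M > 0" using assms(1) by (intro mult_pos_pos add_pos_nonneg) auto
  define \<epsilon> where "\<epsilon> = (real \<nu> + 2)\<^sup>2 / ?M"
  have \<epsilon>: "0 < \<epsilon>" "\<epsilon> \<le> 1" "?M * \<epsilon> \<ge> (real \<nu> + 2)\<^sup>2"
    using M assms by (auto simp: \<epsilon>_def intro!: divide_pos_pos)
  obtain \<xi> where \<xi>: "1 - \<epsilon> \<le> \<xi>" "poly P \<xi> = 0" using gegen_root_near_1[OF P(3) \<epsilon>] by blast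
  then obtain u where u: "P = [:-\<xi>, 1:] * u" by (auto simp: poly_eq_0_iff_dvd)
  with P have u0: "u \<noteq> 0" by auto
  have "degree P = Suc (degree u)" unfolding u using u0 by (subst degree_mult_eq) auto
  with P have deg: "degree u < N" by simp
  have "[:1, -1:] * u\<^sup>2 = smult (1 - \<xi>) (u\<^sup>2) - P * u"
    unfolding u by (rule poly_eq_poly_eq_iff[THEN iffD1], rule ext) (simp add: power2_eq_square algebra_simps)
  then have "zint \<nu> ([:1, -1:] * u\<^sup>2) = (1 - \<xi>) * zint \<nu> (u\<^sup>2)"
    by (simp only: zint_diff zint_smult gegen_orthogonal[OF P(3) deg])
  also have "\<dots> \<le> \<epsilon> * zint \<nu> (u\<^sup>2)"
    using \<xi> zint_square_pos[OF u0, of \<nu>] by (intro mult_right_mono) auto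
  finally show thesis using that[OF u0 deg] unfolding \<epsilon>_def by blast
qed

subsection \<open>A concentrated kernel\<close>

text \<open>Planar harmonics satisfy \<open>1 - Re (w ^ k) \<le> k\<^sup>2 * (1 - Re w)\<close> on the unit disc, which bounds the
  eigenvalues of degree \<open>k\<close> by the one of degree 1.\<close>

definition planar_re :: "'v \<Rightarrow> 'v \<Rightarrow> nat \<Rightarrow> ('v::finite \<Rightarrow> real) \<Rightarrow> real" where
  "planar_re i j k z = Re (Complex (z i) (z j) ^ k)"

definition planar_im :: "'v \<Rightarrow> 'v \<Rightarrow> nat \<Rightarrow> ('v::finite \<Rightarrow> real) \<Rightarrow> real" where
  "planar_im i j k z = Im (Complex (z i) (z j) ^ k)"

lemma planar_Suc:
  "planar_re i j (Suc k) = (\<lambda>z. z i * planar_re i j k z - z j * planar_im i j k z)"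
  "planar_im i j (Suc k) = (\<lambda>z. z i * planar_im i j k z + z j * planar_re i j k z)"
  by (auto simp: planar_re_def planar_im_def)

lemma planar_0: "planar_re i j 0 = (\<lambda>z. 1)" "planar_im i j 0 = (\<lambda>z. 0)"
  by (auto simp: planar_re_def planar_im_def)

lemma laplacian_coord: "laplacian (\<lambda>z. z i) = (\<lambda>z. 0)"
  by (simp add: laplacian_eq polyfun_coord pd_coord pd_const)

lemma laplacian_coord_mult:
  assumes "f \<in> polyfun"
  shows "laplacian (\<lambda>z. z i * f z) = (\<lambda>z. z i * laplacian f z + 2 * pd i f z)"
proof -
  have "(\<Sum>l\<in>UNIV. (if l = i then 1 else 0) * pd l f z) = pd i f z" for z
    by (simp add: if_distrib[of "\<lambda>x. x * _"] cong: if_cong)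
  then show ?thesis by (simp add: laplacian_mult polyfun_coord assms laplacian_coord pd_coord)
qed

text \<open>The Cauchy-Riemann equations are part of the induction because they cancel the
  first-order terms left by \<open>laplacian_coord_mult\<close>.\<close>

lemma planar_harmonic:
  assumes ij: "i \<noteq> j"
  shows "planar_re i j k \<in> hom_polys k \<and> planar_im i j k \<in> hom_polys k \<and>
    pd i (planar_re i j k) = pd j (planar_im i j k) \<and>
    pd j (planar_re i j k) = (\<lambda>z. - pd i (planar_im i j k) z) \<and>
    laplacian (planar_re i j k) = (\<lambda>z. 0) \<and> laplacian (planar_im i j k) = (\<lambda>z. 0)"
proof (induction k)
  case 0
  show ?case unfolding planar_0 by (simp add: hom_const pd_const laplacian_const)
next
  case (Suc k)
  let ?R = "planar_re i j k" and ?I = "planar_im i j k"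
  from Suc have R: "?R \<in> hom_polys k" and I: "?I \<in> hom_polys k"
    and cr: "pd i ?R = pd j ?I" "pd j ?R = (\<lambda>z. - pd i ?I z)"
    and L: "laplacian ?R = (\<lambda>z. 0)" "laplacian ?I = (\<lambda>z. 0)" by auto
  have p: "?R \<in> polyfun" "?I \<in> polyfun" using R I by (auto intro: polyfun_hom)
  have pc: "(\<lambda>z. z l * ?R z) \<in> polyfun" "(\<lambda>z. z l * ?I z) \<in> polyfun" for l
    by (intro polyfun_intros p)+
  have hc: "(\<lambda>z. z l * ?R z) \<in> hom_polys (Suc k)" "(\<lambda>z. z l * ?I z) \<in> hom_polys (Suc k)" for l
    using hom_mult[OF hom_coord R, of l] hom_mult[OF hom_coord I, of l] by auto
  show ?case
  proof (intro conjI)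
    show "planar_re i j (Suc k) \<in> hom_polys (Suc k)"
      unfolding planar_Suc using hom_add[OF hc(1)[of i] hom_cmult[OF hc(2)[of j], of "-1"]] by simp
    show "planar_im i j (Suc k) \<in> hom_polys (Suc k)"
      unfolding planar_Suc by (intro hom_add hc)
    show "laplacian (planar_re i j (Suc k)) = (\<lambda>z. 0)" "laplacian (planar_im i j (Suc k)) = (\<lambda>z. 0)"
      unfolding planar_Suc by (simp_all add: laplacian_diff laplacian_add pc laplacian_coord_mult p L cr)
    show "pd i (planar_re i j (Suc k)) = pd j (planar_im i j (Suc k))"
      "pd j (planar_re i j (Suc k)) = (\<lambda>z. - pd i (planar_im i j (Suc k)) z)"
      unfolding planar_Suc using ij
      by (simp_all add: pd_diff pd_add pc pd_mult polyfun_coord p pd_coord cr fun_eq_iff)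
  qed
qed

lemma planar_re_harm: "i \<noteq> j \<Longrightarrow> planar_re i j k \<in> harm_polys k"
  using planar_harmonic[of i j k] by (simp add: harm_polys_def)

text \<open>2 (1 - Re v) = |1 - v|^2 + (1 - |v|^2). Passing from w to its k-th power multiplies the
  first term by at most k^2 and the second by at most k.\<close>

lemma one_minus_Re_power_le:
  fixes w :: complex
  assumes "norm w \<le> 1"
  shows "1 - Re (w ^ k) \<le> (real k)\<^sup>2 * (1 - Re w)"
proof -
  have id: "2 * (1 - Re v) = (norm (1 - v))\<^sup>2 + (1 - (norm v)\<^sup>2)" for v
  proof -
    have "(norm (1 - v))\<^sup>2 = (1 - Re v)\<^sup>2 + (Im v)\<^sup>2" "(norm v)\<^sup>2 = (Re v)\<^sup>2 + (Im v)\<^sup>2"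
      by (simp_all add: cmod_power2)
    then show ?thesis by (simp add: power2_eq_square algebra_simps)
  qed
  have "norm (1 ^ k - w ^ k) \<le> real k * norm (1 - w)"
    by (rule norm_power_diff) (use assms in auto)
  then have 1: "(norm (1 - w ^ k))\<^sup>2 \<le> (real k)\<^sup>2 * (norm (1 - w))\<^sup>2"
    unfolding power_mult_distrib[symmetric] by (intro power_mono) auto
  have r: "(norm w)\<^sup>2 \<le> 1" using assms by (simp add: power_le_one)
  have "norm (1 ^ k - ((norm w)\<^sup>2) ^ k) \<le> real k * norm (1 - (norm w)\<^sup>2)"
    by (rule norm_power_diff) (use r in auto)
  then have "1 - ((norm w)\<^sup>2) ^ k \<le> real k * (1 - (norm w)\<^sup>2)" using r by simp
  also have "\<dots> \<le> (real k)\<^sup>2 * (1 - (norm w)\<^sup>2)"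
  proof (intro mult_right_mono)
    show "real k \<le> (real k)\<^sup>2" by (cases k) (auto simp: power2_eq_square)
  qed (use r in simp)
  finally have 2: "1 - (norm (w ^ k))\<^sup>2 \<le> (real k)\<^sup>2 * (1 - (norm w)\<^sup>2)"
    by (simp add: norm_power power_mult[symmetric] mult.commute)
  have "2 * (1 - Re (w ^ k)) \<le> (real k)\<^sup>2 * (2 * (1 - Re w))"
    unfolding id distrib_left using 1 2 by linarith
  then have "2 * (1 - Re (w ^ k)) \<le> 2 * ((real k)\<^sup>2 * (1 - Re w))"
    unfolding mult.left_commute[of _ 2] .
  then show ?thesis by (rule mult_left_le_imp_le) simp
qed

lemma planar_norm_le_1:
  assumes "y \<in> sphere_set" "i \<noteq> j"
  shows "norm (Complex (y i) (y j)) \<le> 1"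
proof -
  have "(\<Sum>l\<in>{i, j}. (y l)\<^sup>2) \<le> (\<Sum>l\<in>UNIV. (y l)\<^sup>2)" by (rule sum_mono2) auto
  then show ?thesis using assms by (simp add: sphere_set_def sq_norm_def cmod_def)
qed

text \<open>The degree k harmonic \<open>planar_re i j k\<close> equals 1 at the coordinate vector
  \<open>e\<close>, so the Funk-Hecke formula at \<open>e\<close> expresses the eigenvalue as its
  mean against the kernel. Two coordinates are required for it.\<close>

lemma fh_eigen_bounds:
  assumes card: "CARD('v::finite) \<ge> 2" and nn: "\<And>s. \<bar>s\<bar> \<le> 1 \<Longrightarrow> poly \<phi> s \<ge> 0"
    and one: "fh_eigen CARD('v) \<phi> 0 = 1"
  shows "fh_eigen CARD('v) \<phi> k \<le> 1"
    and "1 - fh_eigen CARD('v) \<phi> k \<le> (real k)\<^sup>2 * fh_eigen CARD('v) ([:1, -1:] * \<phi>) 0"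
proof -
  obtain i j :: 'v where ij: "i \<noteq> j"
    using card by (metis UNIV_I card_le_Suc0_iff_eq finite not_less_eq_eq numeral_2_eq_2)
  define e :: "'v \<Rightarrow> real" where "e = (\<lambda>l. if l = i then 1 else 0)"
  have ip_e: "ip e y = y i" for y by (simp add: ip_def e_def if_distrib[of "\<lambda>x. x * _"] cong: if_cong)
  have e: "e \<in> sphere_set" using ip_e[of e] by (simp add: sphere_set_def ip_self e_def)
  have Ce: "Complex (e i) (e j) = 1" using ij by (simp add: e_def complex_eq_iff)
  let ?lam = "fh_eigen CARD('v) \<phi>"
  have pp: "(\<lambda>y. poly \<psi> (ip e y)) \<in> polyfun" for \<psi> by (rule polyfun_poly_ip)
  have pR: "planar_re i j k \<in> polyfun" by (rule harm_polyfun[OF planar_re_harm[OF ij]])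
  have m0: "sph_mean (\<lambda>y. poly \<psi> (ip e y)) = fh_eigen CARD('v) \<psi> 0" for \<psi>
    using funk_hecke[OF harm_less_2[OF hom_const[of 1]] e, of \<psi>] by simp
  have mk: "sph_mean (\<lambda>y. poly \<phi> (ip e y) * planar_re i j k y) = ?lam k"
    using funk_hecke[OF planar_re_harm[OF ij, of k] e, of \<phi>] by (simp add: planar_re_def Ce)
  have pos: "poly \<phi> (ip e y) \<ge> 0" if "y \<in> sphere_set" for y
    using nn abs_ip_le_1[OF e that] by simp
  have "?lam k \<le> ?lam 0"
    unfolding mk[symmetric] m0[symmetric]
  proof (rule sph_mean_mono)
    fix y :: "'v \<Rightarrow> real" assume y: "y \<in> sphere_set"
    have "planar_re i j k y \<le> norm (Complex (y i) (y j) ^ k)"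
      unfolding planar_re_def by (rule complex_Re_le_cmod)
    also have "\<dots> \<le> 1" unfolding norm_power using planar_norm_le_1[OF y ij] by (intro power_le_one) auto
    finally show "poly \<phi> (ip e y) * planar_re i j k y \<le> poly \<phi> (ip e y)"
      using mult_left_mono[OF _ pos[OF y], of "planar_re i j k y" 1] by simp
  qed (intro polyfun_intros pp pR)+
  then show "?lam k \<le> 1" by (simp add: one)
  have "?lam 0 - ?lam k = sph_mean (\<lambda>y. poly \<phi> (ip e y) - poly \<phi> (ip e y) * planar_re i j k y)"
    unfolding mk[symmetric] m0[symmetric] by (rule sph_mean_diff[symmetric]) (intro polyfun_intros pp pR)+
  also have "\<dots> \<le> sph_mean (\<lambda>y. (real k)\<^sup>2 * poly ([:1, -1:] * \<phi>) (ip e y))"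
  proof (rule sph_mean_mono)
    fix y :: "'v \<Rightarrow> real" assume y: "y \<in> sphere_set"
    have "1 - planar_re i j k y \<le> (real k)\<^sup>2 * (1 - y i)"
      unfolding planar_re_def using one_minus_Re_power_le[OF planar_norm_le_1[OF y ij], of k] by simp
    from mult_left_mono[OF this pos[OF y]]
    show "poly \<phi> (ip e y) - poly \<phi> (ip e y) * planar_re i j k y \<le> (real k)\<^sup>2 * poly ([:1, -1:] * \<phi>) (ip e y)"
      by (simp add: ip_e algebra_simps)
  qed (intro polyfun_intros pp pR)+
  also have "\<dots> = (real k)\<^sup>2 * fh_eigen CARD('v) ([:1, -1:] * \<phi>) 0"
    unfolding m0[symmetric] by (rule sph_mean_cmult[OF pp])
  finally show "1 - ?lam k \<le> (real k)\<^sup>2 * fh_eigen CARD('v) ([:1, -1:] * \<phi>) 0" by (simp add: one)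
qed

lemma concentrated_kernel:
  assumes t: "t \<ge> 1" "CARD('v::finite) \<le> t"
  shows "\<exists>u lam. degree u \<le> t \<and> lam 0 = 1 \<and>
    (\<forall>k. lam k \<le> 1 \<and> 1 - lam k \<le> (real k)\<^sup>2 * (real CARD('v))\<^sup>2 / (real t)\<^sup>2) \<and>
    (\<forall>k. \<forall>h\<in>harm_polys k. \<forall>x\<in>sphere_set. sph_mean (\<lambda>y::'v \<Rightarrow> real. (poly u (ip x y))\<^sup>2 * h y) = lam k * h x)"
proof (cases "CARD('v) \<ge> 2")
  case False
  have "CARD('v) \<ge> 1" using one_le_card_finite[where 'a='v] by simp
  with False have c1: "CARD('v) = 1" by linarith
  \<comment> \<open>On the two-point sphere the kernel (1 + s)^2 / 2 is 2 at y = x and 0 at y = -x,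
    so averaging against it is the identity and all eigenvalues are 1.\<close>
  define u :: "real poly" where "u = smult (1 / sqrt 2) [:1, 1:]"
  have u: "(poly u s)\<^sup>2 = (1 + s)\<^sup>2 / 2" for s
  proof -
    have "poly u s = (1 + s) / sqrt 2" by (simp add: u_def add_divide_distrib)
    then show ?thesis by (simp add: power_divide)
  qed
  have dich: "y = x \<or> ip x y = -1" if "x \<in> sphere_set" "y \<in> sphere_set" for x y :: "'v \<Rightarrow> real"
  proof -
    from c1 obtain a :: 'v where a: "UNIV = {a}" by (auto simp: card_1_singleton_iff)
    from that have "(x a)\<^sup>2 = 1" "(y a)\<^sup>2 = 1" by (auto simp: sphere_set_def sq_norm_def a)
    then have xy: "x a = 1 \<or> x a = -1" "y a = 1 \<or> y a = -1" by (auto simp: power2_eq_1_iff)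
    have eq: "y = x" if "y a = x a"
    proof
      fix l :: 'v
      have "l = a" using UNIV_I[of l] unfolding a by simp
      with that show "y l = x l" by simp
    qed
    have "ip x y = x a * y a" by (simp add: ip_def a)
    then show ?thesis using xy eq by fastforce
  qed
  have pu: "(\<lambda>y. (poly u (ip x y))\<^sup>2 * h y) \<in> polyfun" if "h \<in> polyfun" for x :: "'v \<Rightarrow> real" and h
    by (intro polyfun_intros polyfun_poly_ip that)
  have X: "sph_mean (\<lambda>y. (poly u (ip x y))\<^sup>2 * h y) = sph_mean (\<lambda>y. (poly u (ip x y))\<^sup>2) * h x"
    if "h \<in> polyfun" "x \<in> sphere_set" for x :: "'v \<Rightarrow> real" and h
  proof -
    have "sph_mean (\<lambda>y. (poly u (ip x y))\<^sup>2 * h y) = sph_mean (\<lambda>y. h x * (poly u (ip x y))\<^sup>2)"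
    proof (rule sph_mean_cong[OF pu[OF that(1)]])
      fix y :: "'v \<Rightarrow> real" assume "y \<in> sphere_set"
      from dich[OF that(2) this] show "(poly u (ip x y))\<^sup>2 * h y = h x * (poly u (ip x y))\<^sup>2"
        by (elim disjE) (simp_all add: u)
    qed
    also have "\<dots> = h x * sph_mean (\<lambda>y. (poly u (ip x y))\<^sup>2)"
      by (rule sph_mean_cmult) (intro polyfun_intros polyfun_poly_ip)
    finally show ?thesis by simp
  qed
  have Y: "sph_mean (\<lambda>y. (poly u (ip x y))\<^sup>2) = 1" if x: "x \<in> sphere_set" for x :: "'v \<Rightarrow> real"
  proof -
    \<comment> \<open>At s = 1 and s = -1 the kernel coincides with 1 + s, whose mean is
      known.\<close>
    have "sph_mean (\<lambda>y. (poly u (ip x y))\<^sup>2) = sph_mean (\<lambda>y. 1 + ip x y)"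
    proof (rule sph_mean_cong)
      show "(\<lambda>y. (poly u (ip x y))\<^sup>2) \<in> polyfun" by (intro polyfun_intros polyfun_poly_ip)
      fix y :: "'v \<Rightarrow> real" assume "y \<in> sphere_set"
      from dich[OF x this] show "(poly u (ip x y))\<^sup>2 = 1 + ip x y"
        using x by (auto simp: u ip_self sphere_set_def)
    qed
    also have "\<dots> = 1 + sph_mean (\<lambda>y. ip x y)" by (simp add: sph_mean_add polyfun_const polyfun_ip sph_mean_const)
    also have "sph_mean (\<lambda>y. ip x y) = 0" using sph_mean_harm[OF harm_less_2[OF hom_ip[of x]]] by simp
    finally show ?thesis by simp
  qed
  have "degree u \<le> t" using t by (simp add: u_def)
  then show ?thesis
    by (intro exI[of _ u] exI[of _ "\<lambda>k. 1"]) (simp add: X Y harm_polyfun)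
next
  case True
  then obtain \<nu> where n: "CARD('v) = \<nu> + 2" by (metis add.commute le_Suc_ex)
  \<comment> \<open>N = t + 1, because dividing out a root lowers the degree to t. Since
    \<open>?M\<close> is at least t^2, the hypothesis n <= t gives the condition of
    \<open>concentrated_square\<close>.\<close>
  let ?M = "real (t + 1) * (real (t + 1) + real \<nu>)"
  have Mt: "(real t)\<^sup>2 \<le> ?M" unfolding power2_eq_square by (intro mult_mono) auto
  have nt: "(real \<nu> + 2)\<^sup>2 \<le> (real t)\<^sup>2" using t n by (intro power_mono) auto
  obtain u0 where u0: "u0 \<noteq> 0" "degree u0 < t + 1"
    "zint \<nu> ([:1, -1:] * u0\<^sup>2) \<le> (real \<nu> + 2)\<^sup>2 / ?M * zint \<nu> (u0\<^sup>2)"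
    by (rule concentrated_square[OF _ order_trans[OF nt Mt]]) (simp, rule that)
  have z1: "zint \<nu> 1 > 0" using zint_square_pos[of 1 \<nu>] by simp
  have zu: "zint \<nu> (u0\<^sup>2) > 0" by (rule zint_square_pos[OF u0(1)])
  \<comment> \<open>Scales the kernel to mean 1, so that constants are fixed.\<close>
  define c where "c = zint \<nu> 1 / zint \<nu> (u0\<^sup>2)"
  define u where "u = smult (sqrt c) u0"
  define \<phi> where "\<phi> = smult c (u0\<^sup>2)"
  have c: "c > 0" using z1 zu by (simp add: c_def)
  have \<phi>: "poly \<phi> s = (poly u s)\<^sup>2" for s using c by (simp add: \<phi>_def u_def poly_power power_mult_distrib)
  have E: "fh_eigen CARD('v) \<psi> 0 = zint \<nu> \<psi> / zint \<nu> 1" for \<psi>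
    using fh_eigen_0_zint[of \<nu> \<psi>] z1 by (simp add: n field_simps)
  have one: "fh_eigen CARD('v) \<phi> 0 = 1" using z1 zu by (simp add: E \<phi>_def zint_smult c_def)
  have "fh_eigen CARD('v) ([:1, -1:] * \<phi>) 0 = zint \<nu> ([:1, -1:] * u0\<^sup>2) / zint \<nu> (u0\<^sup>2)"
    using z1 by (simp add: E \<phi>_def zint_smult c_def del: mult_pCons_left)
  also have "\<dots> \<le> (real \<nu> + 2)\<^sup>2 / ?M" using u0(3) zu by (simp add: divide_le_eq del: mult_pCons_left)
  also have "\<dots> \<le> (real \<nu> + 2)\<^sup>2 / (real t)\<^sup>2"
    using Mt t by (intro divide_left_mono mult_pos_pos) auto
  finally have eps: "fh_eigen CARD('v) ([:1, -1:] * \<phi>) 0 \<le> (real CARD('v))\<^sup>2 / (real t)\<^sup>2" by (simp add: n add.commute[of 2])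
  have nn: "\<And>s. \<bar>s\<bar> \<le> 1 \<Longrightarrow> poly \<phi> s \<ge> 0" by (simp add: \<phi>)
  note b = fh_eigen_bounds[OF True nn one]
  have "1 - fh_eigen CARD('v) \<phi> k \<le> (real k)\<^sup>2 * (real CARD('v))\<^sup>2 / (real t)\<^sup>2" for k
    using order_trans[OF b(2) mult_left_mono[OF eps]] by simp
  moreover have "sph_mean (\<lambda>y::'v \<Rightarrow> real. (poly u (ip x y))\<^sup>2 * h y) = fh_eigen CARD('v) \<phi> k * h x"
    if "h \<in> harm_polys k" "x \<in> sphere_set" for k h x
    using funk_hecke[OF that, of \<phi>] by (simp add: \<phi>)
  moreover have "degree u \<le> t" using u0(2) by (simp add: u_def)
  ultimately show ?thesis using b(1) one by (intro exI[of _ u] exI[of _ "fh_eigen CARD('v) \<phi>"]) auto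
qed

subsection \<open>Finite sums of products\<close>

text \<open>The algebraic tensor product, with the factors kept in prescribed spaces. Iterated means
  and product kernels act factor by factor, so induction reduces two variables to one.\<close>

inductive tensor :: "('a \<Rightarrow> real) set \<Rightarrow> ('b \<Rightarrow> real) set \<Rightarrow> ('a \<Rightarrow> 'b \<Rightarrow> real) \<Rightarrow> bool"
  for F G where
  zero: "tensor F G (\<lambda>x y. 0)"
| step: "f \<in> F \<Longrightarrow> g \<in> G \<Longrightarrow> tensor F G h \<Longrightarrow> tensor F G (\<lambda>x y. f x * g y + h x y)"

lemma tensor_prod: "f \<in> F \<Longrightarrow> g \<in> G \<Longrightarrow> tensor F G (\<lambda>x y. f x * g y)"
  using tensor.step[OF _ _ tensor.zero, of f F g G] by simp

lemma tensor_add: "tensor F G h \<Longrightarrow> tensor F G h' \<Longrightarrow> tensor F G (\<lambda>x y. h x y + h' x y)"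
  by (induction rule: tensor.induct) (auto simp: add.assoc intro: tensor.step)

lemma tensor_sum: "(\<And>s. s \<in> S \<Longrightarrow> tensor F G (h s)) \<Longrightarrow> tensor F G (\<lambda>x y. \<Sum>s\<in>S. h s x y)"
  by (induction S rule: infinite_finite_induct) (auto intro: tensor.zero tensor_add)

lemma tensor_cmult:
  assumes "tensor F G h" "\<And>f. f \<in> F \<Longrightarrow> (\<lambda>x. c * f x) \<in> F"
  shows "tensor F G (\<lambda>x y. c * h x y)"
  using assms(1)
proof (induction rule: tensor.induct)
  case zero then show ?case using tensor.zero by simp
next
  case (step f g h)
  then show ?case using tensor.step[OF assms(2)[OF step(1)] step(2) step(4)]
    by (simp add: distrib_left mult.assoc)
qed

lemma tensor_mono: "tensor F G h \<Longrightarrow> F \<subseteq> F' \<Longrightarrow> G \<subseteq> G' \<Longrightarrow> tensor F' G' h"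
  by (induction rule: tensor.induct) (auto intro: tensor.intros)

lemma tensor_mult:
  assumes "tensor F G h" "tensor F' G' h'"
    and F: "\<And>f f'. f \<in> F \<Longrightarrow> f' \<in> F' \<Longrightarrow> (\<lambda>x. f x * f' x) \<in> F''"
    and G: "\<And>g g'. g \<in> G \<Longrightarrow> g' \<in> G' \<Longrightarrow> (\<lambda>y. g y * g' y) \<in> G''"
  shows "tensor F'' G'' (\<lambda>x y. h x y * h' x y)"
  using assms(1)
proof (induction rule: tensor.induct)
  case zero show ?case using tensor.zero by simp
next
  case (step f g h)
  have "tensor F'' G'' (\<lambda>x y. (f x * g y) * h' x y)"
    using assms(2)
  proof (induction rule: tensor.induct)
    case zero show ?case using tensor.zero by simp
  next
    case st: (step f' g' k)
    have "(\<lambda>x y. f x * g y * (f' x * g' y + k x y)) = (\<lambda>x y. (f x * f' x) * (g y * g' y) + f x * g y * k x y)"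
      by (simp add: algebra_simps)
    with tensor.step[OF F[OF step(1) st(1)] G[OF step(2) st(2)] st(4)] show ?case by simp
  qed
  from tensor_add[OF this step(4)] show ?case by (simp add: distrib_right)
qed

lemma tensor_left: "tensor F G h \<Longrightarrow> (\<lambda>x. 0) \<in> F \<Longrightarrow> (\<And>f f'. f \<in> F \<Longrightarrow> f' \<in> F \<Longrightarrow> (\<lambda>x. f x + f' x) \<in> F) \<Longrightarrow>
    (\<And>c f. f \<in> F \<Longrightarrow> (\<lambda>x. c * f x) \<in> F) \<Longrightarrow> (\<lambda>x. h x y) \<in> F"
proof (induction rule: tensor.induct)
  case (step f g h)
  have "(\<lambda>x. g y * f x) \<in> F" using step by blast
  then have "(\<lambda>x. f x * g y) \<in> F" by (simp add: mult.commute)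
  with step show ?case by blast
qed

lemma tensor_right: "tensor F G h \<Longrightarrow> (\<lambda>y. 0) \<in> G \<Longrightarrow> (\<And>f f'. f \<in> G \<Longrightarrow> f' \<in> G \<Longrightarrow> (\<lambda>y. f y + f' y) \<in> G) \<Longrightarrow>
    (\<And>c f. f \<in> G \<Longrightarrow> (\<lambda>y. c * f y) \<in> G) \<Longrightarrow> (\<lambda>y. h x y) \<in> G"
proof (induction rule: tensor.induct)
  case (step f g h)
  have "(\<lambda>y. f x * g y) \<in> G" using step by blast
  with step show ?case by blast
qed

lemma tensor_harm_left: "tensor (harm_polys j) G h \<Longrightarrow> (\<lambda>x. h x y) \<in> harm_polys j"
  by (rule tensor_left) (auto intro: harm_zero harm_add harm_cmult)

lemma tensor_harm_right: "tensor F (harm_polys k) h \<Longrightarrow> h x \<in> harm_polys k"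
  using tensor_right[of F "harm_polys k" h x] by (auto intro: harm_zero harm_add harm_cmult)

abbreviation "bipoly \<equiv> tensor polyfun polyfun"

lemma bipoly_right: "bipoly h \<Longrightarrow> (\<lambda>y. h x y) \<in> polyfun"
  by (rule tensor_right[of polyfun polyfun]) (auto intro: polyfun_intros)

lemma bipoly_mult: "bipoly h \<Longrightarrow> bipoly h' \<Longrightarrow> bipoly (\<lambda>x y. h x y * h' x y)"
  by (rule tensor_mult) (auto intro: polyfun_mult)

lemma bipoly_cmult: "bipoly h \<Longrightarrow> bipoly (\<lambda>x y. c * h x y)"
  by (rule tensor_cmult) (auto intro: polyfun_cmult)

lemma bipoly_harm: "tensor (harm_polys j) (harm_polys k) h \<Longrightarrow> bipoly h"
  by (rule tensor_mono) (auto intro: harm_polyfun)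

text \<open>Ensures that the outer mean in \<open>pmean\<close> is applied to a polynomial function,
  where linearity and positivity are available.\<close>

lemma sph_mean_bipoly: "bipoly h \<Longrightarrow> (\<lambda>x. sph_mean (h x)) \<in> polyfun"
proof (induction rule: tensor.induct)
  case zero then show ?case by (simp add: sph_mean_const polyfun_const)
next
  case (step f g h)
  have "(\<lambda>x. sph_mean (\<lambda>y. f x * g y + h x y)) = (\<lambda>x. f x * sph_mean g + sph_mean (h x))"
    using step bipoly_right[OF step(3)] by (simp add: sph_mean_add sph_mean_cmult polyfun_cmult)
  then show ?case using step by (simp add: polyfun_intros)
qed

definition pmean :: "(('n::finite \<Rightarrow> real) \<Rightarrow> ('n \<Rightarrow> real) \<Rightarrow> real) \<Rightarrow> real" where
  "pmean h = sph_mean (\<lambda>x. sph_mean (h x))"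

lemma pmean_add: "bipoly h \<Longrightarrow> bipoly h' \<Longrightarrow> pmean (\<lambda>x y. h x y + h' x y) = pmean h + pmean h'"
  using bipoly_right[of h] bipoly_right[of h']
  by (simp add: pmean_def sph_mean_add sph_mean_bipoly)

lemma pmean_cmult: "bipoly h \<Longrightarrow> pmean (\<lambda>x y. c * h x y) = c * pmean h"
  using bipoly_right[of h] by (simp add: pmean_def sph_mean_cmult sph_mean_bipoly)

lemma pmean_zero: "pmean (\<lambda>x y. 0) = 0"
  by (simp add: pmean_def sph_mean_const)

lemma pmean_sum: "(\<And>s. s \<in> S \<Longrightarrow> bipoly (h s)) \<Longrightarrow> pmean (\<lambda>x y. \<Sum>s\<in>S. h s x y) = (\<Sum>s\<in>S. pmean (h s))"
  by (induction S rule: infinite_finite_induct) (simp_all add: pmean_zero pmean_add tensor_sum)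

lemma pmean_prod: "f \<in> polyfun \<Longrightarrow> g \<in> polyfun \<Longrightarrow> pmean (\<lambda>x y. f x * g y) = sph_mean f * sph_mean g"
  using sph_mean_cmult[of f "sph_mean g"] by (simp add: pmean_def sph_mean_cmult mult.commute)

lemma pmean_nonneg:
  "bipoly h \<Longrightarrow> (\<And>x y. x \<in> sphere_set \<Longrightarrow> y \<in> sphere_set \<Longrightarrow> h x y \<ge> 0) \<Longrightarrow> pmean h \<ge> 0"
  unfolding pmean_def
  by (intro sph_mean_nonneg sph_mean_bipoly bipoly_right) auto

subsection \<open>Polynomials on the product\<close>

lemma sum_UNIV_Plus: "sum a (UNIV :: ('a::finite + 'b::finite) set) = sum (a \<circ> Inl) UNIV + sum (a \<circ> Inr) UNIV"
  unfolding UNIV_sum by (subst sum.union_disjoint) (auto simp: sum.reindex)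

lemma prod_UNIV_Plus: "prod a (UNIV :: ('a::finite + 'b::finite) set) = prod (a \<circ> Inl) UNIV * prod (a \<circ> Inr) UNIV"
  unfolding UNIV_sum by (subst prod.union_disjoint) (auto simp: prod.reindex)

lemma monom_case_sum:
  "Defs.monom a (case_sum x y) = Defs.monom (a \<circ> Inl) x * Defs.monom (a \<circ> Inr) y"
  unfolding Defs.monom_def prod_UNIV_Plus by (simp add: comp_def)

lemma monom_parts: "Defs.monom a z = Defs.monom (a \<circ> Inl) (xpart z) * Defs.monom (a \<circ> Inr) (ypart z)"
proof -
  have "z = case_sum (xpart z) (ypart z)" by (auto simp: fun_eq_iff xpart_def ypart_def split: sum.split)
  then show ?thesis using monom_case_sum[of a "xpart z" "ypart z"] by simp
qed

lemma polys_comp_part: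
  fixes f :: "('n::finite \<Rightarrow> real) \<Rightarrow> real"
  assumes "f \<in> polys D"
  shows "(\<lambda>z. f (xpart z)) \<in> polys D" "(\<lambda>z. f (ypart z)) \<in> polys D"
proof -
  have f: "f \<in> mspan {a. sum a UNIV \<le> D}" using assms by (simp add: polys_mspan)
  from f show "(\<lambda>z. f (xpart z)) \<in> polys D"
  proof (induction rule: mspan_induct)
    case (monom a)
    have "Defs.monom (case_sum a (\<lambda>_. 0) :: 'n + 'n \<Rightarrow> nat) \<in> polys D"
      using monom by (intro hom_imp_polys[OF hom_monom]) (simp add: sum_UNIV_Plus comp_def)
    moreover have "Defs.monom (case_sum a (\<lambda>_. 0)) = (\<lambda>z. Defs.monom a (xpart z))"
    proof
      fix z show "Defs.monom (case_sum a (\<lambda>_. 0)) z = Defs.monom a (xpart z)"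
        using monom_parts[of "(case_sum a (\<lambda>_. 0))" z] by (simp add: comp_def) (simp add: Defs.monom_def)
    qed
    ultimately show ?case by simp
  qed (auto intro: polys_zero polys_add polys_cmult)
  from f show "(\<lambda>z. f (ypart z)) \<in> polys D"
  proof (induction rule: mspan_induct)
    case (monom a)
    have "Defs.monom (case_sum (\<lambda>_. 0) a :: 'n + 'n \<Rightarrow> nat) \<in> polys D"
      using monom by (intro hom_imp_polys[OF hom_monom]) (simp add: sum_UNIV_Plus comp_def)
    moreover have "Defs.monom (case_sum (\<lambda>_. 0) a) = (\<lambda>z. Defs.monom a (ypart z))"
    proof
      fix z show "Defs.monom (case_sum (\<lambda>_. 0) a) z = Defs.monom a (ypart z)"
        using monom_parts[of "(case_sum (\<lambda>_. 0) a)" z] by (simp add: comp_def) (simp add: Defs.monom_def)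
    qed
    ultimately show ?case by simp
  qed (auto intro: polys_zero polys_add polys_cmult)
qed

lemma polys_slice: "f \<in> polys D \<Longrightarrow> (\<lambda>x. f (case_sum x y)) \<in> polys D"
proof -
  assume "f \<in> polys D"
  then have "f \<in> mspan {a. sum a UNIV \<le> D}" by (simp add: polys_mspan)
  then show ?thesis
  proof (induction rule: mspan_induct)
    case (monom a)
    have "Defs.monom (a \<circ> Inl) \<in> polys D"
      using monom by (intro hom_imp_polys[OF hom_monom]) (simp add: sum_UNIV_Plus)
    from polys_cmult[OF this, of "Defs.monom (a \<circ> Inr) y"] show ?case
      unfolding monom_case_sum by (simp add: mult.commute)
  qed (auto intro: polys_zero polys_add polys_cmult)
qed

text \<open>Recording that components of total degree above D vanish is what later leaves only
  \<open>(D + 2) choose 2\<close> pairs in the error; the degrees of \<open>r1\<close> and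
  \<open>r2\<close> serve the truncated ideal.\<close>

definition biharm_decomp where
  "biharm_decomp D f g r1 r2 \<longleftrightarrow> (\<forall>j k. tensor (harm_polys j) (harm_polys k) (g j k)) \<and>
    (\<forall>j k. j + k > D \<longrightarrow> g j k = (\<lambda>x y. 0)) \<and> r1 \<in> polys (D - 2) \<and> r2 \<in> polys (D - 2) \<and>
    f = (\<lambda>z. (\<Sum>j\<le>D. \<Sum>k\<le>D. g j k (xpart z) (ypart z))
      + r1 z * (1 - sq_norm (xpart z)) + r2 z * (1 - sq_norm (ypart z)))"

lemma biharm_decomp_monom:
  fixes a :: "'n::finite + 'n \<Rightarrow> nat"
  assumes "sum a UNIV \<le> D"
  shows "\<exists>g r1 r2. biharm_decomp D (Defs.monom a) g r1 r2"
proof -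
  define \<alpha> where "\<alpha> = sum (a \<circ> Inl) UNIV"
  define \<beta> where "\<beta> = sum (a \<circ> Inr) UNIV"
  have D: "\<alpha> + \<beta> \<le> D" using assms by (simp add: sum_UNIV_Plus \<alpha>_def \<beta>_def)
  let ?p = "Defs.monom (a \<circ> Inl)" and ?q = "Defs.monom (a \<circ> Inr)"
  have q: "?q \<in> polys \<beta>" using hom_monom[of "a \<circ> Inr"] by (auto intro: hom_imp_polys simp: \<beta>_def)
  from hom_harmonic_decomp[OF hom_monom[of "a \<circ> Inl"]] obtain h r
    where h: "\<And>j. h j \<in> harm_polys j" "\<And>j. j > \<alpha> \<Longrightarrow> h j = (\<lambda>z. 0)"
      and r: "r \<in> polys (\<alpha> - 2)" "\<alpha> < 2 \<Longrightarrow> r = (\<lambda>z. 0)"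
      and p_eq: "?p = (\<lambda>z. (\<Sum>j\<le>\<alpha>. h j z) + (1 - sq_norm z) * r z)"
    unfolding \<alpha>_def[symmetric] by blast
  from hom_harmonic_decomp[OF hom_monom[of "a \<circ> Inr"]] obtain h' r'
    where h': "\<And>j. h' j \<in> harm_polys j" "\<And>j. j > \<beta> \<Longrightarrow> h' j = (\<lambda>z. 0)"
      and r': "r' \<in> polys (\<beta> - 2)" "\<beta> < 2 \<Longrightarrow> r' = (\<lambda>z. 0)"
      and q_eq: "?q = (\<lambda>z. (\<Sum>j\<le>\<beta>. h' j z) + (1 - sq_norm z) * r' z)"
    unfolding \<beta>_def[symmetric] by blast
  have s: "(\<Sum>j\<le>\<alpha>. h j z) = (\<Sum>j\<le>D. h j z)" for z
    by (rule sum.mono_neutral_left) (use D h(2) in auto)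
  have s': "(\<Sum>j\<le>\<beta>. h' j z) = (\<Sum>j\<le>D. h' j z)" for z
    by (rule sum.mono_neutral_left) (use D h'(2) in auto)
  define g where "g = (\<lambda>j k x y. h j x * h' k y)"
  \<comment> \<open>With p = H + (1 - |x|^2) r and q = H' + (1 - |y|^2) r', the product is H H' + (1
    - |x|^2) r q + (1 - |y|^2) H r'.\<close>
  define r1 where "r1 = (\<lambda>z::'n + 'n \<Rightarrow> real. r (xpart z) * ?q (ypart z))"
  define r2 where "r2 = (\<lambda>z::'n + 'n \<Rightarrow> real. (\<Sum>j\<le>\<alpha>. h j (xpart z)) * r' (ypart z))"
  have "r1 \<in> polys (D - 2)"
  \<comment> \<open>For such degrees \<open>\<alpha> - 2\<close> is truncated and the degree count
    would fail, but then \<open>r\<close> is 0.\<close>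
  proof (cases "\<alpha> < 2")
    case True then show ?thesis by (simp add: r1_def r(2) polys_zero)
  next
    case False
    have "r1 \<in> polys ((\<alpha> - 2) + \<beta>)" unfolding r1_def by (intro polys_mult polys_comp_part r q)
    then show ?thesis using False D by (auto elim: polys_mono)
  qed
  moreover have "r2 \<in> polys (D - 2)"
  proof (cases "\<beta> < 2")
    case True then show ?thesis by (simp add: r2_def r'(2) polys_zero)
  next
    case False
    have "(\<lambda>z. \<Sum>j\<le>\<alpha>. h j z) \<in> polys \<alpha>"
      by (intro polys_sum hom_imp_polys[OF harm_imp_hom[OF h(1)]]) auto
    from polys_comp_part(1)[OF this] have "r2 \<in> polys (\<alpha> + (\<beta> - 2))"
      unfolding r2_def by (rule polys_mult[OF _ polys_comp_part(2)[OF r'(1)]])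
    then show ?thesis using False D by (auto elim: polys_mono)
  qed
  moreover have "tensor (harm_polys j) (harm_polys k) (g j k)" for j k
    unfolding g_def by (intro tensor_prod h h')
  moreover have "g j k = (\<lambda>x y. 0)" if "j + k > D" for j k
  proof -
    have "j > \<alpha> \<or> k > \<beta>" using that D by linarith
    then show ?thesis using h(2) h'(2) by (auto simp: g_def)
  qed
  moreover have "Defs.monom a z = (\<Sum>j\<le>D. \<Sum>k\<le>D. g j k (xpart z) (ypart z))
      + r1 z * (1 - sq_norm (xpart z)) + r2 z * (1 - sq_norm (ypart z))" for z
  proof -
    have "(\<Sum>j\<le>D. \<Sum>k\<le>D. g j k (xpart z) (ypart z)) = (\<Sum>j\<le>\<alpha>. h j (xpart z)) * (\<Sum>j\<le>\<beta>. h' j (ypart z))"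
      unfolding s s' by (simp add: g_def sum_product)
    moreover have "?p (xpart z) = (\<Sum>j\<le>\<alpha>. h j (xpart z)) + (1 - sq_norm (xpart z)) * r (xpart z)"
      using p_eq by metis
    moreover have "?q (ypart z) = (\<Sum>j\<le>\<beta>. h' j (ypart z)) + (1 - sq_norm (ypart z)) * r' (ypart z)"
      using q_eq by metis
    ultimately show ?thesis
      unfolding monom_parts[of a z] r1_def r2_def by algebra
  qed
  ultimately show ?thesis unfolding biharm_decomp_def by blast
qed

lemma biharm_decomp_exists:
  fixes f :: "('n::finite + 'n \<Rightarrow> real) \<Rightarrow> real"
  assumes "f \<in> polys D"
  shows "\<exists>g r1 r2. biharm_decomp D f g r1 r2"
proof -
  have "f \<in> mspan {a. sum a UNIV \<le> D}" using assms by (simp add: polys_mspan)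
  then show ?thesis
  proof (induction rule: mspan_induct)
    case zero
    show ?case unfolding biharm_decomp_def
      by (rule exI[of _ "\<lambda>j k x y. 0"], rule exI[of _ "\<lambda>z. 0"], rule exI[of _ "\<lambda>z. 0"])
         (simp add: polys_zero tensor.zero)
  next
    case (monom a) then show ?case by (intro biharm_decomp_monom) simp
  next
    case (cmult c f)
    then obtain g r1 r2 where g: "\<And>j k. tensor (harm_polys j) (harm_polys k) (g j k)"
        "\<And>j k. j + k > D \<Longrightarrow> g j k = (\<lambda>x y. 0)" and r: "r1 \<in> polys (D - 2)" "r2 \<in> polys (D - 2)"
      and eq: "f = (\<lambda>z. (\<Sum>j\<le>D. \<Sum>k\<le>D. g j k (xpart z) (ypart z))
      + r1 z * (1 - sq_norm (xpart z)) + r2 z * (1 - sq_norm (ypart z)))"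
      unfolding biharm_decomp_def by blast
    have "biharm_decomp D (\<lambda>z. c * f z) (\<lambda>j k x y. c * g j k x y) (\<lambda>z. c * r1 z) (\<lambda>z. c * r2 z)"
      unfolding biharm_decomp_def eq using g r
      by (auto intro: polys_cmult tensor_cmult harm_cmult simp: sum_distrib_left distrib_left mult.assoc)
    then show ?case by blast
  next
    case (add f f')
    then obtain g r1 r2 g' r1' r2' where g: "\<And>j k. tensor (harm_polys j) (harm_polys k) (g j k)"
        "\<And>j k. j + k > D \<Longrightarrow> g j k = (\<lambda>x y. 0)" and r: "r1 \<in> polys (D - 2)" "r2 \<in> polys (D - 2)"
      and eq: "f = (\<lambda>z. (\<Sum>j\<le>D. \<Sum>k\<le>D. g j k (xpart z) (ypart z))
      + r1 z * (1 - sq_norm (xpart z)) + r2 z * (1 - sq_norm (ypart z)))"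
      and g': "\<And>j k. tensor (harm_polys j) (harm_polys k) (g' j k)"
        "\<And>j k. j + k > D \<Longrightarrow> g' j k = (\<lambda>x y. 0)" and r': "r1' \<in> polys (D - 2)" "r2' \<in> polys (D - 2)"
      and eq': "f' = (\<lambda>z. (\<Sum>j\<le>D. \<Sum>k\<le>D. g' j k (xpart z) (ypart z))
      + r1' z * (1 - sq_norm (xpart z)) + r2' z * (1 - sq_norm (ypart z)))"
      unfolding biharm_decomp_def by blast
    have "biharm_decomp D (\<lambda>z. f z + f' z) (\<lambda>j k x y. g j k x y + g' j k x y) (\<lambda>z. r1 z + r1' z) (\<lambda>z. r2 z + r2' z)"
      unfolding biharm_decomp_def eq eq' using g r g' r'
      by (auto intro: polys_add tensor_add simp: sum.distrib distrib_right)
    then show ?case by blast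
  qed simp
qed

lemma XX_case_sum: "case_sum x y \<in> XX \<longleftrightarrow> x \<in> sphere_set \<and> y \<in> sphere_set"
  by (simp add: XX_def sphere_set_def xpart_def ypart_def)

lemma parts_case_sum [simp]: "xpart (case_sum x y) = x" "ypart (case_sum x y) = y"
  by (auto simp: xpart_def ypart_def)

lemma case_sum_parts: "case_sum (xpart z) (ypart z) = z"
  by (auto simp: fun_eq_iff xpart_def ypart_def split: sum.split)

text \<open>The one-sphere bound is applied twice: in x for fixed y, to the sums of components of
  equal degree in x, and then in y for fixed x, to such a sum. Each pass costs one factor
  gamma.\<close>

lemma biharm_component_bound:
  fixes f :: "('n::finite + 'n \<Rightarrow> real) \<Rightarrow> real"
  assumes dec: "biharm_decomp D f g r1 r2" and f: "f \<in> polys D"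
    and M: "\<And>z. z \<in> XX \<Longrightarrow> \<bar>f z\<bar> \<le> M" and jk: "j \<le> D" "k \<le> D"
    and xy: "x \<in> sphere_set" "y \<in> sphere_set"
  shows "\<bar>g j k x y\<bar> \<le> (gamma_sph TYPE('n) D)\<^sup>2 * M"
proof -
  from dec have g: "\<And>j k. tensor (harm_polys j) (harm_polys k) (g j k)"
    and eq: "f = (\<lambda>z. (\<Sum>j\<le>D. \<Sum>k\<le>D. g j k (xpart z) (ypart z))
      + r1 z * (1 - sq_norm (xpart z)) + r2 z * (1 - sq_norm (ypart z)))"
    unfolding biharm_decomp_def by auto
  have harm_sum: "(\<lambda>x. \<Sum>k\<in>S. g j k x y) \<in> harm_polys j" if "finite S" for S j y
    using that by induction (auto intro: harm_zero harm_add tensor_harm_left[OF g])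
  have row: "\<bar>\<Sum>k\<le>D. g j k x y\<bar> \<le> gamma_sph TYPE('n) D * M" if y: "y \<in> sphere_set" for y
  proof (rule harmonic_component_gamma_bound[OF polys_slice[OF f, of y], where h = "\<lambda>j x. \<Sum>k\<le>D. g j k x y"])
    fix z :: "'n \<Rightarrow> real" assume z: "z \<in> sphere_set"
    show "f (case_sum z y) = (\<Sum>j\<le>D. \<Sum>k\<le>D. g j k z y)"
      using z y unfolding eq by (simp add: sphere_set_def)
    show "\<bar>f (case_sum z y)\<bar> \<le> M" using z y by (intro M) (simp add: XX_case_sum)
  qed (use jk xy harm_sum in auto)
  have "\<bar>g j k x y\<bar> \<le> gamma_sph TYPE('n) D * (gamma_sph TYPE('n) D * M)"
  proof (rule harmonic_component_gamma_bound[where h = "\<lambda>k. g j k x" and p = "\<lambda>y. \<Sum>k\<le>D. g j k x y"])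
    show "(\<lambda>y. \<Sum>k\<le>D. g j k x y) \<in> polys D"
      by (intro polys_sum hom_imp_polys[OF harm_imp_hom[OF tensor_harm_right[OF g]]]) auto
  qed (use jk xy row tensor_harm_right[OF g] in auto)
  then show ?thesis by (simp add: power2_eq_square mult.assoc)
qed

section \<open>Polynomials vanishing on the product of spheres\<close>

lemma sphere_scaling: "\<exists>c. \<exists>e\<in>sphere_set. z = (\<lambda>i::'v::finite. c * e i)"
proof (cases "sq_norm z = 0")
  case True
  then have "\<forall>i. z i = 0" by (simp add: sq_norm_def sum_nonneg_eq_0_iff)
  then show ?thesis using sphere_nonempty by (intro exI[of _ 0]) auto
next
  case False
  then have pos: "sq_norm z > 0" using sq_norm_nonneg[of z] by simp
  define c where "c = sqrt (sq_norm z)"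
  have c: "c > 0" "c\<^sup>2 = sq_norm z" using pos by (auto simp: c_def)
  have "sq_norm (\<lambda>i. z i / c) = sq_norm z / c\<^sup>2"
    by (simp add: sq_norm_def power_divide sum_divide_distrib)
  then have "(\<lambda>i. z i / c) \<in> sphere_set" using c pos by (simp add: sphere_set_def)
  moreover have "z = (\<lambda>i. c * (z i / c))" using c by simp
  ultimately show ?thesis by (intro exI[of _ c] bexI[of _ "\<lambda>i. z i / c"])
qed

lemma hom_vanish: "h \<in> hom_polys k \<Longrightarrow> (\<And>z. z \<in> sphere_set \<Longrightarrow> h z = 0) \<Longrightarrow> h z = 0"
  using sphere_scaling[of z] hom_scale[of h k] by auto

text \<open>The component bound with M = 0 kills every component on the spheres, homogeneity in each
  variable kills it everywhere, and only the ideal terms of the decomposition remain.\<close>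

lemma vanishing_in_ideal:
  fixes f :: "('n::finite + 'n \<Rightarrow> real) \<Rightarrow> real"
  assumes f: "f \<in> polys D" and van: "\<And>z. z \<in> XX \<Longrightarrow> f z = 0"
  shows "\<exists>r1\<in>polys (D - 2). \<exists>r2\<in>polys (D - 2).
    f = (\<lambda>z. r1 z * (1 - sq_norm (xpart z)) + r2 z * (1 - sq_norm (ypart z)))"
proof -
  obtain g r1 r2 where dec: "biharm_decomp D f g r1 r2" using biharm_decomp_exists[OF f] by blast
  then have g: "\<And>j k. tensor (harm_polys j) (harm_polys k) (g j k)"
    and r: "r1 \<in> polys (D - 2)" "r2 \<in> polys (D - 2)"
    and eq: "f = (\<lambda>z. (\<Sum>j\<le>D. \<Sum>k\<le>D. g j k (xpart z) (ypart z))
      + r1 z * (1 - sq_norm (xpart z)) + r2 z * (1 - sq_norm (ypart z)))"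
    unfolding biharm_decomp_def by auto
  have 0: "g j k x y = 0" if "j \<le> D" "k \<le> D" "x \<in> sphere_set" "y \<in> sphere_set" for j k x y
    using biharm_component_bound[OF dec f _ that, of 0] van by simp
  have "g j k x y = 0" if "j \<le> D" "k \<le> D" "x \<in> sphere_set" for j k x y
    by (rule hom_vanish[OF harm_imp_hom[OF tensor_harm_right[OF g]]]) (rule 0[OF that])
  then have "g j k x y = 0" if "j \<le> D" "k \<le> D" for j k x y
    using hom_vanish[OF harm_imp_hom[OF tensor_harm_left[OF g]]] that by blast
  then have "f = (\<lambda>z. r1 z * (1 - sq_norm (xpart z)) + r2 z * (1 - sq_norm (ypart z)))"
    unfolding eq by simp
  then show ?thesis using r by blast
qed

subsection \<open>Positive functionals give sums of squares\<close>

text \<open>A Cholesky step: row \<open>c\<close> yields one vector \<open>l\<close>, and the Schur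
  complement \<open>M'\<close> is positive semidefinite on the smaller set.\<close>

lemma psd_sum_of_squares:
  fixes M :: "'b \<Rightarrow> 'b \<Rightarrow> real"
  assumes "finite B" "\<And>a b. a \<in> B \<Longrightarrow> b \<in> B \<Longrightarrow> M a b = M b a"
    and "\<And>v. (\<Sum>a\<in>B. \<Sum>b\<in>B. v a * v b * M a b) \<ge> 0"
  shows "\<exists>ls. \<forall>a\<in>B. \<forall>b\<in>B. M a b = (\<Sum>l\<leftarrow>ls. l a * l b)"
  using assms
proof (induction B arbitrary: M rule: finite_induct)
  case empty show ?case by simp
next
  case (insert c B)
  note sym = insert.prems(1) and psd = insert.prems(2)
  have split: "(\<Sum>a\<in>insert c B. \<Sum>b\<in>insert c B. v a * v b * M a b)
     = (v c)\<^sup>2 * M c c + 2 * v c * (\<Sum>a\<in>B. v a * M c a) + (\<Sum>a\<in>B. \<Sum>b\<in>B. v a * v b * M a b)" for v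
  proof -
    have "(\<Sum>a\<in>B. v a * v c * M a c) = v c * (\<Sum>a\<in>B. v a * M c a)"
      unfolding sum_distrib_left by (rule sum.cong) (use sym in \<open>auto simp: mult_ac\<close>)
    moreover have "(\<Sum>a\<in>B. v c * v a * M c a) = v c * (\<Sum>a\<in>B. v a * M c a)"
      unfolding sum_distrib_left by (rule sum.cong) (auto simp: mult_ac)
    ultimately show ?thesis using insert.hyps
      by (simp add: sum.distrib power2_eq_square)
  qed
  have cc: "M c c \<ge> 0"
  proof -
    have "(\<Sum>a\<in>B. (if a = c then 1 else 0) * M c a) = 0"
      "(\<Sum>a\<in>B. \<Sum>b\<in>B. (if a = c then 1 else 0) * (if b = c then 1 else 0) * M a b) = 0"
      using insert.hyps by (auto intro!: sum.neutral)
    then show ?thesis using psd[of "\<lambda>a. if a = c then 1 else 0"] unfolding split by simp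
  qed
  \<comment> \<open>If \<open>M c c = 0\<close>, division by 0 makes \<open>l\<close> zero; this is
    right, since the whole row then vanishes.\<close>
  define l where "l = (\<lambda>a. M c a / sqrt (M c c))"
  have Mc: "M c a = l c * l a" if "a \<in> insert c B" for a
  proof (cases "M c c = 0")
    case True
    have "M c a = 0"
    proof (cases "a = c")
      case False
      with that have a: "a \<in> B" by simp
      \<comment> \<open>With \<open>M c c = 0\<close> the form is affine in the entry
        \<open>s\<close> at \<open>c\<close>; being bounded below, it must have slope 0.\<close>
      have quad: "2 * s * M c a + M a a \<ge> 0" for s
      proof -
        define v where "v = (\<lambda>b. if b = c then s else if b = a then 1 else 0)"
        have *: "(\<Sum>b\<in>B. v b * f b) = f a" for f
        proof -
          have "(\<Sum>b\<in>B. v b * f b) = (\<Sum>b\<in>B. if b = a then f b else 0)"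
            using insert.hyps by (intro sum.cong) (auto simp: v_def)
          then show ?thesis using a insert.hyps by simp
        qed
        have 1: "(\<Sum>b\<in>B. v b * M c b) = M c a" by (rule *)
        have 2: "(\<Sum>i\<in>B. \<Sum>j\<in>B. v i * v j * M i j) = M a a"
          by (simp only: mult.assoc sum_distrib_left[symmetric] *)
        show ?thesis using psd[of v] unfolding split 1 2 by (simp add: True v_def)
      qed
      show ?thesis
      proof (rule ccontr)
        assume "M c a \<noteq> 0"
        then have "2 * (- (M a a + 1) / (2 * M c a)) * M c a + M a a = - 1" by (simp add: field_simps)
        with quad[of "- (M a a + 1) / (2 * M c a)"] show False by linarith
      qed
    qed (use True in simp)
    then show ?thesis by (simp add: l_def True)
  next
    case False
    then have "M c c > 0" using cc by simp
    then show ?thesis by (simp add: l_def real_div_sqrt)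
  qed
  define M' where "M' = (\<lambda>a b. M a b - l a * l b)"
  have "\<exists>ls. \<forall>a\<in>B. \<forall>b\<in>B. M' a b = (\<Sum>l\<leftarrow>ls. l a * l b)"
  proof (rule insert.IH)
    show "M' a b = M' b a" if "a \<in> B" "b \<in> B" for a b using sym[of a b] that by (simp add: M'_def mult.commute)
    fix v :: "'b \<Rightarrow> real"
    define S where "S = (\<Sum>a\<in>B. v a * l a)"
    have LS: "(\<Sum>a\<in>B. \<Sum>b\<in>B. v a * v b * (l a * l b)) = S\<^sup>2"
      unfolding S_def power2_eq_square sum_product by (intro sum.cong) (auto simp: mult_ac)
    have "(\<Sum>a\<in>B. \<Sum>b\<in>B. v a * v b * M a b) \<ge> S\<^sup>2"
    proof (cases "l c = 0")
      case True
      have "l a = 0" if "a \<in> B" for a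
      proof -
        have "M c a = 0" using Mc[of a] that True by simp
        then show ?thesis by (simp add: l_def)
      qed
      then have "S = 0" unfolding S_def by simp
      moreover have "(\<Sum>a\<in>B. (v(c := 0)) a * M c a) = (\<Sum>a\<in>B. v a * M c a)"
        "(\<Sum>a\<in>B. \<Sum>b\<in>B. (v(c := 0)) a * (v(c := 0)) b * M a b) = (\<Sum>a\<in>B. \<Sum>b\<in>B. v a * v b * M a b)"
        using insert.hyps by (auto intro!: sum.cong)
      ultimately show ?thesis using psd[of "v(c := 0)"] unfolding split by simp
    next
      case False
      \<comment> \<open>The entry at \<open>c\<close> that minimises the form; completing the square
        leaves the form on \<open>B\<close> minus \<open>S\<^sup>2\<close>.\<close>
      define w where "w = v(c := - S / l c)"
      have w: "(\<Sum>a\<in>B. w a * M c a) = l c * S"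
        "(\<Sum>a\<in>B. \<Sum>b\<in>B. w a * w b * M a b) = (\<Sum>a\<in>B. \<Sum>b\<in>B. v a * v b * M a b)"
      proof -
        show "(\<Sum>a\<in>B. w a * M c a) = l c * S"
          unfolding S_def sum_distrib_left using insert.hyps
          by (intro sum.cong) (auto simp: w_def Mc)
        show "(\<Sum>a\<in>B. \<Sum>b\<in>B. w a * w b * M a b) = (\<Sum>a\<in>B. \<Sum>b\<in>B. v a * v b * M a b)"
          using insert.hyps by (intro sum.cong) (auto simp: w_def)
      qed
      have "(w c)\<^sup>2 * M c c + 2 * w c * (l c * S) = - S\<^sup>2"
        unfolding Mc[OF insertI1] using False by (simp add: w_def power2_eq_square)
      then show ?thesis using psd[of w] unfolding split w by simp
    qed
    then show "0 \<le> (\<Sum>a\<in>B. \<Sum>b\<in>B. v a * v b * M' a b)"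
      using LS by (simp add: M'_def right_diff_distrib sum_subtractf)
  qed
  then obtain ls where ls: "\<And>a b. a \<in> B \<Longrightarrow> b \<in> B \<Longrightarrow> M' a b = (\<Sum>l\<leftarrow>ls. l a * l b)" by blast
  \<comment> \<open>Clearing the entries at \<open>c\<close> keeps the earlier vectors from
    disturbing row \<open>c\<close>, which \<open>l\<close> already reproduces.\<close>
  define ls' where "ls' = map (\<lambda>l. l(c := 0)) ls"
  have "M a b = (\<Sum>l\<leftarrow>l # ls'. l a * l b)" if "a \<in> insert c B" "b \<in> insert c B" for a b
  proof (cases "a = c \<or> b = c")
    case True
    then have "(\<Sum>l\<leftarrow>ls'. l a * l b) = 0" unfolding ls'_def by (induction ls) auto
    moreover have "M a b = l a * l b"
      using True Mc[of a] Mc[of b] sym[of a b] that by (auto simp: mult.commute)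
    ultimately show ?thesis by simp
  next
    case False
    then have "(\<Sum>l\<leftarrow>ls'. l a * l b) = (\<Sum>l\<leftarrow>ls. l a * l b)" unfolding ls'_def by (induction ls) auto
    then show ?thesis using ls[of a b] that False by (simp add: M'_def)
  qed
  then show ?case by blast
qed

lemma tensor_polys_expand:
  assumes "tensor E (polys D) K" and "(\<lambda>z. 0) \<in> E"
    and add: "\<And>e e'. e \<in> E \<Longrightarrow> e' \<in> E \<Longrightarrow> (\<lambda>z. e z + e' z) \<in> E"
    and cm: "\<And>c e. e \<in> E \<Longrightarrow> (\<lambda>z. c * e z) \<in> E"
  shows "\<exists>c. (\<forall>a. c a \<in> E) \<and> K = (\<lambda>z w. \<Sum>a\<in>{a. sum a UNIV \<le> D}. c a z * Defs.monom a w)"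
  using assms(1)
proof (induction rule: tensor.induct)
  case zero
  show ?case by (rule exI[of _ "\<lambda>a z. 0"]) (simp add: assms(2))
next
  case (step e m h)
  from step(4) obtain c where c: "\<And>a. c a \<in> E"
    and h: "h = (\<lambda>z w. \<Sum>a\<in>{a. sum a UNIV \<le> D}. c a z * Defs.monom a w)" by blast
  from step(2) obtain C where m: "\<And>w. m w = (\<Sum>a\<in>{a. sum a UNIV \<le> D}. C a * Defs.monom a w)"
    by (auto simp: polys_def)
  have "(\<lambda>z. C a * e z + c a z) \<in> E" for a by (intro add cm step(1) c)
  moreover have "(\<lambda>z w. e z * m w + h z w)
     = (\<lambda>z w. \<Sum>a\<in>{a. sum a UNIV \<le> D}. (C a * e z + c a z) * Defs.monom a w)"
    unfolding m h by (simp add: sum_distrib_left sum.distrib algebra_simps)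
  ultimately show ?case by (intro exI[of _ "\<lambda>a z. C a * e z + c a z"]) simp
qed

text \<open>Expanding \<open>K\<close> in the monomials of \<open>w\<close> turns \<open>L\<close>
  of its square into a quadratic form in monomials with matrix
  \<open>L (\<lambda>z. c a z * c b z)\<close>; each vector of a Gram factorisation gives the square
  of one polynomial of degree at most D.\<close>

lemma positive_functional_sos:
  fixes K :: "'z \<Rightarrow> ('v::finite \<Rightarrow> real) \<Rightarrow> real" and L :: "('z \<Rightarrow> real) \<Rightarrow> real"
  assumes K: "tensor E (polys D) K" and zero: "(\<lambda>z. 0) \<in> E"
    and add: "\<And>e e'. e \<in> E \<Longrightarrow> e' \<in> E \<Longrightarrow> (\<lambda>z. e z + e' z) \<in> E"
    and cm: "\<And>c e. e \<in> E \<Longrightarrow> (\<lambda>z. c * e z) \<in> E"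
    and mu: "\<And>e e'. e \<in> E \<Longrightarrow> e' \<in> E \<Longrightarrow> (\<lambda>z. e z * e' z) \<in> E"
    and Ladd: "\<And>e e'. e \<in> E \<Longrightarrow> e' \<in> E \<Longrightarrow> L (\<lambda>z. e z + e' z) = L e + L e'"
    and Lcm: "\<And>c e. e \<in> E \<Longrightarrow> L (\<lambda>z. c * e z) = c * L e"
    and pos: "\<And>e. e \<in> E \<Longrightarrow> L (\<lambda>z. (e z)\<^sup>2) \<ge> 0"
  shows "is_sos (\<lambda>w. L (\<lambda>z. (K z w)\<^sup>2))" "(\<lambda>w. L (\<lambda>z. (K z w)\<^sup>2)) \<in> polys (2 * D)"
proof -
  let ?I = "{a::'v \<Rightarrow> nat. sum a UNIV \<le> D}"
  obtain c where c: "\<And>a. c a \<in> E" and K_eq: "K = (\<lambda>z w. \<Sum>a\<in>?I. c a z * Defs.monom a w)"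
    using tensor_polys_expand[OF K zero add cm] by blast
  have Esum: "(\<lambda>z. \<Sum>s\<in>S. e s z) \<in> E" if "\<And>s. s \<in> S \<Longrightarrow> e s \<in> E" for S and e :: "('v \<Rightarrow> nat) \<Rightarrow> 'z \<Rightarrow> real"
    using that by (induction S rule: infinite_finite_induct) (auto intro: zero add)
  have L0: "L (\<lambda>z. 0) = 0" using Lcm[OF zero, of 0] by simp
  have Lsum: "L (\<lambda>z. \<Sum>s\<in>S. e s z) = (\<Sum>s\<in>S. L (e s))" if "\<And>s. s \<in> S \<Longrightarrow> e s \<in> E"
    for S and e :: "('v \<Rightarrow> nat) \<Rightarrow> 'z \<Rightarrow> real"
    using that by (induction S rule: infinite_finite_induct) (simp_all add: L0 Ladd Esum)
  define M where "M = (\<lambda>a b. L (\<lambda>z. c a z * c b z))"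
  have quad: "L (\<lambda>z. (\<Sum>a\<in>?I. v a * c a z)\<^sup>2) = (\<Sum>a\<in>?I. \<Sum>b\<in>?I. v a * v b * M a b)" for v
  proof -
    have "(\<lambda>z. (\<Sum>a\<in>?I. v a * c a z)\<^sup>2) = (\<lambda>z. \<Sum>a\<in>?I. \<Sum>b\<in>?I. (v a * v b) * (c a z * c b z))"
      unfolding power2_eq_square sum_product by (simp add: mult_ac)
    then show ?thesis by (simp add: Lsum Esum cm mu c Lcm M_def)
  qed
  have "\<exists>ls. \<forall>a\<in>?I. \<forall>b\<in>?I. M a b = (\<Sum>l\<leftarrow>ls. l a * l b)"
  proof (rule psd_sum_of_squares)
    show "M a b = M b a" for a b by (simp add: M_def mult.commute)
    show "0 \<le> (\<Sum>a\<in>?I. \<Sum>b\<in>?I. v a * v b * M a b)" for v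
      unfolding quad[symmetric] by (intro pos Esum cm c)
  qed simp
  then obtain ls where ls: "\<And>a b. a \<in> ?I \<Longrightarrow> b \<in> ?I \<Longrightarrow> M a b = (\<Sum>l\<leftarrow>ls. l a * l b)" by blast
  have G: "L (\<lambda>z. (K z w)\<^sup>2) = (\<Sum>a\<in>?I. \<Sum>b\<in>?I. Defs.monom a w * Defs.monom b w * M a b)" for w
    using quad[of "\<lambda>a. Defs.monom a w"] unfolding K_eq by (simp add: mult.commute)
  define fs where "fs = map (\<lambda>l w. \<Sum>a\<in>?I. l a * Defs.monom a w) ls"
  have sq: "(\<Sum>a\<in>?I. \<Sum>b\<in>?I. Defs.monom a w * Defs.monom b w * (\<Sum>l\<leftarrow>ls. l a * l b))
    = (\<Sum>l\<leftarrow>ls. (\<Sum>a\<in>?I. l a * Defs.monom a w)\<^sup>2)" for w ls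
  proof (induction ls)
    case (Cons l ls)
    have "(\<Sum>a\<in>?I. l a * Defs.monom a w)\<^sup>2 = (\<Sum>a\<in>?I. \<Sum>b\<in>?I. Defs.monom a w * Defs.monom b w * (l a * l b))"
      unfolding power2_eq_square sum_product by (simp add: mult_ac)
    with Cons show ?case by (simp add: distrib_left sum.distrib)
  qed simp
  have "L (\<lambda>z. (K z w)\<^sup>2) = (\<Sum>f\<leftarrow>fs. (f w)\<^sup>2)" for w
  proof -
    have "L (\<lambda>z. (K z w)\<^sup>2) = (\<Sum>a\<in>?I. \<Sum>b\<in>?I. Defs.monom a w * Defs.monom b w * (\<Sum>l\<leftarrow>ls. l a * l b))"
      unfolding G by (intro sum.cong refl) (simp add: ls)
    then show ?thesis unfolding sq fs_def by (simp add: comp_def)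
  qed
  moreover have "f \<in> polys D" if "f \<in> set fs" for f
    using that by (auto simp: fs_def intro!: polys_sum polys_cmult hom_imp_polys[OF hom_monom])
  ultimately show "is_sos (\<lambda>w. L (\<lambda>z. (K z w)\<^sup>2))" unfolding is_sos_def by blast
  have "(\<lambda>w. Defs.monom a w * Defs.monom b w * M a b) \<in> polys (2 * D)" if "a \<in> ?I" "b \<in> ?I" for a b
    using polys_mult[OF polys_mult[OF hom_imp_polys[OF hom_monom, of a D] hom_imp_polys[OF hom_monom, of b D]]
        polys_const[of "M a b" 0]] that
    unfolding mult_2 by simp
  then show "(\<lambda>w. L (\<lambda>z. (K z w)\<^sup>2)) \<in> polys (2 * D)"
    unfolding G by (intro polys_sum)
qed

subsection \<open>The product kernel and the main estimate\<close>

lemma tensor_ip_kernel: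
  fixes u :: "real poly"
  assumes P: "\<And>i. (\<lambda>z. X z i) \<in> E" and Q: "\<And>i. (\<lambda>w. W w i) \<in> polys 1"
    and const: "\<And>c. (\<lambda>z. c) \<in> E" and mu: "\<And>e e'. e \<in> E \<Longrightarrow> e' \<in> E \<Longrightarrow> (\<lambda>z. e z * e' z) \<in> E"
    and deg: "degree u \<le> t"
  shows "tensor E (polys t) (\<lambda>z w. poly u (ip (X z) (W w)))"
proof -
  have ip1: "tensor E (polys 1) (\<lambda>z w. ip (X z) (W w))"
    unfolding ip_def by (intro tensor_sum tensor_prod P Q)
  have pow: "tensor E (polys m) (\<lambda>z w. ip (X z) (W w) ^ m)" for m
  proof (induction m)
    case 0
    show ?case using tensor_prod[OF const[of 1] polys_const[of 1 0]] by simp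
  next
    case (Suc m)
    have "tensor E (polys (Suc m)) (\<lambda>z w. ip (X z) (W w) * ip (X z) (W w) ^ m)"
      by (rule tensor_mult[OF ip1 Suc]) (auto intro: mu dest: polys_mult)
    then show ?case by simp
  qed
  have "tensor E (polys t) (\<lambda>z w. coeff u m * ip (X z) (W w) ^ m)" if "m \<le> degree u" for m
  proof (rule tensor_cmult)
    show "tensor E (polys t) (\<lambda>z w. ip (X z) (W w) ^ m)"
      using that deg by (intro tensor_mono[OF pow]) (auto elim: polys_mono)
    show "(\<lambda>z. coeff u m * f z) \<in> E" if "f \<in> E" for f by (rule mu[OF const that])
  qed
  then show ?thesis unfolding poly_altdef by (intro tensor_sum) auto
qed

lemma product_kernel_sos:
  fixes F :: "('n::finite \<Rightarrow> real) \<Rightarrow> ('n \<Rightarrow> real) \<Rightarrow> real" and u :: "real poly"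
  assumes F: "bipoly F" and nn: "\<And>x y. x \<in> sphere_set \<Longrightarrow> y \<in> sphere_set \<Longrightarrow> F x y \<ge> 0"
    and deg: "degree u \<le> t"
  defines "G \<equiv> \<lambda>w. pmean (\<lambda>x y. F x y * (poly u (ip x (xpart w)) * poly u (ip y (ypart w)))\<^sup>2)"
  shows "is_sos G" "G \<in> polys (4 * t)"
proof -
  \<comment> \<open>Packs both points into one argument to fit
    \<open>positive_functional_sos\<close>; the functional is the mean over both spheres weighted by
    the nonnegative \<open>F\<close>.\<close>
  define E :: "(('n \<Rightarrow> real) \<times> ('n \<Rightarrow> real) \<Rightarrow> real) set" where "E = {e. bipoly (\<lambda>x y. e (x, y))}"
  define K where "K = (\<lambda>z (w :: 'n + 'n \<Rightarrow> real). poly u (ip (fst z) (xpart w)) * poly u (ip (snd z) (ypart w)))"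
  define L where "L = (\<lambda>e. pmean (\<lambda>x y. F x y * e (x, y)))"
  have const: "(\<lambda>z. c) \<in> E" for c
    unfolding E_def using tensor_prod[OF polyfun_const[of c] polyfun_const[of 1]] by simp
  have add: "(\<lambda>z. e z + e' z) \<in> E" and mu: "(\<lambda>z. e z * e' z) \<in> E" if "e \<in> E" "e' \<in> E" for e e'
    using that by (auto simp: E_def intro: tensor_add bipoly_mult)
  have fstE: "(\<lambda>z. fst z i) \<in> E" for i
    unfolding E_def using tensor_prod[OF polyfun_coord[of i] polyfun_const[of 1]] by simp
  have sndE: "(\<lambda>z. snd z i) \<in> E" for i
    unfolding E_def using tensor_prod[OF polyfun_const[of 1] polyfun_coord[of i]] by simp
  have xp: "(\<lambda>w. xpart w i) \<in> polys 1" and yp: "(\<lambda>w. ypart w i) \<in> polys 1" for i :: 'n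
    using hom_coord by (auto simp: xpart_def ypart_def intro!: hom_imp_polys)
  \<comment> \<open>Degree t in each block of variables of \<open>w\<close>, hence 2 t for the
    product and 4 t for its square.\<close>
  have K: "tensor E (polys (t + t)) K"
    unfolding K_def
    by (rule tensor_mult[OF tensor_ip_kernel[OF fstE xp const mu deg] tensor_ip_kernel[OF sndE yp const mu deg]])
       (auto intro: mu polys_mult)
  have FE: "bipoly (\<lambda>x y. F x y * e (x, y))" if "e \<in> E" for e
    using that by (auto simp: E_def intro: bipoly_mult F)
  have Ladd: "L (\<lambda>z. e z + e' z) = L e + L e'" if "e \<in> E" "e' \<in> E" for e e'
    unfolding L_def by (simp add: distrib_left pmean_add FE that)
  have Lcm: "L (\<lambda>z. c * e z) = c * L e" if "e \<in> E" for c e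
    unfolding L_def using pmean_cmult[OF FE[OF that], of c] by (simp add: mult.left_commute)
  have pos: "L (\<lambda>z. (e z)\<^sup>2) \<ge> 0" if "e \<in> E" for e
    unfolding L_def using FE[OF mu[OF that that]] nn by (intro pmean_nonneg) (auto simp: power2_eq_square)
  have cm: "(\<lambda>z. c * e z) \<in> E" if "e \<in> E" for c e by (rule mu[OF const that])
  have sos: "is_sos (\<lambda>w. L (\<lambda>z. (K z w)\<^sup>2))" "(\<lambda>w. L (\<lambda>z. (K z w)\<^sup>2)) \<in> polys (2 * (t + t))"
    by (rule positive_functional_sos[where L = L and E = E and K = K and D = "t + t"];
        fact K const add cm mu Ladd Lcm pos)+
  have "G = (\<lambda>w. L (\<lambda>z. (K z w)\<^sup>2))" by (simp add: G_def L_def K_def)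
  then show "is_sos G" "G \<in> polys (4 * t)" using sos by auto
qed

lemma product_kernel_eigen:
  fixes u :: "real poly" and g :: "('n::finite \<Rightarrow> real) \<Rightarrow> ('n \<Rightarrow> real) \<Rightarrow> real"
  assumes lam: "\<And>k h x. h \<in> harm_polys k \<Longrightarrow> x \<in> sphere_set \<Longrightarrow>
      sph_mean (\<lambda>y::'n \<Rightarrow> real. (poly u (ip x y))\<^sup>2 * h y) = lam k * h x"
    and g: "tensor (harm_polys j) (harm_polys k) g" and w: "w1 \<in> sphere_set" "w2 \<in> sphere_set"
  shows "pmean (\<lambda>x y. g x y * (poly u (ip x w1) * poly u (ip y w2))\<^sup>2) = lam j * lam k * g w1 w2"
  using g
proof (induction rule: tensor.induct)
  case zero then show ?case by (simp add: pmean_zero)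
next
  case (step f h g)
  let ?U = "\<lambda>w x. (poly u (ip x w))\<^sup>2"
  have Up: "?U w \<in> polyfun" for w :: "'n \<Rightarrow> real"
    unfolding ip_commute[of _ w] by (intro polyfun_intros polyfun_poly_ip)
  have fp: "(\<lambda>x. ?U w1 x * f x) \<in> polyfun" "(\<lambda>x. ?U w2 x * h x) \<in> polyfun"
    by (rule polyfun_mult[OF Up harm_polyfun[OF step(1)]], rule polyfun_mult[OF Up harm_polyfun[OF step(2)]])
  have bU: "bipoly (\<lambda>x y. ?U w1 x * ?U w2 y)" by (intro tensor_prod Up)
  have "pmean (\<lambda>x y. (f x * h y + g x y) * (poly u (ip x w1) * poly u (ip y w2))\<^sup>2)
     = pmean (\<lambda>x y. (?U w1 x * f x) * (?U w2 y * h y) + g x y * (?U w1 x * ?U w2 y))"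
    by (simp add: power_mult_distrib distrib_right mult_ac)
  also have "\<dots> = pmean (\<lambda>x y. (?U w1 x * f x) * (?U w2 y * h y)) + pmean (\<lambda>x y. g x y * (?U w1 x * ?U w2 y))"
    by (intro pmean_add tensor_prod fp bipoly_mult bU bipoly_harm[OF step(3)])
  also have "pmean (\<lambda>x y. (?U w1 x * f x) * (?U w2 y * h y)) = (lam j * f w1) * (lam k * h w2)"
    using lam[OF step(1) w(1)] lam[OF step(2) w(2)] by (simp add: pmean_prod fp ip_commute)
  also have "pmean (\<lambda>x y. g x y * (?U w1 x * ?U w2 y)) = lam j * lam k * g w1 w2"
    using step(4) by (simp add: power_mult_distrib)
  finally show ?case by (simp add: algebra_simps)
qed

section \<open>Counting bidegrees and estimating inverted eigenvalues\<close>

lemma card_pairs: "(\<Sum>j\<le>d. \<Sum>k\<le>d. if j + k \<le> d then (1::real) else 0) = real ((d + 2) choose 2)"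
proof -
  have "(\<Sum>k\<le>d. if j + k \<le> d then (1::real) else 0) = real (d - j) + 1" if "j \<le> d" for j
  proof -
    have "(\<Sum>k\<le>d. if j + k \<le> d then (1::real) else 0) = (\<Sum>k\<in>{..d - j}. 1)"
      by (rule sum.mono_neutral_cong_right) (use that in auto)
    then show ?thesis by simp
  qed
  then have "(\<Sum>j\<le>d. \<Sum>k\<le>d. if j + k \<le> d then (1::real) else 0) = (\<Sum>j\<le>d. real (d - j) + 1)"
    by simp
  also have "\<dots> = (\<Sum>j\<le>d. real j + 1)"
    by (rule sum.reindex_bij_witness[of _ "\<lambda>j. d - j" "\<lambda>j. d - j"]) auto
  also have "\<dots> = real ((d + 2) choose 2)"
  proof (induction d)
    case (Suc d)
    have "Suc (d + 2) choose 2 = ((d + 2) choose 1) + ((d + 2) choose 2)"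
      by (simp add: numeral_2_eq_2)
    then show ?case using Suc by simp
  qed (simp add: numeral_2_eq_2)
  finally show ?thesis .
qed

text \<open>1 - a b <= (1 - a) + (1 - b) <= 1/4 keeps a b away from 0; the 8 of \<open>C_X\<close>
  enters through 8 a b >= 1.\<close>

lemma inverse_eigenvalue_bound:
  fixes a b e :: real
  assumes "a \<le> 1" "b \<le> 1" "(1 - a) + (1 - b) \<le> e" "e \<le> 1 / 4"
  shows "a * b > 0" "\<bar>1 / (a * b) - 1\<bar> \<le> 8 * e"
proof -
  have "(1 - a) * (1 - b) \<ge> 0" using assms by simp
  then have "1 - a * b \<le> (1 - a) + (1 - b)" by (simp add: algebra_simps)
  then have 1: "1 - a * b \<le> e" using assms by linarith
  then show pos: "a * b > 0" using assms by linarith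
  have "a \<ge> 0" "b \<ge> 0" using assms by linarith+
  then have ab1: "a * b \<le> 1" using assms by (simp add: mult_le_one)
  have "1 / (a * b) - 1 = (1 - a * b) / (a * b)" using pos by (metis diff_divide_distrib divide_self less_irrefl)
  also have "\<dots> \<le> e / (a * b)" using 1 pos by (simp add: divide_right_mono)
  also have "\<dots> \<le> 8 * e"
  proof -
    have "e \<ge> 0" using 1 ab1 by linarith
    moreover have "8 * (a * b) \<ge> 1" using 1 assms by linarith
    ultimately have "e * 1 \<le> e * (8 * (a * b))" by (intro mult_left_mono)
    then show ?thesis using pos by (simp add: divide_le_eq)
  qed
  finally have "1 / (a * b) - 1 \<le> 8 * e" .
  moreover have "1 / (a * b) - 1 \<ge> 0" using pos ab1 by simp
  ultimately show "\<bar>1 / (a * b) - 1\<bar> \<le> 8 * e" by simp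
qed

text \<open>Squared, the hypothesis on t reads n^2 d^3 / t^2 <= 1/4. The cube of d absorbs j^2 + k^2
  <= d^2.\<close>

lemma pair_eigenvalue_bound:
  fixes n t d :: nat
  assumes d: "d \<ge> 1" and n: "n \<ge> 1" and t: "real t \<ge> 2 * real n * real d * sqrt (real d)"
    and lam: "\<And>k. lam k \<le> 1 \<and> 1 - lam k \<le> (real k)\<^sup>2 * (real n)\<^sup>2 / (real t)\<^sup>2" and jk: "j + k \<le> d"
  shows "lam j * lam k > 0" "\<bar>1 / (lam j * lam k) - 1\<bar> \<le> 8 * ((real n)\<^sup>2 * real d ^ 3 / (real t)\<^sup>2)"
proof -
  let ?e = "(real n)\<^sup>2 * real d ^ 3 / (real t)\<^sup>2"
  have "0 < 2 * real n * real d * sqrt (real d)" using n d by simp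
  then have tpos: "real t > 0" using t by linarith
  have "(2 * real n * real d * sqrt (real d))\<^sup>2 \<le> (real t)\<^sup>2" using t by (intro power_mono) auto
  moreover have "(2 * real n * real d * sqrt (real d))\<^sup>2 = 4 * ((real n)\<^sup>2 * real d ^ 3)"
    by (simp add: power_mult_distrib power2_eq_square power3_eq_cube)
  ultimately have e: "?e \<le> 1 / 4" using tpos by (simp add: divide_le_eq)
  have "(real j)\<^sup>2 + (real k)\<^sup>2 \<le> (real j + real k)\<^sup>2" by (simp add: power2_sum)
  also have "\<dots> \<le> (real d)\<^sup>2" using jk by (intro power_mono) (auto simp flip: of_nat_add)
  also have "\<dots> \<le> real d ^ 3" using d by (intro power_increasing) auto
  finally have jkd: "((real j)\<^sup>2 + (real k)\<^sup>2) * ((real n)\<^sup>2 / (real t)\<^sup>2) \<le> real d ^ 3 * ((real n)\<^sup>2 / (real t)\<^sup>2)"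
    by (rule mult_right_mono) simp
  have "(1 - lam j) + (1 - lam k) \<le> (real j)\<^sup>2 * (real n)\<^sup>2 / (real t)\<^sup>2 + (real k)\<^sup>2 * (real n)\<^sup>2 / (real t)\<^sup>2"
    using lam by (intro add_mono) auto
  also have "\<dots> = ((real j)\<^sup>2 + (real k)\<^sup>2) * ((real n)\<^sup>2 / (real t)\<^sup>2)"
    by (simp add: distrib_right add_divide_distrib)
  also note jkd
  also have "real d ^ 3 * ((real n)\<^sup>2 / (real t)\<^sup>2) = ?e" by simp
  finally have "(1 - lam j) + (1 - lam k) \<le> ?e" .
  from inverse_eigenvalue_bound[OF _ _ this e] lam
  show "lam j * lam k > 0" "\<bar>1 / (lam j * lam k) - 1\<bar> \<le> 8 * ?e" by auto
qed

lemma polyfun_bounded_on_XX: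
  assumes "f \<in> polyfun"
  shows "\<exists>C. \<forall>z\<in>XX. \<bar>f (z :: 'n::finite + 'n \<Rightarrow> real)\<bar> \<le> C"
proof -
  from polyfun_bounded_on_cube[OF assms] obtain C where C: "\<And>z. (\<forall>i. \<bar>z i\<bar> \<le> 1) \<Longrightarrow> \<bar>f z\<bar> \<le> C" by blast
  have "\<bar>z i\<bar> \<le> 1" if "z \<in> XX" for z :: "'n + 'n \<Rightarrow> real" and i
    using abs_coord_le_1[of "xpart z"] abs_coord_le_1[of "ypart z"] that
    by (cases i) (auto simp: XX_def sphere_set_def xpart_def ypart_def)
  then show ?thesis using C by blast
qed

lemma XX_parts: "z \<in> XX \<Longrightarrow> xpart z \<in> sphere_set \<and> ypart z \<in> sphere_set"
  by (simp add: XX_def sphere_set_def)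

lemma shifted_in_trunc_preord:
  fixes q :: "('n::finite + 'n \<Rightarrow> real) \<Rightarrow> real" and d t :: nat
  assumes d: "d \<ge> 1" and q: "q \<in> polys d"
    and t: "real t \<ge> 2 * real CARD('n) * real d * sqrt (real d)"
    and nn: "\<And>z. z \<in> XX \<Longrightarrow> 0 \<le> q z" and R: "\<And>z. z \<in> XX \<Longrightarrow> q z \<le> R"
  shows "(\<lambda>z. q z + C_X TYPE('n) d / (real t)\<^sup>2 * R) \<in> trunc_preord (2 * t)"
proof -
  let ?n = "CARD('n)" and ?\<gamma> = "gamma_sph TYPE('n) d"
  let ?e = "(real ?n)\<^sup>2 * real d ^ 3 / (real t)\<^sup>2"
  define \<delta> where "\<delta> = C_X TYPE('n) d / (real t)\<^sup>2 * R"
  have n1: "?n \<ge> 1" using one_le_card_finite[where 'a='n] by simp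
  have "sqrt (real d) \<ge> 1" using d by simp
  then have "2 * real ?n * real d * sqrt (real d) \<ge> 2 * real ?n * real d * 1"
    by (intro mult_left_mono) auto
  then have t2: "real t \<ge> 2 * real ?n * real d" using t by linarith
  then have "real (2 * ?n * d) \<le> real t" by simp
  then have t3: "t \<ge> 2 * ?n * d" by (simp only: of_nat_le_iff)
  \<comment> \<open>n <= t is the condition of \<open>concentrated_kernel\<close>; d <= t keeps
    \<open>q\<close> within degree 4 t.\<close>
  have nt: "?n \<le> t" and dt: "d \<le> t" and t1: "t \<ge> 1"
  proof -
    have "?n \<le> ?n * d" "d \<le> ?n * d" using d n1 by simp_all
    then show "?n \<le> t" "d \<le> t" using t3 by linarith+
    then show "t \<ge> 1" using n1 by linarith
  qed
  obtain u lam where deg: "degree u \<le> t" and lam0: "lam 0 = 1"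
    and lam: "\<And>k. lam k \<le> 1 \<and> 1 - lam k \<le> (real k)\<^sup>2 * (real ?n)\<^sup>2 / (real t)\<^sup>2"
    and eig: "\<And>k h x. h \<in> harm_polys k \<Longrightarrow> x \<in> sphere_set \<Longrightarrow>
      sph_mean (\<lambda>y::'n \<Rightarrow> real. (poly u (ip x y))\<^sup>2 * h y) = lam k * h x"
    using concentrated_kernel[OF t1 nt] by blast
  obtain g r1 r2 where dec: "biharm_decomp d q g r1 r2" using biharm_decomp_exists[OF q] by blast
  then have g: "\<And>j k. tensor (harm_polys j) (harm_polys k) (g j k)"
    and g0: "\<And>j k. j + k > d \<Longrightarrow> g j k = (\<lambda>x y. 0)"
    and qeq: "q = (\<lambda>z. (\<Sum>j\<le>d. \<Sum>k\<le>d. g j k (xpart z) (ypart z))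
      + r1 z * (1 - sq_norm (xpart z)) + r2 z * (1 - sq_norm (ypart z)))"
    unfolding biharm_decomp_def by auto
  have qS: "q (case_sum x y) = (\<Sum>j\<le>d. \<Sum>k\<le>d. g j k x y)" if "x \<in> sphere_set" "y \<in> sphere_set" for x y
    using that unfolding qeq by (simp add: sphere_set_def)
  have absR: "\<bar>q z\<bar> \<le> R" if "z \<in> XX" for z using nn[OF that] R[OF that] by simp
  have gb: "\<bar>g j k x y\<bar> \<le> ?\<gamma>\<^sup>2 * R" if "j \<le> d" "k \<le> d" "x \<in> sphere_set" "y \<in> sphere_set" for j k x y
    by (rule biharm_component_bound[OF dec q absR that])
  \<comment> \<open>Eigenvalues are known to be positive only for j + k <= d. Beyond that the
    quotient may be a division by 0, but there \<open>g j k\<close> is 0.\<close>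
  define c where "c = (\<lambda>j k. 1 / (lam j * lam k))"
  \<comment> \<open>The preimage of q + \<open>\<delta>\<close> under the kernel operator.\<close>
  define F where "F = (\<lambda>x y. (\<Sum>j\<le>d. \<Sum>k\<le>d. c j k * g j k x y) + \<delta>)"
  \<comment> \<open>The constant is treated as a component of bidegree (0, 0), which the kernel
    fixes because \<open>lam 0 = 1\<close>.\<close>
  define one :: "('n \<Rightarrow> real) \<Rightarrow> ('n \<Rightarrow> real) \<Rightarrow> real" where "one = (\<lambda>x y. 1)"
  have one: "tensor (harm_polys 0) (harm_polys 0) one"
    using tensor_prod[OF harm_less_2[OF hom_const[of 1]] harm_less_2[OF hom_const[of 1]]] by (simp add: one_def)
  have bg: "bipoly (\<lambda>x y. c j k * g j k x y)" for j k by (intro bipoly_cmult bipoly_harm[OF g])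
  have F_eq: "F = (\<lambda>x y. (\<Sum>j\<le>d. \<Sum>k\<le>d. c j k * g j k x y) + \<delta> * one x y)" by (simp add: F_def one_def)
  have bF: "bipoly F" unfolding F_eq by (intro tensor_add tensor_sum bg bipoly_cmult bipoly_harm[OF one])
  have Fnn: "F x y \<ge> 0" if xy: "x \<in> sphere_set" "y \<in> sphere_set" for x y
  proof -
    have XXxy: "case_sum x y \<in> XX" using xy by (simp add: XX_case_sum)
    have "R \<ge> 0" using nn[OF XXxy] R[OF XXxy] by linarith
    \<comment> \<open>On the spheres F - (q + \<open>\<delta>\<close>) consists of the terms (c - 1)
      g. Eigenvalue bound times component bound, summed over all pairs, is precisely
      \<open>\<delta>\<close>.\<close>
    have summand: "\<bar>(c j k - 1) * g j k x y\<bar> \<le> (if j + k \<le> d then 1 else 0) * (8 * ?e * (?\<gamma>\<^sup>2 * R))"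
      if "j \<le> d" "k \<le> d" for j k
    proof (cases "j + k \<le> d")
      case True
      have "\<bar>c j k - 1\<bar> \<le> 8 * ?e" unfolding c_def by (rule pair_eigenvalue_bound[OF d n1 t lam True])
      then have "\<bar>c j k - 1\<bar> * \<bar>g j k x y\<bar> \<le> 8 * ?e * (?\<gamma>\<^sup>2 * R)"
        using gb[OF that xy] by (intro mult_mono) auto
      then show ?thesis using True by (simp add: abs_mult)
    next
      case False then show ?thesis by (simp add: g0)
    qed
    have "\<bar>\<Sum>j\<le>d. \<Sum>k\<le>d. (c j k - 1) * g j k x y\<bar> \<le> (\<Sum>j\<le>d. \<Sum>k\<le>d. \<bar>(c j k - 1) * g j k x y\<bar>)"
      by (intro order_trans[OF sum_abs] sum_mono sum_abs)
    also have "\<dots> \<le> (\<Sum>j\<le>d. \<Sum>k\<le>d. (if j + k \<le> d then 1 else 0) * (8 * ?e * (?\<gamma>\<^sup>2 * R)))"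
      by (intro sum_mono summand) auto
    also have "\<dots> = real ((d + 2) choose 2) * (8 * ?e * (?\<gamma>\<^sup>2 * R))"
      unfolding card_pairs[symmetric] sum_distrib_right ..
    also have "\<dots> = \<delta>" by (simp add: \<delta>_def C_X_def)
    finally have "(\<Sum>j\<le>d. \<Sum>k\<le>d. (c j k - 1) * g j k x y) \<ge> - \<delta>" by linarith
    moreover have "F x y = q (case_sum x y) + (\<Sum>j\<le>d. \<Sum>k\<le>d. (c j k - 1) * g j k x y) + \<delta>"
      unfolding F_def qS[OF xy] by (simp add: left_diff_distrib sum_subtractf)
    ultimately show ?thesis using nn[OF XXxy] by linarith
  qed
  define K where "K = (\<lambda>w (x::'n \<Rightarrow> real) (y::'n \<Rightarrow> real). (poly u (ip x (xpart w)) * poly u (ip y (ypart w)))\<^sup>2)"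
  define G where "G = (\<lambda>w::'n + 'n \<Rightarrow> real. pmean (\<lambda>x y. F x y * K w x y))"
  have sos: "is_sos G" and Gp: "G \<in> polys (4 * t)"
    unfolding G_def K_def using product_kernel_sos[OF bF Fnn deg] by blast+
  have GX: "G w = q w + \<delta>" if w: "w \<in> XX" for w
  proof -
    have wS: "xpart w \<in> sphere_set" "ypart w \<in> sphere_set" using XX_parts[OF w] by auto
    have bU: "(\<lambda>x. (poly u (ip x v))\<^sup>2) \<in> polyfun" for v :: "'n \<Rightarrow> real"
      unfolding ip_commute[of _ v] by (intro polyfun_intros polyfun_poly_ip)
    have bK: "bipoly (K w)" unfolding K_def power_mult_distrib by (intro tensor_prod bU)
    have eigK: "pmean (\<lambda>x y. h x y * K w x y) = lam j * lam k * h (xpart w) (ypart w)"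
      if "tensor (harm_polys j) (harm_polys k) h" for j k h
      unfolding K_def by (rule product_kernel_eigen[where lam = lam, OF _ that wS]) (rule eig)
    have bgK: "bipoly (\<lambda>x y. c j k * (g j k x y * K w x y))" for j k
      by (intro bipoly_cmult bipoly_mult bipoly_harm[OF g] bK)
    have boK: "bipoly (\<lambda>x y. \<delta> * (one x y * K w x y))"
      by (intro bipoly_cmult bipoly_mult bipoly_harm[OF one] bK)
    have "G w = pmean (\<lambda>x y. (\<Sum>j\<le>d. \<Sum>k\<le>d. c j k * (g j k x y * K w x y)) + \<delta> * (one x y * K w x y))"
      unfolding G_def F_eq by (simp add: distrib_right sum_distrib_right mult.assoc)
    also have "\<dots> = (\<Sum>j\<le>d. \<Sum>k\<le>d. pmean (\<lambda>x y. c j k * (g j k x y * K w x y))) + pmean (\<lambda>x y. \<delta> * (one x y * K w x y))"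
      by (simp add: pmean_add pmean_sum tensor_sum bgK boK)
    also have "pmean (\<lambda>x y. \<delta> * (one x y * K w x y)) = \<delta>"
    proof -
      have "pmean (\<lambda>x y. \<delta> * (one x y * K w x y)) = \<delta> * pmean (\<lambda>x y. one x y * K w x y)"
        by (intro pmean_cmult bipoly_mult bipoly_harm[OF one] bK)
      then show ?thesis unfolding eigK[OF one] by (simp add: lam0 one_def)
    qed
    also have "(\<Sum>j\<le>d. \<Sum>k\<le>d. pmean (\<lambda>x y. c j k * (g j k x y * K w x y)))
        = (\<Sum>j\<le>d. \<Sum>k\<le>d. g j k (xpart w) (ypart w))"
    proof (intro sum.cong refl)
      fix j k
      have "pmean (\<lambda>x y. c j k * (g j k x y * K w x y)) = c j k * (lam j * lam k * g j k (xpart w) (ypart w))"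
        unfolding eigK[OF g, symmetric] by (intro pmean_cmult bipoly_mult bipoly_harm[OF g] bK)
      also have "\<dots> = g j k (xpart w) (ypart w)"
      proof (cases "j + k \<le> d")
        case True
        have "lam j * lam k > 0" by (rule pair_eigenvalue_bound(1)[OF d n1 t lam True])
        then show ?thesis by (auto simp: c_def)
      next
        case False then show ?thesis by (simp add: g0)
      qed
      finally show "pmean (\<lambda>x y. c j k * (g j k x y * K w x y)) = g j k (xpart w) (ypart w)" .
    qed
    also have "\<dots> = q w" using qS[OF wS] by (simp add: case_sum_parts)
    finally show ?thesis .
  qed
  \<comment> \<open>\<open>GX\<close> is an identity on \<open>XX\<close> only. The defect vanishes
    there and has degree at most 4 t, which gives multipliers of degree 4 t - 2, as
    \<open>trunc_preord (2 * t)\<close> demands.\<close>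
  define f where "f = (\<lambda>z. (q z + \<delta>) + (-1) * G z)"
  have "f \<in> polys (4 * t)"
    unfolding f_def using dt by (intro polys_add polys_cmult Gp polys_const polys_mono[OF q]) auto
  moreover have "f z = 0" if "z \<in> XX" for z using GX[OF that] by (simp add: f_def)
  ultimately obtain h1 h2 where h: "h1 \<in> polys (4 * t - 2)" "h2 \<in> polys (4 * t - 2)"
    and feq: "f = (\<lambda>z. h1 z * (1 - sq_norm (xpart z)) + h2 z * (1 - sq_norm (ypart z)))"
    using vanishing_in_ideal[of f "4 * t"] by blast
  have "q z + \<delta> = G z + h1 z * (1 - sq_norm (xpart z)) + h2 z * (1 - sq_norm (ypart z))" for z
    using fun_cong[OF feq, of z] by (simp add: f_def)
  then show ?thesis
    unfolding trunc_preord_def \<delta>_def[symmetric] using sos Gp h by auto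
qed

theorem theorem3:
  fixes q :: "('n::finite + 'n \<Rightarrow> real) \<Rightarrow> real" and d t :: nat
  assumes "d \<ge> 1"
    and "q \<in> polys d" and "q \<notin> polys (d - 1)"
    and "real t \<ge> 2 * real CARD('n) * real d * sqrt (real d)"
  shows "ereal (Inf (q ` XX)) - lb q (2 * t)
           \<le> ereal (C_X TYPE('n) d / (real t)^2 * (Sup (q ` XX) - Inf (q ` XX)))"
proof -
  define m where "m = Inf (q ` XX)"
  define \<delta> where "\<delta> = C_X TYPE('n) d / (real t)\<^sup>2 * (Sup (q ` XX) - m)"
  obtain C where C: "\<And>z. z \<in> XX \<Longrightarrow> \<bar>q z\<bar> \<le> C"
    using polyfun_bounded_on_XX[OF polyfunI[OF assms(2)]] by blast
  have bdd: "bdd_below (q ` XX)" "bdd_above (q ` XX)"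
    using C by (auto intro!: bdd_belowI2[of _ "- C"] bdd_aboveI2[of _ _ C] simp: abs_le_iff minus_le_iff)
  have "m \<le> q z" "q z \<le> Sup (q ` XX)" if "z \<in> XX" for z
    using that bdd by (auto simp: m_def intro: cINF_lower cSUP_upper)
  moreover have "(\<lambda>z. q z + (- m)) \<in> polys d" by (intro polys_add assms(2) polys_const)
  ultimately have "(\<lambda>z. q z - m + \<delta>) \<in> trunc_preord (2 * t)"
    using shifted_in_trunc_preord[of d "\<lambda>z. q z - m" t "Sup (q ` XX) - m"] assms(1,4)
    by (simp add: \<delta>_def)
  then have "(\<lambda>z. q z - (m - \<delta>)) \<in> trunc_preord (2 * t)" by (simp add: algebra_simps)
  then have "ereal (m - \<delta>) \<le> lb q (2 * t)" unfolding lb_def by (intro Sup_upper) auto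
  \<comment> \<open>A real lower bound excludes the value -infinity of \<open>lb\<close>, and the
    value infinity would make the difference -infinity.\<close>
  then have "ereal m - lb q (2 * t) \<le> ereal \<delta>" by (cases "lb q (2 * t)") auto
  then show ?thesis by (simp add: m_def \<delta>_def)
qed

end
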